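(* In the linear homoskedastic model described in the context, assume that the design vectors $x_{1,n},\dots,x_{n,n}$ are i.i.d. Gaussian with mean $\mu_n\in\mathbb{R}^{p_n}$ and positive definite covariance matrix $\Sigma_n$, and that the design $X_n=[x_{1,n},\dots,x_{n,n}]'$ is independent of the errors $(\varepsilon_{1,n},\dots,\varepsilon_{n,n})'$, which satisfy $\mathbb{E}[(\varepsilon_{1,n}/\sigma_n)^4]=O(1)$ as $n\to\infty$. Moreover, suppose that $\limsup_np_n/n<1$, $\Delta_\gamma=o(q_n/n)$, and that the null hypothesis does not involve a restriction on the intercept parameter (i.e., the first column of $R_0$ is equal to zero). If $q_n=q\in\mathbb{N}$ does not depend on $n$, then $$s_n^{-1/2}(F_n-1)-\sqrt{n}\,\Delta_\gamma b_n\;\xrightarrow[n\to\infty]{w}\;(2q)^{-1/2}\chi_q^2-\sqrt{q/2},$$ where $s_n=2\left(\frac{1}{q_n}+\frac{1}{n-p_n-1}\right)$ and $b_n=\sqrt{\frac{(1-(p_n+1)/n)(1-(p_n+1)/n+q_n/n)}{2q_n/n}}$.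
   Context: Model. For each $n$, $p_n$ is a positive integer with $p_n<n-1$ and $(y_{i,n},x_{i,n})_{i=1}^n$ are i.i.d. pairs, $y_{i,n}$ real-valued and $x_{i,n}$ a random vector in $\mathbb{R}^{p_n}$, with $\mathbb{E}[y_{1,n}|x_{1,n}]=\alpha_n+\beta_n'x_{1,n}$ and $\mathrm{Var}[y_{1,n}|x_{1,n}]=\sigma_n^2\in(0,\infty)$ (non-random); $\varepsilon_{i,n}=y_{i,n}-\mathbb{E}[y_{i,n}|x_{i,n}]$. Let $\mu_n=\mathbb{E}[x_{1,n}]$ and $\Sigma_n=\mathrm{Var}[x_{1,n}]$. Write $Y=(y_{1,n},\dots,y_{n,n})'$, $\iota_n=(1,\dots,1)'\in\mathbb{R}^n$, $U=[\iota_n,X_n]$, $\gamma=(\alpha_n,\beta_n')'$. The prime denotes transpose. Hypothesis and test statistic. $R_0$ (depending on $n$) is a $q_n\times(p_n+1)$ non-random matrix of rank $q_n$, $1\le q_n\le p_n+1$, normalized to have orthonormal rows, and $r_0\in\mathbb{R}^{q_n}$; the null hypothesis is $H_0:R_0\gamma=r_0$. With $\hat\gamma_n=(U'U)^{-1}U'Y$, $$F_n=\frac{(R_0\hat\gamma_n-r_0)'(R_0(U'U)^{-1}R_0')^{-1}(R_0\hat\gamma_n-r_0)/q_n}{\|Y-U\hat\gamma_n\|^2/(n-p_n-1)}$$ whenever all appearing quantities are well defined, and $F_n=0$ otherwise. Further, $S_n=\begin{bmatrix}1&\mu_n'\\ \mu_n&\Sigma_n+\mu_n\mu_n'\end{bmatrix}$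 and $\Delta_\gamma=(R_0\gamma-r_0)'(R_0S_n^{-1}R_0')^{-1}(R_0\gamma-r_0)/\sigma_n^2$. Notation. $\xrightarrow{w}$ is weak convergence; $(2q)^{-1/2}\chi_q^2-\sqrt{q/2}$ denotes the law of $(2q)^{-1/2}K-\sqrt{q/2}$ for $K$ chi-squared distributed with $q$ degrees of freedom. *)

theory Defs
  imports
    "HOL-Probability.Probability"
    "HOL-Library.Landau_Symbols"
    "Jordan_Normal_Form.Matrix"
    "Jordan_Normal_Form.Determinant"
    "Jordan_Normal_Form.Gauss_Jordan_Elimination"
    "Jordan_Normal_Form.DL_Rank"
begin

no_notation inner (infix \<open>\<bullet>\<close> 70)
no_notation vec_nth (infixl \<open>$\<close> 90)
hide_const (open) Finite_Cartesian_Product.vec Determinants.det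

text \<open>
  All dimensions vary with the sample size. Deterministic vectors and matrices therefore have the
  types \<open>real vec\<close> and \<open>real mat\<close>, while random vectors take values in the space \<open>Rn p\<close> of functions
  on \<open>{..<p}\<close>, which carries the Borel sets and Lebesgue measure on p-dimensional Euclidean space.
  The function \<open>vec p\<close> converts from the latter representation to the former. Indices start at 0.
\<close>

abbreviation Rn :: "nat \<Rightarrow> (nat \<Rightarrow> real) measure" where
  "Rn p \<equiv> (\<Pi>\<^sub>M j\<in>{..<p}. lborel)"

text \<open>Inverse of a square matrix; unspecified if the matrix is singular.\<close>

definition inv_mat :: "real mat \<Rightarrow> real mat" where
  "inv_mat A = the (mat_inverse A)"

definition pos_definite :: "nat \<Rightarrow> real mat \<Rightarrow> bool" where
  "pos_definite p A \<longleftrightarrow> A \<in> carrier_mat p p \<and> A\<^sup>T = A \<and>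
     (\<forall>v\<in>carrier_vec p. v \<noteq> 0\<^sub>v p \<longrightarrow> v \<bullet> (A *\<^sub>v v) > 0)"

definition mean_vec :: "'a measure \<Rightarrow> nat \<Rightarrow> ('a \<Rightarrow> nat \<Rightarrow> real) \<Rightarrow> real vec" where
  "mean_vec M p X = vec p (\<lambda>j. \<integral>\<omega>. X \<omega> j \<partial>M)"

definition cov_mat :: "'a measure \<Rightarrow> nat \<Rightarrow> ('a \<Rightarrow> nat \<Rightarrow> real) \<Rightarrow> real mat" where
  "cov_mat M p X = mat p p (\<lambda>(j, k).
     \<integral>\<omega>. (X \<omega> j - mean_vec M p X $ j) * (X \<omega> k - mean_vec M p X $ k) \<partial>M)"

definition gaussian_density :: "nat \<Rightarrow> real vec \<Rightarrow> real mat \<Rightarrow> real vec \<Rightarrow> real" where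
  "gaussian_density p \<mu> \<Sigma> z =
     exp (- ((z - \<mu>) \<bullet> (inv_mat \<Sigma> *\<^sub>v (z - \<mu>))) / 2) / sqrt ((2 * pi) ^ p * det \<Sigma>)"

definition gaussian :: "'a measure \<Rightarrow> nat \<Rightarrow> ('a \<Rightarrow> nat \<Rightarrow> real) \<Rightarrow> real vec \<Rightarrow> real mat \<Rightarrow> bool" where
  "gaussian M p X \<mu> \<Sigma> \<longleftrightarrow> \<mu> \<in> carrier_vec p \<and> pos_definite p \<Sigma> \<and>
     distributed M (Rn p) X (\<lambda>z. ennreal (gaussian_density p \<mu> \<Sigma> (vec p z)))"

definition cond_mean :: "'a measure \<Rightarrow> nat \<Rightarrow> ('a \<Rightarrow> real) \<Rightarrow> ('a \<Rightarrow> nat \<Rightarrow> real) \<Rightarrow> 'a \<Rightarrow> real" where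
  "cond_mean M p Y X = real_cond_exp M (vimage_algebra (space M) X (Rn p)) Y"

definition model_error :: "'a measure \<Rightarrow> nat \<Rightarrow> ('a \<Rightarrow> real) \<Rightarrow> ('a \<Rightarrow> nat \<Rightarrow> real) \<Rightarrow> 'a \<Rightarrow> real" where
  "model_error M p Y X \<omega> = Y \<omega> - cond_mean M p Y X \<omega>"

definition cond_var :: "'a measure \<Rightarrow> nat \<Rightarrow> ('a \<Rightarrow> real) \<Rightarrow> ('a \<Rightarrow> nat \<Rightarrow> real) \<Rightarrow> 'a \<Rightarrow> real" where
  "cond_var M p Y X = cond_mean M p (\<lambda>\<omega>. (model_error M p Y X \<omega>)\<^sup>2) X"

definition iid :: "'a measure \<Rightarrow> 'b measure \<Rightarrow> nat \<Rightarrow> (nat \<Rightarrow> 'a \<Rightarrow> 'b) \<Rightarrow> bool" where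
  "iid M N n Z \<longleftrightarrow> prob_space.indep_vars M (\<lambda>_. N) Z {..<n} \<and>
     (\<forall>i<n. distr M N (Z i) = distr M N (Z 0))"

text \<open>
  The linear homoskedastic model for one sample size n. Integrability of the response and of
  the squared error is what makes the conditional mean and the conditional variance meaningful,
  since \<open>real_cond_exp\<close> is total.
\<close>

definition linear_model ::
  "'a measure \<Rightarrow> nat \<Rightarrow> nat \<Rightarrow> (nat \<Rightarrow> 'a \<Rightarrow> real) \<Rightarrow> (nat \<Rightarrow> 'a \<Rightarrow> nat \<Rightarrow> real) \<Rightarrow>
     real \<Rightarrow> real vec \<Rightarrow> real \<Rightarrow> bool" where
  "linear_model M n p y x \<alpha> \<beta> \<sigma> \<longleftrightarrow>
     prob_space M \<and> 0 < p \<and> p + 1 < n \<and> \<beta> \<in> carrier_vec p \<and> 0 < \<sigma> \<and>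
     iid M (borel \<Otimes>\<^sub>M Rn p) n (\<lambda>i \<omega>. (y i \<omega>, x i \<omega>)) \<and>
     integrable M (y 0) \<and>
     (AE \<omega> in M. cond_mean M p (y 0) (x 0) \<omega> = \<alpha> + \<beta> \<bullet> vec p (x 0 \<omega>)) \<and>
     integrable M (\<lambda>\<omega>. (model_error M p (y 0) (x 0) \<omega>)\<^sup>2) \<and>
     (AE \<omega> in M. cond_var M p (y 0) (x 0) \<omega> = \<sigma>\<^sup>2)"

text \<open>
  Independence of the design and the error vector is independence of the sigma-algebras they
  generate: \<open>prob_space.indep_var\<close> would force both to have values in the same type.
\<close>

definition design_indep_errors ::
  "'a measure \<Rightarrow> nat \<Rightarrow> nat \<Rightarrow> (nat \<Rightarrow> 'a \<Rightarrow> real) \<Rightarrow> (nat \<Rightarrow> 'a \<Rightarrow> nat \<Rightarrow> real) \<Rightarrow> bool" where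
  "design_indep_errors M n p y x \<longleftrightarrow>
     prob_space.indep_set M
       (sets (vimage_algebra (space M) (\<lambda>\<omega>. \<lambda>i\<in>{..<n}. x i \<omega>) (\<Pi>\<^sub>M i\<in>{..<n}. Rn p)))
       (sets (vimage_algebra (space M)
          (\<lambda>\<omega>. \<lambda>i\<in>{..<n}. model_error M p (y i) (x i) \<omega>) (Rn n)))"

definition response_vec :: "nat \<Rightarrow> (nat \<Rightarrow> 'a \<Rightarrow> real) \<Rightarrow> 'a \<Rightarrow> real vec" where
  "response_vec n y \<omega> = vec n (\<lambda>i. y i \<omega>)"

definition design_mat :: "nat \<Rightarrow> nat \<Rightarrow> (nat \<Rightarrow> 'a \<Rightarrow> nat \<Rightarrow> real) \<Rightarrow> 'a \<Rightarrow> real mat" where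
  "design_mat n p x \<omega> = mat n (p + 1) (\<lambda>(i, j). if j = 0 then 1 else x i \<omega> (j - 1))"

text \<open>The F-statistic of \<open>R \<gamma> = r\<close> for response vector Y and regressor matrix U.\<close>

definition F_statistic :: "nat \<Rightarrow> nat \<Rightarrow> nat \<Rightarrow> real mat \<Rightarrow> real vec \<Rightarrow> real mat \<Rightarrow> real vec \<Rightarrow> real" where
  "F_statistic n p q R r U Y =
     (let G = U\<^sup>T * U;
          \<gamma>h = inv_mat G *\<^sub>v (U\<^sup>T *\<^sub>v Y);
          W = R * inv_mat G * R\<^sup>T;
          d = R *\<^sub>v \<gamma>h - r;
          e = Y - U *\<^sub>v \<gamma>h
      in if invertible_mat G \<and> invertible_mat W \<and> e \<bullet> e \<noteq> 0
         then ((d \<bullet> (inv_mat W *\<^sub>v d)) / real q) / ((e \<bullet> e) / (real n - real p - 1))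
         else 0)"

definition S_mat :: "nat \<Rightarrow> real vec \<Rightarrow> real mat \<Rightarrow> real mat" where
  "S_mat p \<mu> \<Sigma> = four_block_mat
     (1\<^sub>m 1)                 (mat_of_rows p [\<mu>])
     (mat_of_cols p [\<mu>])    (\<Sigma> + mat_of_cols p [\<mu>] * mat_of_rows p [\<mu>])"

definition Delta_gamma :: "real mat \<Rightarrow> real vec \<Rightarrow> real mat \<Rightarrow> real vec \<Rightarrow> real \<Rightarrow> real" where
  "Delta_gamma R r S \<gamma> \<sigma> =
     (let d = R *\<^sub>v \<gamma> - r in (d \<bullet> (inv_mat (R * inv_mat S * R\<^sup>T) *\<^sub>v d)) / \<sigma>\<^sup>2)"

definition restriction_mat :: "nat \<Rightarrow> nat \<Rightarrow> real mat \<Rightarrow> bool" where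
  "restriction_mat q k R \<longleftrightarrow> 1 \<le> q \<and> q \<le> k \<and> R \<in> carrier_mat q k \<and>
     vec_space.rank q R = q \<and> R * R\<^sup>T = 1\<^sub>m q"

text \<open>Chi-squared law: the sum of squares of q independent standard normal variables.\<close>

definition chi_squared :: "nat \<Rightarrow> real measure" where
  "chi_squared q =
     distr (\<Pi>\<^sub>M i\<in>{..<q}. density lborel std_normal_density) borel (\<lambda>z. \<Sum>i<q. (z i)\<^sup>2)"

definition s_seq :: "nat \<Rightarrow> nat \<Rightarrow> nat \<Rightarrow> real" where
  "s_seq n p q = 2 * (1 / real q + 1 / (real n - real p - 1))"

definition b_seq :: "nat \<Rightarrow> nat \<Rightarrow> nat \<Rightarrow> real" where
  "b_seq n p q = sqrt (((1 - (real p + 1) / real n) * (1 - (real p + 1) / real n + real q / real n))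
                       / (2 * real q / real n))"

end

theory Submission
  imports Defs
begin

text \<open>
  In a basis of the coefficient space that is orthonormal for \<open>S\<^sub>n\<close> and adapted to \<open>R\<^sub>0\<close>, the
  regressors split as \<open>U [D2, D1] = [Z, V]\<close>, where the hypothesis restricts the coefficients of
  \<open>Z\<close> only. Because \<open>R\<^sub>0\<close> does not involve the intercept, \<open>V\<close> keeps a constant column, and all
  other entries of \<open>Z\<close> and \<open>V\<close> are independent standard normal variables. Let \<open>Q\<close> project onto
  the orthogonal complement of the columns of \<open>V\<close>, let \<open>A = Z'QZ\<close> and let \<open>e\<close> be the standardised
  errors. Up to the factor \<open>1 / q\<close> and a common factor \<open>\<sigma>\<^sup>2\<close>, the numerator of \<open>F\<close> is \<open>w'A\<^sup>-\<^sup>1w\<close> with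
  \<open>w = Z'Qe + A\<delta>\<close> and \<open>\<delta>'\<delta> = \<Delta>\<close>. Given \<open>V\<close> and \<open>e\<close>, the vector \<open>g = Z'Qe / |Qe|\<close> is exactly
  standard normal, so that \<open>G = g'g\<close> is chi-squared for every \<open>n\<close>. With \<open>m = n - (p + 1 - q)\<close>,
  Chebyshev's inequality for quadratic forms in independent variables shows that \<open>A / m\<close> is close
  to the identity and \<open>|Qe|\<^sup>2 / m\<close> to 1, and likewise for the denominator of \<open>F\<close>. As \<open>n \<Delta>\<close> tends
  to 0, \<open>F\<close> is close to \<open>G / q\<close>; moreover \<open>s\<^sub>n\<close> tends to \<open>2 / q\<close> and the centring term is at most
  \<open>n \<Delta>\<close>, so the statistic differs from \<open>(2q)\<^sup>-\<^sup>1\<^sup>/\<^sup>2 G - (q/2)\<^sup>1\<^sup>/\<^sup>2\<close> by a term that vanishes in probability.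
\<close>

section \<open>Matrices over the reals\<close>

text \<open>With \<open>q\<close> fixed, the numerator stays random in the limit, so its law has to
  be found and not only its size. The errors have four controlled moments and a law that may vary
  with \<open>n\<close>; the limit law comes from the design. Conditioning on \<open>V\<close> and
  the errors freezes \<open>Qe\<close>, and only the normal entries of \<open>Z\<close> remain
  random. All other quantities need second moments of quadratic forms alone: the variance of
  \<open>e'Qe\<close> is at most a constant times its mean \<open>m\<close>, so relative deviations
  are of order \<open>m\<close> to the power -1/2. The condition on \<open>p / n\<close> enters
  through \<open>n - p - 1\<close>, the smallest number of degrees of freedom involved, which it
  forces to tend to infinity. Dimensions and probability spaces change with \<open>n\<close>. Hence
  the comparison of \<open>F\<close> with \<open>G\<close> is made for each \<open>n\<close> on its
  own space: outside an event of small probability it is an inequality of deterministic matrix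
  algebra, and singular matrices, for which \<open>inv_mat\<close> is unspecified, are put into that
  event. Since the law of \<open>G\<close> is the same for all \<open>n\<close>, closeness in
  probability then gives convergence of distribution functions.\<close>

lemma assoc_mult_mat_dim:
  fixes A :: "'a::semiring_0 mat"
  shows "dim_col A = dim_row B \<Longrightarrow> dim_col B = dim_row C \<Longrightarrow> A * B * C = A * (B * C)"
  by (rule assoc_mult_mat[of _ "dim_row A" "dim_col A" _ "dim_col B" _ "dim_col C"]) auto

lemma assoc_mult_mat_vec_dim:
  fixes A :: "'a::semiring_0 mat"
  shows "dim_col A = dim_row B \<Longrightarrow> dim_col B = dim_vec v \<Longrightarrow> A * B *\<^sub>v v = A *\<^sub>v (B *\<^sub>v v)"
  by (rule assoc_mult_mat_vec[of _ "dim_row A" "dim_col A" _ "dim_col B"]) auto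

lemma transpose_mult_dim:
  fixes A :: "'a::comm_semiring_0 mat"
  shows "dim_col A = dim_row B \<Longrightarrow> (A * B)\<^sup>T = B\<^sup>T * A\<^sup>T"
  by (rule transpose_mult[of _ "dim_row A" "dim_col A" _ "dim_col B"]) auto

lemma scalar_prod_mult_mat_vec:
  fixes A :: "'a::comm_semiring_0 mat"
  assumes "dim_vec v = dim_row A" "dim_vec w = dim_col A"
  shows "v \<bullet> (A *\<^sub>v w) = (A\<^sup>T *\<^sub>v v) \<bullet> w"
  by (rule transpose_vec_mult_scalar[of A "dim_row A" "dim_col A" w v, symmetric])
    (use assms in \<open>auto intro: carrier_vecI\<close>)

lemma scalar_prod_mult_mat_vec_both:
  fixes A :: "'a::comm_semiring_0 mat"
  assumes "dim_vec v = dim_col A" "dim_vec w = dim_col B" "dim_row A = dim_row B"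
  shows "(A *\<^sub>v v) \<bullet> (B *\<^sub>v w) = v \<bullet> (A\<^sup>T * B *\<^sub>v w)"
  using assms scalar_prod_mult_mat_vec[of v "A\<^sup>T" "B *\<^sub>v w"]
  by (simp add: assoc_mult_mat_vec_dim)

lemma one_mult_mat_dim: "dim_row A = n \<Longrightarrow> 1\<^sub>m n * A = (A :: 'a::semiring_1 mat)"
  by (rule left_mult_one_mat[of A n "dim_col A"]) auto

lemma mult_one_mat_dim: "dim_col A = n \<Longrightarrow> A * 1\<^sub>m n = (A :: 'a::semiring_1 mat)"
  by (rule right_mult_one_mat[of A "dim_row A" n]) auto

lemma scalar_prod_sum: "v \<bullet> w = (\<Sum>i<dim_vec w. v $ i * w $ i)"
  by (simp add: scalar_prod_def atLeast0LessThan)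

lemma scalar_prod_self_nonneg: "0 \<le> v \<bullet> (v :: real vec)"
  by (simp add: scalar_prod_sum sum_nonneg)

lemma scalar_prod_self_eq_0_iff: "v \<bullet> (v :: real vec) = 0 \<longleftrightarrow> v = 0\<^sub>v (dim_vec v)"
proof
  assume "v \<bullet> v = 0"
  thus "v = 0\<^sub>v (dim_vec v)" by (intro eq_vecI) (auto simp: scalar_prod_sum sum_nonneg_eq_0_iff)
next
  assume "v = 0\<^sub>v (dim_vec v)"
  hence "v $ i = 0" if "i < dim_vec v" for i using that by (metis index_zero_vec(1))
  thus "v \<bullet> v = 0" by (simp add: scalar_prod_sum)
qed

lemma scalar_prod_comm_dim: "dim_vec v = dim_vec w \<Longrightarrow> v \<bullet> w = w \<bullet> (v :: 'a::comm_semiring_0 vec)"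
  by (metis carrier_vecI comm_scalar_prod)

lemma scalar_prod_Cauchy_Schwarz:
  fixes v w :: "real vec"
  assumes "dim_vec v = dim_vec w"
  shows "(v \<bullet> w)\<^sup>2 \<le> (v \<bullet> v) * (w \<bullet> w)"
  using assms Cauchy_Schwarz_ineq_sum[of "\<lambda>i. v $ i" "\<lambda>i. w $ i" "{..<dim_vec w}"]
  by (simp add: scalar_prod_sum power2_eq_square)

text \<open>Zero rows pad \<open>A\<close> to a square matrix \<open>B\<close>. As
  \<open>r < c\<close>, row \<open>r\<close> of \<open>B\<close> is zero, so Laplace expansion along
  it gives determinant 0, and a singular square matrix over a field has a nonzero kernel
  vector.\<close>

lemma ex_kernel_vec:
  assumes A: "(A :: 'a::field mat) \<in> carrier_mat r c" and "r < c"
  shows "\<exists>v\<in>carrier_vec c. v \<noteq> 0\<^sub>v c \<and> A *\<^sub>v v = 0\<^sub>v r"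
proof -
  define B where "B = mat c c (\<lambda>(i, j). if i < r then A $$ (i, j) else 0)"
  have B: "B \<in> carrier_mat c c" by (simp add: B_def)
  have "det B = 0"
    using laplace_expansion_row[OF B \<open>r < c\<close>] \<open>r < c\<close> by (simp add: B_def)
  then obtain v where v: "v \<in> carrier_vec c" "v \<noteq> 0\<^sub>v c" "B *\<^sub>v v = 0\<^sub>v c"
    using det_0_iff_vec_prod_zero_field[OF B] by blast
  have "A *\<^sub>v v = 0\<^sub>v r"
  proof (rule eq_vecI)
    fix i assume i: "i < dim_vec (0\<^sub>v r :: 'a vec)"
    have "row A i = row B i" using i A \<open>r < c\<close> by (auto simp: B_def)
    moreover have "(B *\<^sub>v v) $ i = 0" using v(3) i \<open>r < c\<close> by simp
    ultimately show "(A *\<^sub>v v) $ i = 0\<^sub>v r $ i" using i A B \<open>r < c\<close> by simp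
  qed (use A in simp)
  with v show ?thesis by blast
qed

section \<open>Invertibility, adjugates and inverses\<close>

lemma invertible_mat_iff_det:
  assumes A: "(A :: 'a::field mat) \<in> carrier_mat n n"
  shows "invertible_mat A \<longleftrightarrow> det A \<noteq> 0"
proof
  assume "invertible_mat A"
  then obtain B where B: "A * B = 1\<^sub>m n" "B * A = 1\<^sub>m (dim_row B)"
    using A unfolding invertible_mat_def inverts_mat_def by auto
  \<comment> \<open>\<open>invertible_mat\<close> does not fix the shape of the inverse; it is read
    off from the two identities before determinants are multiplied.\<close>
  have "dim_col B = n" using B(1) by (metis index_mult_mat(3) index_one_mat(3))
  moreover have "dim_row B = n" using B(2) A by (metis index_mult_mat(3) index_one_mat(3) carrier_matD(2))
  ultimately have "det A * det B = 1"
    using A B det_mult[of A n B] by (metis carrier_matI det_one)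
  thus "det A \<noteq> 0" by auto
next
  assume d: "det A \<noteq> 0"
  define B where "B = inverse (det A) \<cdot>\<^sub>m adj_mat A"
  have "A * B = 1\<^sub>m n" "B * A = 1\<^sub>m n"
    using adj_mat[OF A] d A by (auto simp: B_def mult_smult_distrib mult_smult_assoc_mat[of _ n n])
  thus "invertible_mat A" using A adj_mat[OF A]
    unfolding invertible_mat_def inverts_mat_def B_def
    by (auto intro!: exI[of _ "inverse (det A) \<cdot>\<^sub>m adj_mat A"])
qed

lemma invertible_matI:
  assumes A: "(A :: 'a::field mat) \<in> carrier_mat n n"
    and "\<And>v. v \<in> carrier_vec n \<Longrightarrow> A *\<^sub>v v = 0\<^sub>v n \<Longrightarrow> v = 0\<^sub>v n"
  shows "invertible_mat A"
  using assms det_0_iff_vec_prod_zero_field[OF A] invertible_mat_iff_det[OF A] by blast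

text \<open>The inverse \<open>B\<close> puts \<open>A\<close> among the units of the matrix ring,
  so \<open>mat_inverse\<close> cannot return \<open>None\<close>; what it returns is a left inverse
  and therefore equals the right inverse \<open>B\<close>.\<close>

lemma inv_mat_unique:
  assumes A: "A \<in> carrier_mat n n" and B: "B \<in> carrier_mat n n" and AB: "A * B = 1\<^sub>m n"
  shows "inv_mat A = B"
proof -
  have BA: "B * A = 1\<^sub>m n" by (rule mat_mult_left_right_inverse[OF A B AB])
  have U: "A \<in> Units (ring_mat TYPE(real) n ())"
    using A B AB BA unfolding Units_def by (auto simp: ring_mat_simps intro!: bexI[of _ B])
  then obtain C where C: "mat_inverse A = Some C"
    using mat_inverse(1)[OF A, where b = "()"] by (cases "mat_inverse A") auto
  have CC: "C \<in> carrier_mat n n" "C * A = 1\<^sub>m n" using mat_inverse(2)[OF A C] by auto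
  have "C = C * (A * B)" using CC AB by simp
  also have "\<dots> = B" using CC A B by (simp flip: assoc_mult_mat)
  finally show ?thesis using C by (simp add: inv_mat_def)
qed

lemma invertible_matI_mult:
  assumes A: "(A :: real mat) \<in> carrier_mat n n" and B: "B \<in> carrier_mat n n" and AB: "A * B = 1\<^sub>m n"
  shows "invertible_mat A"
  using mat_mult_left_right_inverse[OF A B AB] A B AB
  unfolding invertible_mat_def inverts_mat_def by auto

lemma inv_mat_adj:
  assumes A: "A \<in> carrier_mat n n" and d: "det A \<noteq> 0"
  shows "inv_mat A = (1 / det A) \<cdot>\<^sub>m adj_mat A"
  using adj_mat[OF A] d A by (intro inv_mat_unique[of _ n]) (auto simp: mult_smult_distrib)

lemma
  assumes A: "A \<in> carrier_mat n n" and "invertible_mat A"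
  shows inv_mat_carrier: "inv_mat A \<in> carrier_mat n n"
    and inv_mat_right: "A * inv_mat A = 1\<^sub>m n"
    and inv_mat_left: "inv_mat A * A = 1\<^sub>m n"
proof -
  have d: "det A \<noteq> 0" using assms invertible_mat_iff_det by blast
  have eq: "inv_mat A = (1 / det A) \<cdot>\<^sub>m adj_mat A" by (rule inv_mat_adj[OF A d])
  show "inv_mat A \<in> carrier_mat n n" using adj_mat[OF A] eq by simp
  show "A * inv_mat A = 1\<^sub>m n" "inv_mat A * A = 1\<^sub>m n"
    using adj_mat[OF A] d A unfolding eq by (auto simp: mult_smult_distrib mult_smult_assoc_mat[of _ n n])
qed

lemma inv_mat_symmetric:
  assumes A: "A \<in> carrier_mat n n" and "invertible_mat A" and "A\<^sup>T = A"
  shows "(inv_mat A)\<^sup>T = inv_mat A"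
proof -
  have "A * (inv_mat A)\<^sup>T = 1\<^sub>m n"
    using arg_cong[OF inv_mat_left[OF assms(1,2)], of transpose_mat] assms
      inv_mat_carrier[OF assms(1,2)] by (simp add: transpose_mult_dim)
  thus ?thesis using inv_mat_unique[OF A, of "(inv_mat A)\<^sup>T"] inv_mat_carrier[OF assms(1,2)] by simp
qed

lemma pos_definite_invertible:
  assumes "pos_definite n A"
  shows "invertible_mat A"
proof (rule invertible_matI)
  show A: "A \<in> carrier_mat n n" using assms by (simp add: pos_definite_def)
  fix v assume v: "v \<in> carrier_vec n" "A *\<^sub>v v = 0\<^sub>v n"
  hence "v \<bullet> (A *\<^sub>v v) = 0" by simp
  thus "v = 0\<^sub>v n" using assms v(1) unfolding pos_definite_def by (metis less_irrefl)
qed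

lemma sum_upto_append: "(\<Sum>c<a + b. f c) = (\<Sum>c<a. f c) + (\<Sum>c<b. f (a + c :: nat) :: 'a::comm_monoid_add)"
proof -
  have "{..<a + b} = {..<a} \<union> (\<lambda>c. a + c) ` {..<b}"
    by (auto simp: image_iff) (metis lessThan_iff add_diff_inverse_nat nat_add_left_cancel_less)
  moreover have "{..<a} \<inter> (\<lambda>c. a + c) ` {..<b} = {}" by auto
  ultimately show ?thesis by (simp add: sum.union_disjoint sum.reindex)
qed

section \<open>Columns orthonormal for a positive definite form\<close>

lemma orthonormal_columns_le:
  assumes A: "A \<in> carrier_mat m m" and H: "H \<in> carrier_mat m k" and o: "H\<^sup>T * A * H = (1\<^sub>m k :: real mat)"
  shows "k \<le> m"
proof (rule ccontr)
  assume "\<not> k \<le> m"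
  then obtain v where v: "v \<in> carrier_vec k" "v \<noteq> 0\<^sub>v k" "H *\<^sub>v v = 0\<^sub>v m"
    using ex_kernel_vec[OF H] by auto
  \<comment> \<open>The Gram identity fixes the kernel vector, whereas \<open>H\<close> annihilates
    it.\<close>
  have "v = H\<^sup>T * A * H *\<^sub>v v" using o v by simp
  also have "\<dots> = H\<^sup>T * A *\<^sub>v (H *\<^sub>v v)" using A H v by (simp add: assoc_mult_mat_vec_dim)
  also have "\<dots> = 0\<^sub>v k" unfolding v(3) using A H by (intro eq_vecI) (auto simp: scalar_prod_def)
  finally show False using v by simp
qed

text \<open>A vector orthogonal to all present columns is a kernel vector of
  \<open>H\<^sup>T * A\<close>, which exists because that matrix has fewer rows than columns;
  dividing it by its \<open>A\<close>-norm gives the new column. No projection formula is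
  needed.\<close>

lemma orthonormal_columns_extend_one:
  assumes A: "pos_definite m A" and H: "H \<in> carrier_mat m k" and o: "H\<^sup>T * A * H = 1\<^sub>m k" and "k < m"
  shows "\<exists>H'\<in>carrier_mat m (Suc k). H'\<^sup>T * A * H' = 1\<^sub>m (Suc k) \<and> (\<forall>j<k. col H' j = col H j)"
proof -
  have Ac: "A \<in> carrier_mat m m" and AT: "A\<^sup>T = A" using A by (auto simp: pos_definite_def)
  have HA: "H\<^sup>T * A \<in> carrier_mat k m" using H Ac by simp
  obtain w where w: "w \<in> carrier_vec m" "w \<noteq> 0\<^sub>v m" "H\<^sup>T * A *\<^sub>v w = 0\<^sub>v k"
    using ex_kernel_vec[OF HA \<open>k < m\<close>] by blast
  define c where "c = w \<bullet> (A *\<^sub>v w)"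
  have c: "c > 0" using A w by (auto simp: pos_definite_def c_def)
  define v where "v = (1 / sqrt c) \<cdot>\<^sub>v w"
  have v: "v \<in> carrier_vec m" using w by (simp add: v_def)
  have Av: "A *\<^sub>v v = (1 / sqrt c) \<cdot>\<^sub>v (A *\<^sub>v w)" using w Ac by (simp add: v_def mult_mat_vec)
  have vv: "v \<bullet> (A *\<^sub>v v) = 1"
    using w Ac c unfolding Av by (simp add: v_def c_def[symmetric])
  have Hv: "H\<^sup>T * A *\<^sub>v v = 0\<^sub>v k"
    using w HA by (simp add: v_def mult_mat_vec) auto
  define H' where "H' = mat m (Suc k) (\<lambda>(i, j). if j < k then H $$ (i, j) else v $ i)"
  have H': "H' \<in> carrier_mat m (Suc k)" by (simp add: H'_def)
  have c1: "col H' j = col H j" if "j < k" for j using that H by (auto simp: H'_def)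
  have c2: "col H' k = v" using v by (auto simp: H'_def)
  have ent: "(H'\<^sup>T * A * H') $$ (i, j) = col H' i \<bullet> (A *\<^sub>v col H' j)" if "i < Suc k" "j < Suc k" for i j
    using that H' Ac by (simp add: assoc_mult_mat_dim mult_mat_vec_def)
  have entH: "(H\<^sup>T * A * H) $$ (i, j) = col H i \<bullet> (A *\<^sub>v col H j)" if "i < k" "j < k" for i j
    using that H Ac by (simp add: assoc_mult_mat_dim mult_mat_vec_def)
  have hv: "col H i \<bullet> (A *\<^sub>v v) = 0" if "i < k" for i
  proof -
    have "col H i \<bullet> (A *\<^sub>v v) = (H\<^sup>T *\<^sub>v (A *\<^sub>v v)) $ i" using that H by simp
    also have "\<dots> = (H\<^sup>T * A *\<^sub>v v) $ i" using H Ac v by (simp add: assoc_mult_mat_vec_dim)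
    finally show ?thesis using Hv that by simp
  qed
  have vh: "v \<bullet> (A *\<^sub>v col H i) = 0" if "i < k" for i
  proof -
    have "v \<bullet> (A *\<^sub>v col H i) = (A *\<^sub>v v) \<bullet> col H i"
      using scalar_prod_mult_mat_vec[of v A "col H i"] v Ac H that AT by simp
    also have "\<dots> = col H i \<bullet> (A *\<^sub>v v)" using H Ac v that by (intro scalar_prod_comm_dim) auto
    finally show ?thesis using hv[OF that] by simp
  qed
  have "H'\<^sup>T * A * H' = 1\<^sub>m (Suc k)"
  proof (rule eq_matI)
    fix i j assume ij: "i < dim_row (1\<^sub>m (Suc k) :: real mat)" "j < dim_col (1\<^sub>m (Suc k) :: real mat)"
    then consider "i < k" "j < k" | "i < k" "j = k" | "i = k" "j < k" | "i = k" "j = k" by fastforce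
    thus "(H'\<^sup>T * A * H') $$ (i, j) = 1\<^sub>m (Suc k) $$ (i, j)"
    proof cases
      case 1
      hence "(H'\<^sup>T * A * H') $$ (i, j) = (H\<^sup>T * A * H) $$ (i, j)" by (simp add: ent entH c1)
      thus ?thesis using 1 o by simp
    qed (simp_all add: ent c1 c2 hv vh vv)
  qed (use H' in auto)
  with H' c1 show ?thesis by blast
qed

text \<open>Induction on the number of missing columns; \<open>orthonormal_columns_le\<close> shows
  that none missing means \<open>k = m\<close>. The given columns keep their places, which is what
  lets a basis be adapted to a restriction.\<close>

lemma orthonormal_columns_extend:
  assumes A: "pos_definite m A" and H: "H \<in> carrier_mat m k" and o: "H\<^sup>T * A * H = 1\<^sub>m k"
  shows "\<exists>D\<in>carrier_mat m m. D\<^sup>T * A * D = 1\<^sub>m m \<and> (\<forall>j<k. col D j = col H j)"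
  using H o
proof (induction "m - k" arbitrary: k H)
  case 0
  have "A \<in> carrier_mat m m" using A by (simp add: pos_definite_def)
  from orthonormal_columns_le[OF this 0(2,3)] 0(1) have "k = m" by simp
  with 0 show ?case by blast
next
  case (Suc d)
  hence "k < m" by simp
  from orthonormal_columns_extend_one[OF A Suc.prems this]
  obtain H' where H': "H' \<in> carrier_mat m (Suc k)" "H'\<^sup>T * A * H' = 1\<^sub>m (Suc k)"
    "\<forall>j<k. col H' j = col H j" by blast
  have "d = m - Suc k" using Suc by simp
  from Suc.hyps(1)[OF this H'(1,2)] obtain D where
    "D \<in> carrier_mat m m" "D\<^sup>T * A * D = 1\<^sub>m m" "\<forall>j<Suc k. col D j = col H' j" by blast
  thus ?case using H' by (metis less_SucI)
qed

section \<open>Least squares under a linear restriction\<close>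

lemma add_mult_distrib_mat_dim:
  fixes A :: "'a::semiring_0 mat"
  shows "dim_row A = dim_row B \<Longrightarrow> dim_col A = dim_col B \<Longrightarrow> dim_col A = dim_row C \<Longrightarrow> (A + B) * C = A * C + B * C"
  by (rule add_mult_distrib_mat[of _ "dim_row A" "dim_col A" _ _ "dim_col C"]) auto

lemma mult_add_distrib_mat_dim:
  fixes A :: "'a::semiring_0 mat"
  shows "dim_row B = dim_row C \<Longrightarrow> dim_col B = dim_col C \<Longrightarrow> dim_col A = dim_row C \<Longrightarrow> A * (B + C) = A * B + A * C"
  by (rule mult_add_distrib_mat[of _ "dim_row A" "dim_col A" _ "dim_col C"]) auto

lemma minus_mult_distrib_mat_dim:
  fixes A :: "'a::ring mat"
  shows "dim_row A = dim_row B \<Longrightarrow> dim_col A = dim_col B \<Longrightarrow> dim_col A = dim_row C \<Longrightarrow> (A - B) * C = A * C - B * C"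
  by (rule minus_mult_distrib_mat[of _ "dim_row A" "dim_col A" _ _ "dim_col C"]) auto

lemma mult_minus_distrib_mat_dim:
  fixes A :: "'a::ring mat"
  shows "dim_row B = dim_row C \<Longrightarrow> dim_col B = dim_col C \<Longrightarrow> dim_col A = dim_row C \<Longrightarrow> A * (B - C) = A * B - A * C"
  by (rule mult_minus_distrib_mat[of _ "dim_row A" "dim_col A" _ "dim_col C"]) auto

lemma mult_mat_zero_vec_dim:
  fixes A :: "'a::semiring_0 mat"
  shows "dim_col A = c \<Longrightarrow> A *\<^sub>v 0\<^sub>v c = 0\<^sub>v (dim_row A)"
  by (intro eq_vecI) (auto simp: scalar_prod_def)

text \<open>For \<open>V\<close> of full column rank this is the orthogonal projection onto the
  complement of the column space of \<open>V\<close>, the residual maker of the regression on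
  \<open>V\<close>.\<close>

definition resid_mat :: "nat \<Rightarrow> real mat \<Rightarrow> real mat" where
  "resid_mat n V = 1\<^sub>m n - V * (inv_mat (V\<^sup>T * V) * V\<^sup>T)"

section \<open>Algebra of the residual projection\<close>

lemma gram_mat_carrier: "V \<in> carrier_mat n k \<Longrightarrow> V\<^sup>T * V \<in> carrier_mat k k"
  by auto

lemma gram_mat_symmetric: "(V\<^sup>T * V)\<^sup>T = V\<^sup>T * (V :: real mat)"
  by (simp add: transpose_mult_dim)

context
  fixes V :: "real mat" and n k :: nat
  assumes V: "V \<in> carrier_mat n k" and inv: "invertible_mat (V\<^sup>T * V)"
begin

private lemma d: "dim_row V = n" "dim_col V = k"
  using V by auto

private lemma I: "inv_mat (V\<^sup>T * V) \<in> carrier_mat k k"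
  by (rule inv_mat_carrier[OF gram_mat_carrier[OF V] inv])

private lemma Id: "dim_row (inv_mat (V\<^sup>T * V)) = k" "dim_col (inv_mat (V\<^sup>T * V)) = k"
  using I by auto

private lemma IT: "(inv_mat (V\<^sup>T * V))\<^sup>T = inv_mat (V\<^sup>T * V)"
  by (rule inv_mat_symmetric[OF gram_mat_carrier[OF V] inv gram_mat_symmetric])

lemma resid_mat_carrier: "resid_mat n V \<in> carrier_mat n n"
  unfolding resid_mat_def
  by (rule minus_carrier_mat[OF mult_carrier_mat[OF V mult_carrier_mat[OF I]]]) (use V in simp)

lemma resid_mat_symmetric: "(resid_mat n V)\<^sup>T = resid_mat n V"
proof -
  have "(V * (inv_mat (V\<^sup>T * V) * V\<^sup>T))\<^sup>T = V * (inv_mat (V\<^sup>T * V) * V\<^sup>T)"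
    using d Id by (simp add: transpose_mult_dim IT assoc_mult_mat_dim)
  thus ?thesis unfolding resid_mat_def
    using transpose_minus[of "1\<^sub>m n" n n "V * (inv_mat (V\<^sup>T * V) * V\<^sup>T)"] V I by auto
qed

lemma resid_mat_annihilates: "resid_mat n V * V = 0\<^sub>m n k"
proof -
  have "resid_mat n V * V = V - V * (inv_mat (V\<^sup>T * V) * (V\<^sup>T * V))"
    unfolding resid_mat_def using d Id
    by (simp add: minus_mult_distrib_mat_dim assoc_mult_mat_dim one_mult_mat_dim)
  also have "\<dots> = V - V" using inv_mat_left[OF gram_mat_carrier[OF V] inv] d
    by (simp add: mult_one_mat_dim)
  finally show ?thesis using V by auto
qed

lemma resid_mat_idempotent: "resid_mat n V * resid_mat n V = resid_mat n V"
proof -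
  have "resid_mat n V * resid_mat n V
      = resid_mat n V * 1\<^sub>m n - resid_mat n V * V * (inv_mat (V\<^sup>T * V) * V\<^sup>T)"
    unfolding resid_mat_def[of n V] using d Id resid_mat_carrier[unfolded resid_mat_def]
    by (subst mult_minus_distrib_mat_dim) (auto simp: assoc_mult_mat_dim)
  also have "\<dots> = resid_mat n V"
    unfolding resid_mat_annihilates using resid_mat_carrier d Id
    by (auto simp: mult_one_mat_dim)
  finally show ?thesis .
qed

text \<open>Cyclicity of the trace: \<open>V * K\<close> has the trace of \<open>K * V\<close>, the
  identity of size \<open>k\<close>. The value is the mean of the quadratic form in uncorrelated
  centred variables of variance 1.\<close>

lemma resid_mat_trace: "(\<Sum>i<n. resid_mat n V $$ (i, i)) = real n - real k"
proof -
  define K where "K = inv_mat (V\<^sup>T * V) * V\<^sup>T"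
  have K: "K \<in> carrier_mat k n" using I V by (auto simp: K_def)
  have KV: "K * V = 1\<^sub>m k" unfolding K_def
    using d Id inv_mat_left[OF gram_mat_carrier[OF V] inv] by (simp add: assoc_mult_mat_dim)
  have "(\<Sum>i<n. (V * K) $$ (i, i)) = (\<Sum>i<n. \<Sum>c<k. V $$ (i, c) * K $$ (c, i))"
    using V K by (intro sum.cong refl) (simp add: scalar_prod_sum)
  also have "\<dots> = (\<Sum>c<k. \<Sum>i<n. K $$ (c, i) * V $$ (i, c))"
    by (subst sum.swap) (simp add: mult.commute)
  also have "\<dots> = (\<Sum>c<k. (K * V) $$ (c, c))"
    using V K by (intro sum.cong refl) (simp add: scalar_prod_sum)
  also have "\<dots> = real k" unfolding KV by simp
  finally have "(\<Sum>i<n. (V * K) $$ (i, i)) = real k" .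
  moreover have "resid_mat n V $$ (i, i) = 1 - (V * K) $$ (i, i)" if "i < n" for i
    using that V K by (simp add: resid_mat_def K_def[symmetric])
  ultimately show ?thesis by (simp add: sum_subtractf)
qed

text \<open>By symmetry and idempotence the squares in row \<open>i\<close> add up to the diagonal
  entry \<open>(i, i)\<close>, so the sum is the trace. It governs the variance of the quadratic
  form.\<close>

lemma resid_mat_sum_squares: "(\<Sum>i<n. \<Sum>j<n. (resid_mat n V $$ (i, j))\<^sup>2) = real n - real k"
proof -
  have "(\<Sum>j<n. (resid_mat n V $$ (i, j))\<^sup>2) = resid_mat n V $$ (i, i)" if i: "i < n" for i
  proof -
    have "resid_mat n V $$ (i, i) = (resid_mat n V * (resid_mat n V)\<^sup>T) $$ (i, i)"
      by (simp add: resid_mat_symmetric resid_mat_idempotent)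
    also have "\<dots> = (\<Sum>j<n. (resid_mat n V $$ (i, j))\<^sup>2)"
      using i resid_mat_carrier by (simp add: scalar_prod_sum power2_eq_square)
    finally show ?thesis by simp
  qed
  thus ?thesis using resid_mat_trace by simp
qed

end

text \<open>The change of basis \<open>U [D2, D1] = [Z, V]\<close> turns the restriction into one on the
  coefficients of \<open>Z\<close> alone (Frisch--Waugh--Lovell).\<close>

locale restricted_regression =
  fixes n m q k :: nat and U R D2 D1 E2 E1 B L :: "real mat"
  assumes U: "U \<in> carrier_mat n m" and R: "R \<in> carrier_mat q m"
    and D2: "D2 \<in> carrier_mat m q" and D1: "D1 \<in> carrier_mat m k"
    and E2: "E2 \<in> carrier_mat q m" and E1: "E1 \<in> carrier_mat k m"
    and DE: "D2 * E2 + D1 * E1 = 1\<^sub>m m"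
    and B: "B \<in> carrier_mat q q" and L: "L \<in> carrier_mat q q" and BL: "B * L = 1\<^sub>m q"
    and RD2: "R * D2 = B" and RD1: "R * D1 = 0\<^sub>m q k"
    and inv_V: "invertible_mat ((U * D1)\<^sup>T * (U * D1))"
    and inv_A: "invertible_mat ((U * D2)\<^sup>T * (resid_mat n (U * D1) * (U * D2)))"
begin

definition "Z = U * D2"
definition "V = U * D1"
definition "Q = resid_mat n V"
definition "A = Z\<^sup>T * (Q * Z)"
definition "G = U\<^sup>T * U"
definition "W = R * inv_mat G * R\<^sup>T"

lemma Z: "Z \<in> carrier_mat n q" and V: "V \<in> carrier_mat n k"
  using U D2 D1 by (auto simp: Z_def V_def)

lemma Q: "Q \<in> carrier_mat n n" and QT: "Q\<^sup>T = Q" and QV: "Q * V = 0\<^sub>m n k"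
  using resid_mat_carrier[OF V] resid_mat_symmetric[OF V]
    resid_mat_annihilates[OF V] inv_V by (auto simp: Q_def V_def)

lemma VQ: "V\<^sup>T * Q = 0\<^sub>m k n"
  using arg_cong[OF QV, of transpose_mat] Q V by (simp add: transpose_mult_dim QT)

lemma A: "A \<in> carrier_mat q q"
  using Z Q by (auto simp: A_def)

lemma AT: "A\<^sup>T = A"
  unfolding A_def using Z Q by (simp add: transpose_mult_dim QT assoc_mult_mat_dim)

lemma iA: "inv_mat A \<in> carrier_mat q q" "A * inv_mat A = 1\<^sub>m q" "inv_mat A * A = 1\<^sub>m q"
    "(inv_mat A)\<^sup>T = inv_mat A"
  using inv_mat_carrier[OF A] inv_mat_right[OF A] inv_mat_left[OF A] inv_mat_symmetric[OF A _ AT] inv_A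
  by (auto simp: A_def Z_def Q_def V_def)

lemma LB: "L * B = 1\<^sub>m q"
  using mat_mult_left_right_inverse[OF B L BL] .

lemma dims:
  "dim_row U = n" "dim_col U = m" "dim_row R = q" "dim_col R = m" "dim_row D2 = m" "dim_col D2 = q"
  "dim_row D1 = m" "dim_col D1 = k" "dim_row E2 = q" "dim_col E2 = m" "dim_row E1 = k" "dim_col E1 = m"
  "dim_row B = q" "dim_col B = q" "dim_row L = q" "dim_col L = q"
  "dim_row Z = n" "dim_col Z = q" "dim_row V = n" "dim_col V = k" "dim_row Q = n" "dim_col Q = n"
  "dim_row A = q" "dim_col A = q" "dim_row (inv_mat A) = q" "dim_col (inv_mat A) = q"
  using U R D2 D1 E2 E1 B L Z V Q A iA(1) by auto

lemma U_decomp: "U = Z * E2 + V * E1"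
proof -
  have "U = U * (D2 * E2 + D1 * E1)" using dims by (simp add: DE mult_one_mat_dim)
  also have "\<dots> = Z * E2 + V * E1"
    unfolding Z_def V_def using dims by (simp add: mult_add_distrib_mat_dim assoc_mult_mat_dim)
  finally show ?thesis .
qed

lemma R_decomp: "R = B * E2"
proof -
  have "R = R * (D2 * E2 + D1 * E1)" using dims by (simp add: DE mult_one_mat_dim)
  also have "\<dots> = (R * D2) * E2 + (R * D1) * E1"
    using dims by (simp add: mult_add_distrib_mat_dim assoc_mult_mat_dim)
  also have "\<dots> = B * E2" unfolding RD2 RD1 using E1 B E2 by auto
  finally show ?thesis .
qed

lemma G: "G \<in> carrier_mat m m" using U by (simp add: G_def)

text \<open>If \<open>U v = 0\<close>, then \<open>Z a + V b = 0\<close> for \<open>a = E2 v\<close>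
  and \<open>b = E1 v\<close>. Applying \<open>Z'Q\<close> removes \<open>V b\<close> and leaves
  \<open>A a = 0\<close>, so \<open>a = 0\<close>; then \<open>V b = 0\<close> gives
  \<open>b = 0\<close>, and \<open>v = D2 a + D1 b\<close> vanishes.\<close>

lemma inv_G: "invertible_mat G"
proof (rule invertible_matI[OF G])
  fix v assume v: "v \<in> carrier_vec m" "G *\<^sub>v v = 0\<^sub>v m"
  define a where "a = E2 *\<^sub>v v"
  define b where "b = E1 *\<^sub>v v"
  have ab: "a \<in> carrier_vec q" "b \<in> carrier_vec k" using E2 E1 v by (auto simp: a_def b_def)
  have "(U *\<^sub>v v) \<bullet> (U *\<^sub>v v) = v \<bullet> (G *\<^sub>v v)"
    using v(1) dims by (subst scalar_prod_mult_mat_vec_both) (simp_all add: G_def)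
  hence "(U *\<^sub>v v) \<bullet> (U *\<^sub>v v) = 0" using v by simp
  hence Uv: "U *\<^sub>v v = 0\<^sub>v n" using scalar_prod_self_eq_0_iff[of "U *\<^sub>v v"] dims by simp
  have Uv': "U *\<^sub>v v = Z *\<^sub>v a + V *\<^sub>v b"
    unfolding a_def b_def using v Z E2 V E1 dims
    by (subst U_decomp, subst add_mult_distrib_mat_vec[of _ n m]) (auto simp: assoc_mult_mat_vec_dim)
  have "A *\<^sub>v a = Z\<^sup>T * Q *\<^sub>v (Z *\<^sub>v a + V *\<^sub>v b)"
  proof -
    have "Z\<^sup>T * Q *\<^sub>v (V *\<^sub>v b) = Z\<^sup>T *\<^sub>v (Q * V *\<^sub>v b)"
      using ab dims by (simp add: assoc_mult_mat_vec_dim)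
    also have "\<dots> = 0\<^sub>v q" unfolding QV using Z ab by (intro eq_vecI) (auto simp: scalar_prod_def)
    finally have z: "Z\<^sup>T * Q *\<^sub>v (V *\<^sub>v b) = 0\<^sub>v q" .
    have "Z\<^sup>T * Q *\<^sub>v (Z *\<^sub>v a + V *\<^sub>v b) = Z\<^sup>T * Q *\<^sub>v (Z *\<^sub>v a) + Z\<^sup>T * Q *\<^sub>v (V *\<^sub>v b)"
      using Z Q V ab by (intro mult_add_distrib_mat_vec[of _ q n]) auto
    also have "\<dots> = A *\<^sub>v a" unfolding z A_def using Z Q ab dims
      by (simp add: assoc_mult_mat_vec_dim)
    finally show ?thesis by simp
  qed
  also have "\<dots> = 0\<^sub>v q" unfolding Uv'[symmetric] Uv using Z Q by (intro eq_vecI) (auto simp: scalar_prod_def)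
  finally have Aa: "A *\<^sub>v a = 0\<^sub>v q" .
  have "a = inv_mat A *\<^sub>v (A *\<^sub>v a)"
    using iA ab dims by (simp flip: assoc_mult_mat_vec_dim)
  hence a: "a = 0\<^sub>v q" unfolding Aa using iA by (auto simp: scalar_prod_def)
  have "V *\<^sub>v b = 0\<^sub>v n"
    using Uv Uv' V Z ab dims unfolding a by (simp add: mult_mat_zero_vec_dim)
  hence "V\<^sup>T * V *\<^sub>v b = 0\<^sub>v k" using V ab dims by (simp add: assoc_mult_mat_vec_dim scalar_prod_def) auto
  hence b: "b = 0\<^sub>v k"
    using inv_V V ab det_0_iff_vec_prod_zero_field[of "V\<^sup>T * V" k] invertible_mat_iff_det[of "V\<^sup>T * V" k]
    by (auto simp: V_def[symmetric])
  have "v = (D2 * E2 + D1 * E1) *\<^sub>v v" using v DE by simp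
  also have "\<dots> = D2 *\<^sub>v a + D1 *\<^sub>v b"
    unfolding a_def b_def using v D2 D1 E2 E1 dims
    by (subst add_mult_distrib_mat_vec[of _ m m]) (auto simp: assoc_mult_mat_vec_dim)
  also have "\<dots> = 0\<^sub>v m" unfolding a b using D2 D1 by (intro eq_vecI) (auto simp: scalar_prod_def)
  finally show "v = 0\<^sub>v m" .
qed

lemma iG: "inv_mat G \<in> carrier_mat m m" "G * inv_mat G = 1\<^sub>m m" "inv_mat G * G = 1\<^sub>m m"
    "(inv_mat G)\<^sup>T = inv_mat G"
  using inv_mat_carrier[OF G inv_G] inv_mat_right[OF G inv_G] inv_mat_left[OF G inv_G]
    inv_mat_symmetric[OF G inv_G] by (auto simp: G_def gram_mat_symmetric)

lemma dimG: "dim_row G = m" "dim_col G = m" "dim_row (inv_mat G) = m" "dim_col (inv_mat G) = m"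
  using G iG by auto

text \<open>In the basis \<open>D2, D1\<close>, this is the block column of the partitioned inverse
  of the Gram matrix that belongs to \<open>Z\<close>: regressing \<open>Z\<close> on
  \<open>V\<close> and removing the fit turns \<open>U K\<close> into \<open>Q Z\<close> times the
  inverse of \<open>A\<close>.\<close>

definition "K = (D2 - D1 * (inv_mat (V\<^sup>T * V) * (V\<^sup>T * Z))) * inv_mat A"

lemma iV: "inv_mat (V\<^sup>T * V) \<in> carrier_mat k k"
  using inv_mat_carrier[OF gram_mat_carrier[OF V]] inv_V by (simp add: V_def)

lemma dimV: "dim_row (inv_mat (V\<^sup>T * V)) = k" "dim_col (inv_mat (V\<^sup>T * V)) = k"
  using iV by auto

lemma K: "K \<in> carrier_mat m q" unfolding K_def using D2 D1 iV V Z iA(1) by auto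

lemma UK: "U * K = Q * (Z * inv_mat A)"
  unfolding K_def Q_def resid_mat_def using dims dimV
  by (simp add: mult_minus_distrib_mat_dim minus_mult_distrib_mat_dim assoc_mult_mat_dim
      one_mult_mat_dim Z_def V_def)

lemma RK: "R * K = B * inv_mat A"
proof -
  have "R * K = (R * D2 - (R * D1) * (inv_mat (V\<^sup>T * V) * (V\<^sup>T * Z))) * inv_mat A"
    unfolding K_def using dims dimV
    by (simp add: mult_minus_distrib_mat_dim minus_mult_distrib_mat_dim assoc_mult_mat_dim)
  also have "R * D2 - (R * D1) * (inv_mat (V\<^sup>T * V) * (V\<^sup>T * Z)) = B"
    unfolding RD1 RD2 using B iV V Z by (intro eq_matI) auto
  finally show ?thesis .
qed

lemma UQZ: "U\<^sup>T * (Q * Z) = E2\<^sup>T * A"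
proof -
  have "U\<^sup>T = E2\<^sup>T * Z\<^sup>T + E1\<^sup>T * V\<^sup>T"
    using Z E2 V E1 dims by (subst U_decomp, subst transpose_add[of _ n m]) (auto simp: transpose_mult_dim)
  hence "U\<^sup>T * (Q * Z) = E2\<^sup>T * (Z\<^sup>T * (Q * Z)) + E1\<^sup>T * (V\<^sup>T * Q * Z)"
    using dims by (simp add: add_mult_distrib_mat_dim assoc_mult_mat_dim)
  also have "\<dots> = E2\<^sup>T * A" unfolding VQ A_def using Z E1 E2 Q by auto
  finally show ?thesis .
qed

text \<open>Instead of inverting a block matrix, the candidate is verified:
  \<open>G K = U'QZ\<close> times the inverse of \<open>A\<close>, and \<open>U'QZ = E2'A\<close>
  because \<open>V'Q = 0\<close>; what remains is \<open>E2'B'\<close>, the transpose of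
  \<open>R\<close>.\<close>

lemma iGR: "inv_mat G * R\<^sup>T = K * B\<^sup>T"
proof -
  have "G * (K * B\<^sup>T) = U\<^sup>T * ((U * K) * B\<^sup>T)"
    unfolding G_def using K dims by (simp add: assoc_mult_mat_dim)
  also have "\<dots> = U\<^sup>T * (Q * Z) * (inv_mat A * B\<^sup>T)"
    unfolding UK using dims by (simp add: assoc_mult_mat_dim)
  also have "\<dots> = E2\<^sup>T * ((A * inv_mat A) * B\<^sup>T)"
    unfolding UQZ using dims by (simp add: assoc_mult_mat_dim)
  also have "\<dots> = R\<^sup>T" by (subst R_decomp) (use dims in \<open>simp add: iA one_mult_mat_dim transpose_mult_dim\<close>)
  finally have *: "G * (K * B\<^sup>T) = R\<^sup>T" .
  have "inv_mat G * R\<^sup>T = (inv_mat G * G) * (K * B\<^sup>T)"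
    unfolding *[symmetric] using dims dimG K by (simp add: assoc_mult_mat_dim)
  thus ?thesis using K dims by (simp add: iG one_mult_mat_dim)
qed

lemma W_eq: "W = B * (inv_mat A * B\<^sup>T)"
proof -
  have "W = R * (inv_mat G * R\<^sup>T)" unfolding W_def using dims dimG by (simp add: assoc_mult_mat_dim)
  also have "\<dots> = (R * K) * B\<^sup>T" unfolding iGR using dims K by (simp add: assoc_mult_mat_dim)
  finally show ?thesis unfolding RK using dims by (simp add: assoc_mult_mat_dim)
qed

lemma W_inverse: "W * (L\<^sup>T * (A * L)) = 1\<^sub>m q"
proof -
  have BTLT: "B\<^sup>T * L\<^sup>T = 1\<^sub>m q" using arg_cong[OF LB, of transpose_mat] dims by (simp add: transpose_mult_dim)
  have "W * (L\<^sup>T * (A * L)) = B * (inv_mat A * ((B\<^sup>T * L\<^sup>T) * (A * L)))"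
    unfolding W_eq using dims by (simp add: assoc_mult_mat_dim)
  also have "\<dots> = B * ((inv_mat A * A) * L)"
    unfolding BTLT using dims by (simp add: assoc_mult_mat_dim one_mult_mat_dim)
  finally show ?thesis unfolding iA using dims by (simp add: one_mult_mat_dim BL)
qed

lemma W: "W \<in> carrier_mat q q" unfolding W_eq using B iA by auto

lemma inv_W: "invertible_mat W" and inv_W_eq: "inv_mat W = L\<^sup>T * (A * L)"
proof -
  have c: "L\<^sup>T * (A * L) \<in> carrier_mat q q" using L A by auto
  show "invertible_mat W" by (rule invertible_matI_mult[OF W c W_inverse])
  show "inv_mat W = L\<^sup>T * (A * L)" by (rule inv_mat_unique[OF W c W_inverse])
qed

context
  fixes r \<gamma> e Y :: "real vec"
  assumes r: "r \<in> carrier_vec q" and \<gamma>: "\<gamma> \<in> carrier_vec m" and e: "e \<in> carrier_vec n"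
    and Y: "Y = U *\<^sub>v \<gamma> + e"
begin

lemma least_squares: "inv_mat G *\<^sub>v (U\<^sup>T *\<^sub>v Y) = \<gamma> + inv_mat G *\<^sub>v (U\<^sup>T *\<^sub>v e)"
proof -
  have "U\<^sup>T *\<^sub>v Y = G *\<^sub>v \<gamma> + U\<^sup>T *\<^sub>v e"
    unfolding Y G_def using U \<gamma> e dims
    by (subst mult_add_distrib_mat_vec[of _ m n]) (auto simp: assoc_mult_mat_vec_dim)
  hence "inv_mat G *\<^sub>v (U\<^sup>T *\<^sub>v Y) = (inv_mat G * G) *\<^sub>v \<gamma> + inv_mat G *\<^sub>v (U\<^sup>T *\<^sub>v e)"
    using U G iG(1) \<gamma> e dimG
    by (simp add: mult_add_distrib_mat_vec[of _ m m] assoc_mult_mat_vec_dim)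
  thus ?thesis using \<gamma> by (simp add: iG)
qed

lemma residual: "Y - U *\<^sub>v (inv_mat G *\<^sub>v (U\<^sup>T *\<^sub>v Y)) = resid_mat n U *\<^sub>v e"
proof -
  have "resid_mat n U *\<^sub>v e = e - U *\<^sub>v (inv_mat G *\<^sub>v (U\<^sup>T *\<^sub>v e))"
    unfolding resid_mat_def G_def[symmetric] using U iG(1) e dims dimG
    by (simp add: minus_mult_distrib_mat_vec[of _ n n] assoc_mult_mat_vec_dim)
  moreover have "U *\<^sub>v (\<gamma> + inv_mat G *\<^sub>v (U\<^sup>T *\<^sub>v e)) = U *\<^sub>v \<gamma> + U *\<^sub>v (inv_mat G *\<^sub>v (U\<^sup>T *\<^sub>v e))"
    using U \<gamma> e iG(1) by (intro mult_add_distrib_mat_vec[of _ n m]) auto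
  moreover have "U *\<^sub>v \<gamma> + e - (U *\<^sub>v \<gamma> + u) = e - u" if "u \<in> carrier_vec n" for u
    using that U \<gamma> e by (intro eq_vecI) auto
  ultimately show ?thesis unfolding least_squares using U iG(1) e by (simp add: Y)
qed

lemma residual_sum_squares: "(resid_mat n U *\<^sub>v e) \<bullet> (resid_mat n U *\<^sub>v e) = e \<bullet> (resid_mat n U *\<^sub>v e)"
proof -
  have i: "invertible_mat (U\<^sup>T * U)" using inv_G by (simp add: G_def)
  show ?thesis
    using resid_mat_carrier[OF U i] e
    by (simp add: scalar_prod_mult_mat_vec_both resid_mat_symmetric[OF U i] resid_mat_idempotent[OF U i])
qed

text \<open>The estimated violation of the restriction is \<open>B\<close> times
  \<open>inv_mat A\<close> applied to this vector. The first summand stems from the errors; the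
  second is the shift caused by a violated hypothesis and is zero if
  \<open>R \<gamma> = r\<close>.\<close>

definition "w = Z\<^sup>T *\<^sub>v (Q *\<^sub>v e) + A *\<^sub>v (L *\<^sub>v (R *\<^sub>v \<gamma> - r))"

lemma w: "w \<in> carrier_vec q" unfolding w_def using Z Q e A L R \<gamma> r by auto

text \<open>With \<open>c\<close> the inverse of \<open>A\<close> applied to \<open>w\<close>, the
  vector \<open>dv\<close> is \<open>B c\<close>. The inverse of \<open>W\<close> is
  \<open>L'AL\<close> and \<open>L B\<close> is the identity, so the form collapses to
  \<open>c'Ac\<close>, that is, to \<open>w'c\<close>.\<close>

lemma numerator:
  defines "dv \<equiv> R *\<^sub>v (inv_mat G *\<^sub>v (U\<^sup>T *\<^sub>v Y)) - r"
  shows "dv \<bullet> (inv_mat W *\<^sub>v dv) = w \<bullet> (inv_mat A *\<^sub>v w)"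
proof -
  define c where "c = inv_mat A *\<^sub>v w"
  have c: "c \<in> carrier_vec q" using iA w by (auto simp: c_def)
  have RiG: "R * inv_mat G = B * K\<^sup>T"
    using arg_cong[OF iGR, of transpose_mat] dims dimG K by (simp add: transpose_mult_dim iG)
  have KU: "K\<^sup>T * U\<^sup>T = inv_mat A * (Z\<^sup>T * Q)"
    using arg_cong[OF UK, of transpose_mat] dims K by (simp add: transpose_mult_dim iA QT assoc_mult_mat_dim)
  have "R *\<^sub>v (inv_mat G *\<^sub>v (U\<^sup>T *\<^sub>v e)) = (R * inv_mat G) * U\<^sup>T *\<^sub>v e"
    using e dims dimG by (simp add: assoc_mult_mat_vec_dim)
  also have "\<dots> = B * (K\<^sup>T * U\<^sup>T) *\<^sub>v e"
    unfolding RiG using dims K by (simp add: assoc_mult_mat_dim)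
  also have "\<dots> = B *\<^sub>v (inv_mat A *\<^sub>v (Z\<^sup>T *\<^sub>v (Q *\<^sub>v e)))"
    unfolding KU using dims e by (simp add: assoc_mult_mat_vec_dim)
  finally have 1: "R *\<^sub>v (inv_mat G *\<^sub>v (U\<^sup>T *\<^sub>v e)) = B *\<^sub>v (inv_mat A *\<^sub>v (Z\<^sup>T *\<^sub>v (Q *\<^sub>v e)))" .
  have c_eq: "c = inv_mat A *\<^sub>v (Z\<^sup>T *\<^sub>v (Q *\<^sub>v e)) + L *\<^sub>v (R *\<^sub>v \<gamma> - r)"
  proof -
    have "c = inv_mat A *\<^sub>v (Z\<^sup>T *\<^sub>v (Q *\<^sub>v e)) + inv_mat A *\<^sub>v (A *\<^sub>v (L *\<^sub>v (R *\<^sub>v \<gamma> - r)))"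
      unfolding c_def w_def using iA(1) Z Q A L R e \<gamma> r by (intro mult_add_distrib_mat_vec[of _ q q]) auto
    also have "inv_mat A *\<^sub>v (A *\<^sub>v (L *\<^sub>v (R *\<^sub>v \<gamma> - r))) = (inv_mat A * A) *\<^sub>v (L *\<^sub>v (R *\<^sub>v \<gamma> - r))"
      using dims R r \<gamma> by (simp add: assoc_mult_mat_vec_dim)
    finally show ?thesis using L R r \<gamma> by (simp add: iA)
  qed
  have "B *\<^sub>v (L *\<^sub>v (R *\<^sub>v \<gamma> - r)) = (B * L) *\<^sub>v (R *\<^sub>v \<gamma> - r)"
    using dims R r \<gamma> by (simp add: assoc_mult_mat_vec_dim)
  hence 2: "B *\<^sub>v (L *\<^sub>v (R *\<^sub>v \<gamma> - r)) = R *\<^sub>v \<gamma> - r" using R r \<gamma> by (simp add: BL)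
  have "dv = (R *\<^sub>v \<gamma> + R *\<^sub>v (inv_mat G *\<^sub>v (U\<^sup>T *\<^sub>v e))) - r"
    unfolding dv_def least_squares using R \<gamma> iG(1) U e by (subst mult_add_distrib_mat_vec[of _ q m]) auto
  also have "\<dots> = B *\<^sub>v (inv_mat A *\<^sub>v (Z\<^sup>T *\<^sub>v (Q *\<^sub>v e))) + (R *\<^sub>v \<gamma> - r)"
    unfolding 1 using R \<gamma> r B iA(1) dims by (intro eq_vecI) auto
  also have "\<dots> = B *\<^sub>v c"
    unfolding c_eq using 2 B iA(1) Z Q e L R \<gamma> r by (subst mult_add_distrib_mat_vec[of _ q q]) auto
  finally have dv: "dv = B *\<^sub>v c" .
  have "inv_mat W *\<^sub>v dv = L\<^sup>T *\<^sub>v (A *\<^sub>v ((L * B) *\<^sub>v c))"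
    unfolding dv inv_W_eq using dims c by (simp add: assoc_mult_mat_vec_dim)
  also have "\<dots> = L\<^sup>T *\<^sub>v (A *\<^sub>v c)" using c by (simp add: LB)
  also have "A *\<^sub>v c = (A * inv_mat A) *\<^sub>v w" unfolding c_def using dims w by (simp add: assoc_mult_mat_vec_dim)
  also have "\<dots> = w" using w by (simp add: iA)
  finally have "dv \<bullet> (inv_mat W *\<^sub>v dv) = (B *\<^sub>v c) \<bullet> (L\<^sup>T *\<^sub>v w)" by (simp only: dv)
  also have "\<dots> = c \<bullet> (B\<^sup>T * L\<^sup>T *\<^sub>v w)" using dims c w by (simp add: scalar_prod_mult_mat_vec_both)
  also have "B\<^sup>T * L\<^sup>T = 1\<^sub>m q" using arg_cong[OF LB, of transpose_mat] dims by (simp add: transpose_mult_dim)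
  finally have "dv \<bullet> (inv_mat W *\<^sub>v dv) = c \<bullet> w" using w by simp
  also have "\<dots> = w \<bullet> c" using c w by (intro scalar_prod_comm_dim) auto
  finally show ?thesis by (simp add: c_def)
qed

lemma F_statistic_eq:
  assumes "e \<bullet> (resid_mat n U *\<^sub>v e) \<noteq> 0"
  shows "F_statistic n p q R r U Y = ((w \<bullet> (inv_mat A *\<^sub>v w)) / real q) /
     ((e \<bullet> (resid_mat n U *\<^sub>v e)) / (real n - real p - 1))"
  using numerator inv_G inv_W assms unfolding F_statistic_def Let_def G_def[symmetric] W_def[symmetric]
  by (simp add: residual residual_sum_squares)

end

end

section \<open>Perturbation of quadratic forms\<close>

context
  fixes A :: "real mat" and q :: nat and m \<eta> :: real
  assumes A: "A \<in> carrier_mat q q" and m: "0 < m" and \<eta>: "0 \<le> \<eta>" "real q * \<eta> \<le> 1 / 2"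
    and near: "\<And>j l. j < q \<Longrightarrow> l < q \<Longrightarrow> \<bar>A $$ (j, l) - m * of_bool (j = l)\<bar> \<le> \<eta> * m"
begin

text \<open>The relative perturbation: \<open>A\<close> is \<open>m\<close> times the identity plus
  \<open>m E\<close>. Entries of size at most \<eta> give \<open>E\<close> an operator norm of at
  most \<open>q * \<eta>\<close>, hence at most 1/2, which keeps \<open>A\<close> between
  \<open>m / 2\<close> and \<open>2 * m\<close> times the identity.\<close>

private definition E :: "real mat" where
  "E = mat q q (\<lambda>(j, l). A $$ (j, l) / m - of_bool (j = l))"

private lemma E: "E \<in> carrier_mat q q" by (simp add: E_def)

private lemma E_entry: "j < q \<Longrightarrow> l < q \<Longrightarrow> \<bar>E $$ (j, l)\<bar> \<le> \<eta>"
proof -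
  assume jl: "j < q" "l < q"
  hence "E $$ (j, l) = (A $$ (j, l) - m * of_bool (j = l)) / m"
    using m by (simp add: E_def diff_divide_distrib)
  thus "\<bar>E $$ (j, l)\<bar> \<le> \<eta>"
    using near[OF jl] m by (simp add: abs_divide pos_divide_le_eq)
qed

private lemma A_mult: "v \<in> carrier_vec q \<Longrightarrow> A *\<^sub>v v = m \<cdot>\<^sub>v (v + E *\<^sub>v v)"
proof (rule eq_vecI)
  fix i assume v: "v \<in> carrier_vec q" and "i < dim_vec (m \<cdot>\<^sub>v (v + E *\<^sub>v v))"
  hence i: "i < q" by (simp add: E_def)
  have "(E *\<^sub>v v) $ i = (\<Sum>l<q. A $$ (i, l) * v $ l / m - of_bool (i = l) * v $ l)"
    using i v by (simp add: E_def scalar_prod_sum algebra_simps)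
  also have "\<dots> = (A *\<^sub>v v) $ i / m - v $ i"
    using i v A by (simp add: scalar_prod_sum sum_subtractf sum_divide_distrib of_bool_def
        if_distrib[of "\<lambda>x. x * _"] cong: if_cong)
  finally show "(A *\<^sub>v v) $ i = (m \<cdot>\<^sub>v (v + E *\<^sub>v v)) $ i"
    using i v m by (simp add: E_def)
qed (use A in \<open>simp add: E_def\<close>)

private lemma E_mult_bound:
  assumes "v \<in> carrier_vec q"
  shows "(E *\<^sub>v v) \<bullet> (E *\<^sub>v v) \<le> (real q * \<eta>)\<^sup>2 * (v \<bullet> v)"
proof -
  have "((E *\<^sub>v v) $ j)\<^sup>2 \<le> real q * \<eta>\<^sup>2 * (v \<bullet> v)" if j: "j < q" for j
  proof -
    have "((E *\<^sub>v v) $ j)\<^sup>2 = (\<Sum>l<q. E $$ (j, l) * v $ l)\<^sup>2"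
      using j assms E by (simp add: scalar_prod_sum)
    also have "\<dots> \<le> (\<Sum>l<q. (E $$ (j, l))\<^sup>2) * (\<Sum>l<q. (v $ l)\<^sup>2)"
      by (rule Cauchy_Schwarz_ineq_sum)
    also have "\<dots> \<le> (\<Sum>l<q. \<eta>\<^sup>2) * (\<Sum>l<q. (v $ l)\<^sup>2)"
      using E_entry[OF j] \<eta> by (intro mult_right_mono sum_mono sum_nonneg) (auto intro: abs_le_square_iff[THEN iffD1])
    finally show ?thesis using assms by (simp add: scalar_prod_sum power2_eq_square)
  qed
  hence "(\<Sum>j<q. ((E *\<^sub>v v) $ j)\<^sup>2) \<le> (\<Sum>j<q. real q * \<eta>\<^sup>2 * (v \<bullet> v))"
    by (intro sum_mono) auto
  thus ?thesis using E by (simp add: scalar_prod_sum power2_eq_square mult_ac)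
qed

private lemma E_bilinear:
  assumes "u \<in> carrier_vec q" "v \<in> carrier_vec q"
  shows "\<bar>u \<bullet> (E *\<^sub>v v)\<bar> \<le> real q * \<eta> * (sqrt (u \<bullet> u) * sqrt (v \<bullet> v))"
proof -
  have "(u \<bullet> (E *\<^sub>v v))\<^sup>2 \<le> (u \<bullet> u) * ((E *\<^sub>v v) \<bullet> (E *\<^sub>v v))"
    using assms E by (intro scalar_prod_Cauchy_Schwarz) auto
  also have "\<dots> \<le> (u \<bullet> u) * ((real q * \<eta>)\<^sup>2 * (v \<bullet> v))"
    by (intro mult_left_mono E_mult_bound assms scalar_prod_self_nonneg)
  also have "\<dots> = (real q * \<eta> * (sqrt (u \<bullet> u) * sqrt (v \<bullet> v)))\<^sup>2"
    by (simp add: power_mult_distrib scalar_prod_self_nonneg)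
  finally have "\<bar>u \<bullet> (E *\<^sub>v v)\<bar> \<le> \<bar>real q * \<eta> * (sqrt (u \<bullet> u) * sqrt (v \<bullet> v))\<bar>"
    by (simp only: abs_le_square_iff)
  also have "\<dots> = real q * \<eta> * (sqrt (u \<bullet> u) * sqrt (v \<bullet> v))"
    using \<eta> by (simp add: abs_mult scalar_prod_self_nonneg)
  finally show ?thesis .
qed

lemma near_scalar_mat_lower:
  assumes v: "v \<in> carrier_vec q"
  shows "m / 2 * (v \<bullet> v) \<le> v \<bullet> (A *\<^sub>v v)"
proof -
  have "\<bar>v \<bullet> (E *\<^sub>v v)\<bar> \<le> real q * \<eta> * (v \<bullet> v)"
    using E_bilinear[OF v v] by (simp add: scalar_prod_self_nonneg)
  also have "\<dots> \<le> 1 / 2 * (v \<bullet> v)" using \<eta> by (intro mult_right_mono) (auto simp: scalar_prod_self_nonneg)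
  finally have "v \<bullet> v + v \<bullet> (E *\<^sub>v v) \<ge> 1 / 2 * (v \<bullet> v)" by linarith
  moreover have "v \<bullet> (A *\<^sub>v v) = m * (v \<bullet> v + v \<bullet> (E *\<^sub>v v))"
    unfolding A_mult[OF v] using v E by (simp add: scalar_prod_add_distrib[of _ q])
  ultimately show ?thesis using m mult_left_mono[of "1 / 2 * (v \<bullet> v)" "v \<bullet> v + v \<bullet> (E *\<^sub>v v)" m] by simp
qed

lemma near_scalar_mat_upper:
  assumes v: "v \<in> carrier_vec q"
  shows "v \<bullet> (A *\<^sub>v v) \<le> 2 * m * (v \<bullet> v)"
proof -
  have "\<bar>v \<bullet> (E *\<^sub>v v)\<bar> \<le> real q * \<eta> * (v \<bullet> v)"
    using E_bilinear[OF v v] by (simp add: scalar_prod_self_nonneg)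
  also have "\<dots> \<le> 1 / 2 * (v \<bullet> v)" using \<eta> by (intro mult_right_mono) (auto simp: scalar_prod_self_nonneg)
  finally have "v \<bullet> v + v \<bullet> (E *\<^sub>v v) \<le> 2 * (v \<bullet> v)" using scalar_prod_self_nonneg[of v] by linarith
  moreover have "v \<bullet> (A *\<^sub>v v) = m * (v \<bullet> v + v \<bullet> (E *\<^sub>v v))"
    unfolding A_mult[OF v] using v E by (simp add: scalar_prod_add_distrib[of _ q])
  ultimately show ?thesis using m by (simp add: field_simps)
qed

lemma near_scalar_mat_invertible: "invertible_mat A"
proof (rule invertible_matI[OF A])
  fix v assume v: "v \<in> carrier_vec q" "A *\<^sub>v v = 0\<^sub>v q"
  have "m / 2 * (v \<bullet> v) \<le> 0" using near_scalar_mat_lower[OF v(1)] v by simp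
  hence "v \<bullet> v = 0" using m scalar_prod_self_nonneg[of v] by (simp add: mult_le_0_iff)
  thus "v = 0\<^sub>v q" using v scalar_prod_self_eq_0_iff[of v] by simp
qed

text \<open>The vector \<open>h\<close>, which is \<open>m\<close> times the inverse of
  \<open>A\<close> applied to \<open>g\<close>, solves \<open>g = h + E h\<close>. Thus
  \<open>g \<bullet> h\<close> differs from \<open>g \<bullet> g\<close> by
  \<open>g \<bullet> E h\<close>, at most \<open>q * \<eta>\<close> times the product of the
  lengths, and the bound 1/2 on the norm of \<open>E\<close> makes \<open>h\<close> at most twice as
  long as \<open>g\<close>.\<close>

lemma near_scalar_mat_inverse_form:
  assumes g: "g \<in> carrier_vec q"
  shows "\<bar>m * (g \<bullet> (inv_mat A *\<^sub>v g)) - g \<bullet> g\<bar> \<le> 2 * real q * \<eta> * (g \<bullet> g)"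
proof -
  define h where "h = m \<cdot>\<^sub>v (inv_mat A *\<^sub>v g)"
  have iA: "inv_mat A \<in> carrier_mat q q" "A * inv_mat A = 1\<^sub>m q"
    using inv_mat_carrier[OF A near_scalar_mat_invertible] inv_mat_right[OF A near_scalar_mat_invertible] by auto
  have h: "h \<in> carrier_vec q" using iA g by (auto simp: h_def)
  have "A *\<^sub>v (inv_mat A *\<^sub>v g) = (A * inv_mat A) *\<^sub>v g"
    by (rule assoc_mult_mat_vec[OF A iA(1) g, symmetric])
  hence "A *\<^sub>v (inv_mat A *\<^sub>v g) = g" using g iA(2) by simp
  hence Ah: "A *\<^sub>v h = m \<cdot>\<^sub>v g"
    unfolding h_def using A iA g by (subst mult_mat_vec[of _ q q]) auto
  have gh: "g = h + E *\<^sub>v h"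
  proof (rule eq_vecI)
    fix i assume "i < dim_vec (h + E *\<^sub>v h)"
    hence i: "i < q" using E by simp
    have "(m \<cdot>\<^sub>v g) $ i = (m \<cdot>\<^sub>v (h + E *\<^sub>v h)) $ i" using Ah A_mult[OF h] by simp
    thus "g $ i = (h + E *\<^sub>v h) $ i" using i g h E m by simp
  qed (use g E in simp)
  define G H where "G = sqrt (g \<bullet> g)" and "H = sqrt (h \<bullet> h)"
  have GH0: "0 \<le> G" "0 \<le> H" "g \<bullet> g = G\<^sup>2" "h \<bullet> h = H\<^sup>2"
    by (auto simp: G_def H_def scalar_prod_self_nonneg)
  have qe: "0 \<le> real q * \<eta>" using \<eta> by simp
  have "(h \<bullet> g)\<^sup>2 \<le> (H * G)\<^sup>2"
    using scalar_prod_Cauchy_Schwarz[of h g] g h by (simp add: GH0 power_mult_distrib)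
  hence hg1: "h \<bullet> g \<le> H * G" by (rule power2_le_imp_le) (use GH0 in simp)
  have "h \<bullet> g = H\<^sup>2 + h \<bullet> (E *\<^sub>v h)"
  proof -
    have "h \<bullet> g = h \<bullet> (h + E *\<^sub>v h)" using gh by simp
    also have "\<dots> = h \<bullet> h + h \<bullet> (E *\<^sub>v h)" using h E by (intro scalar_prod_add_distrib[of _ q]) auto
    finally show ?thesis by (simp add: GH0)
  qed
  moreover have "\<bar>h \<bullet> (E *\<^sub>v h)\<bar> \<le> real q * \<eta> * H\<^sup>2"
    using E_bilinear[OF h h] by (simp add: H_def scalar_prod_self_nonneg)
  moreover have "real q * \<eta> * H\<^sup>2 \<le> 1 / 2 * H\<^sup>2" using \<eta> by (intro mult_right_mono) auto
  \<comment> \<open>Cauchy-Schwarz bounds \<open>h \<bullet> g\<close> above by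
    \<open>H * G\<close>, and the perturbation bounds it below by half of the square of
    \<open>H\<close>.\<close>
  ultimately have "H\<^sup>2 \<le> 2 * (H * G)" using hg1 by linarith
  hence "H * H \<le> H * (2 * G)" by (simp add: power2_eq_square)
  hence HG: "H \<le> 2 * G" using GH0 by (cases "H = 0") auto
  have "g \<bullet> h = g \<bullet> g - g \<bullet> (E *\<^sub>v h)"
  proof -
    have "g \<bullet> g = g \<bullet> (h + E *\<^sub>v h)" using gh by simp
    also have "\<dots> = g \<bullet> h + g \<bullet> (E *\<^sub>v h)" using g h E by (intro scalar_prod_add_distrib[of _ q]) auto
    finally show ?thesis by simp
  qed
  hence "\<bar>g \<bullet> h - g \<bullet> g\<bar> = \<bar>g \<bullet> (E *\<^sub>v h)\<bar>" by simp
  also have "\<dots> \<le> real q * \<eta> * (G * H)" using E_bilinear[OF g h] by (simp add: G_def H_def)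
  also have "\<dots> \<le> real q * \<eta> * (G * (2 * G))" using HG GH0 qe by (intro mult_left_mono) auto
  also have "\<dots> = 2 * real q * \<eta> * (g \<bullet> g)" by (simp add: GH0 power2_eq_square)
  finally show ?thesis using g iA by (simp add: h_def)
qed

text \<open>Expanding the form leaves \<open>s\<close> times \<open>g\<close> against the inverse of
  \<open>A\<close>, twice a cross term in \<open>g \<bullet> \<delta>\<close>, and \<delta> against
  \<open>A\<close>. The first is near \<open>g \<bullet> g\<close> since \<open>s\<close> and
  \<open>A\<close> are both near \<open>m\<close>; the others are small since \<open>m\<close> times
  the squared length of \<delta> is at most the square of \<eta>.\<close>

lemma perturbed_quadratic_form:
  assumes AT: "A\<^sup>T = A" and q: "1 \<le> q" and g: "g \<in> carrier_vec q" and \<delta>: "\<delta> \<in> carrier_vec q"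
    and s: "0 \<le> s" "\<bar>s - m\<bar> \<le> \<eta> * m" and small: "m * (\<delta> \<bullet> \<delta>) \<le> \<eta>\<^sup>2"
  defines "w \<equiv> sqrt s \<cdot>\<^sub>v g + A *\<^sub>v \<delta>"
  shows "\<bar>w \<bullet> (inv_mat A *\<^sub>v w) - g \<bullet> g\<bar> \<le> (4 * real q + 5) * \<eta> * (1 + g \<bullet> g)"
proof -
  have iA: "inv_mat A \<in> carrier_mat q q" "A * inv_mat A = 1\<^sub>m q" "inv_mat A * A = 1\<^sub>m q"
    "(inv_mat A)\<^sup>T = inv_mat A"
    using inv_mat_carrier[OF A near_scalar_mat_invertible] inv_mat_right[OF A near_scalar_mat_invertible]
      inv_mat_left[OF A near_scalar_mat_invertible] inv_mat_symmetric[OF A near_scalar_mat_invertible AT] by auto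
  define G where "G = g \<bullet> g"
  define b where "b = m * (g \<bullet> (inv_mat A *\<^sub>v g))"
  have G0: "0 \<le> G" by (simp add: G_def scalar_prod_self_nonneg)
  have "\<eta> \<le> real q * \<eta>" using q \<eta> by (simp add: mult_le_cancel_right1)
  hence \<eta>1: "\<eta> \<le> 1 / 2" using \<eta> by linarith
  have b: "\<bar>b - G\<bar> \<le> 2 * real q * \<eta> * G"
    using near_scalar_mat_inverse_form[OF g] by (simp add: b_def G_def)
  have iw: "inv_mat A *\<^sub>v w = sqrt s \<cdot>\<^sub>v (inv_mat A *\<^sub>v g) + \<delta>"
  proof -
    have "inv_mat A *\<^sub>v (A *\<^sub>v \<delta>) = (inv_mat A * A) *\<^sub>v \<delta>"
      by (rule assoc_mult_mat_vec[OF iA(1) A \<delta>, symmetric])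
    hence "inv_mat A *\<^sub>v (A *\<^sub>v \<delta>) = \<delta>" using \<delta> iA(3) by simp
    thus ?thesis unfolding w_def using A iA g \<delta>
      by (simp add: mult_add_distrib_mat_vec[of _ q q] mult_mat_vec[of _ q q])
  qed
  have sym: "(A *\<^sub>v \<delta>) \<bullet> (inv_mat A *\<^sub>v g) = \<delta> \<bullet> g"
    using A iA g \<delta> by (simp add: scalar_prod_mult_mat_vec_both AT)
  have "w \<bullet> (inv_mat A *\<^sub>v w) =
    s * (g \<bullet> (inv_mat A *\<^sub>v g)) + sqrt s * (g \<bullet> \<delta>) + sqrt s * (\<delta> \<bullet> g) + (A *\<^sub>v \<delta>) \<bullet> \<delta>"
    unfolding iw unfolding w_def using A iA g \<delta> s sym
    by (simp add: scalar_prod_add_distrib[of _ q] add_scalar_prod_distrib[of _ q] algebra_simps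
        flip: power2_eq_square)
  also have "(A *\<^sub>v \<delta>) \<bullet> \<delta> = \<delta> \<bullet> (A *\<^sub>v \<delta>)" using A \<delta> by (intro scalar_prod_comm_dim) auto
  also have "\<delta> \<bullet> g = g \<bullet> \<delta>" using g \<delta> by (intro scalar_prod_comm_dim) auto
  finally have eq: "w \<bullet> (inv_mat A *\<^sub>v w) - G = (s - m) / m * b + (b - G) + 2 * (sqrt s * (g \<bullet> \<delta>)) + \<delta> \<bullet> (A *\<^sub>v \<delta>)"
    using m by (simp add: b_def field_simps)
  have "\<bar>b\<bar> \<le> G + 2 * (real q * \<eta>) * G" using b G0 by linarith
  also have "\<dots> \<le> G + 2 * (1 / 2) * G" using \<eta> G0 by (intro add_left_mono mult_right_mono mult_left_mono) auto
  finally have b2: "\<bar>b\<bar> \<le> 2 * G" by simp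
  have "\<bar>(s - m) / m\<bar> \<le> \<eta>" using s m by (simp add: field_simps)
  hence 1: "\<bar>(s - m) / m * b\<bar> \<le> \<eta> * (2 * G)"
    using b2 \<eta> unfolding abs_mult by (intro mult_mono) auto
  have dA: "0 \<le> \<delta> \<bullet> (A *\<^sub>v \<delta>)" "\<delta> \<bullet> (A *\<^sub>v \<delta>) \<le> 2 * \<eta>\<^sup>2"
    using near_scalar_mat_upper[OF \<delta>] near_scalar_mat_lower[OF \<delta>] small m scalar_prod_self_nonneg[of \<delta>]
    by (auto intro: order_trans[rotated])
  have "\<eta>\<^sup>2 \<le> \<eta>" using \<eta> \<eta>1 by (simp add: power2_eq_square mult_left_le)
  hence 2: "\<bar>\<delta> \<bullet> (A *\<^sub>v \<delta>)\<bar> \<le> 2 * \<eta>" using dA by linarith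
  have "(sqrt s * (g \<bullet> \<delta>))\<^sup>2 = s * (g \<bullet> \<delta>)\<^sup>2" using s by (simp add: power_mult_distrib)
  also have "\<dots> \<le> s * (G * (\<delta> \<bullet> \<delta>))"
    using scalar_prod_Cauchy_Schwarz[of g \<delta>] g \<delta> s by (intro mult_left_mono) (auto simp: G_def)
  also have "\<dots> \<le> 2 * m * (G * (\<delta> \<bullet> \<delta>))"
  proof (intro mult_right_mono)
    have "s \<le> m + \<eta> * m" using s by linarith
    also have "\<eta> * m \<le> 1 * m" using \<eta>1 m by (intro mult_right_mono) auto
    finally show "s \<le> 2 * m" by simp
  qed (use G0 in \<open>auto simp: scalar_prod_self_nonneg\<close>)
  also have "\<dots> = 2 * G * (m * (\<delta> \<bullet> \<delta>))" by simp
  also have "\<dots> \<le> 2 * G * \<eta>\<^sup>2" using small G0 by (intro mult_left_mono) auto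
  \<comment> \<open>The cross term is of the order of the square root of \<open>G\<close>; this step
    makes it linear, which explains the factor \<open>1 + G\<close> in the final bound.\<close>
  also have "\<dots> \<le> (\<eta> * (1 + G))\<^sup>2"
  proof -
    have "2 * G \<le> (1 + G)\<^sup>2" by (simp add: power2_eq_square algebra_simps)
    thus ?thesis unfolding power_mult_distrib by (subst mult.commute) (rule mult_left_mono, auto)
  qed
  finally have "\<bar>sqrt s * (g \<bullet> \<delta>)\<bar> \<le> \<bar>\<eta> * (1 + G)\<bar>" using abs_le_square_iff by blast
  hence 3: "\<bar>2 * (sqrt s * (g \<bullet> \<delta>))\<bar> \<le> 2 * (\<eta> * (1 + G))" using \<eta> G0 by simp
  \<comment> \<open>The four summands stem from replacing \<open>s\<close> by \<open>m\<close>, from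
    replacing \<open>A\<close> by its scalar approximation, from the cross term and from the form in
    \<delta>. The constant \<open>4 * q + 5\<close> is a convenient majorant of both
    \<open>2 * q + 4\<close> and 4.\<close>
  have "\<bar>w \<bullet> (inv_mat A *\<^sub>v w) - G\<bar> \<le> \<eta> * (2 * G) + 2 * real q * \<eta> * G + 2 * (\<eta> * (1 + G)) + 2 * \<eta>"
    unfolding eq using 1 2 3 b by linarith
  also have "\<dots> = (2 * real q + 4) * (\<eta> * G) + 4 * \<eta>" by (simp add: algebra_simps)
  also have "\<dots> \<le> (4 * real q + 5) * (\<eta> * G) + (4 * real q + 5) * \<eta>"
    using \<eta> G0 by (intro add_mono mult_right_mono) auto
  also have "\<dots> = (4 * real q + 5) * \<eta> * (1 + G)" by (simp add: algebra_simps)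
  finally show ?thesis by (simp add: G_def)
qed

end

section \<open>Measurability of matrix expressions\<close>

text \<open>The matrix \<open>inv_mat A\<close> is unspecified for singular \<open>A\<close>, so that only the adjugate formula can
  be shown to depend measurably on \<open>A\<close>.\<close>

definition adj_inverse :: "real mat \<Rightarrow> real mat" where
  "adj_inverse A = (1 / det A) \<cdot>\<^sub>m adj_mat A"

lemma adj_inverse_eq: "A \<in> carrier_mat n n \<Longrightarrow> invertible_mat A \<Longrightarrow> inv_mat A = adj_inverse A"
  unfolding adj_inverse_def using inv_mat_adj invertible_mat_iff_det by blast

text \<open>Entrywise, with dimensions fixed on the whole space: matrix expressions can thus be
  treated without choosing a measurable space of matrices.\<close>

definition mat_measurable :: "'a measure \<Rightarrow> nat \<Rightarrow> nat \<Rightarrow> ('a \<Rightarrow> real mat) \<Rightarrow> bool" where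
  "mat_measurable M r c f \<longleftrightarrow> (\<forall>\<omega>\<in>space M. f \<omega> \<in> carrier_mat r c) \<and>
     (\<forall>i<r. \<forall>j<c. (\<lambda>\<omega>. f \<omega> $$ (i, j)) \<in> borel_measurable M)"

definition vec_measurable :: "'a measure \<Rightarrow> nat \<Rightarrow> ('a \<Rightarrow> real vec) \<Rightarrow> bool" where
  "vec_measurable M r f \<longleftrightarrow> (\<forall>\<omega>\<in>space M. f \<omega> \<in> carrier_vec r) \<and>
     (\<forall>i<r. (\<lambda>\<omega>. f \<omega> $ i) \<in> borel_measurable M)"

section \<open>Closure of entrywise measurability under matrix operations\<close>

lemma mat_measurable_const: "A \<in> carrier_mat r c \<Longrightarrow> mat_measurable M r c (\<lambda>_. A)"
  by (simp add: mat_measurable_def)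

lemma vec_measurable_const: "v \<in> carrier_vec r \<Longrightarrow> vec_measurable M r (\<lambda>_. v)"
  by (simp add: vec_measurable_def)

lemma mat_measurable_transpose: "mat_measurable M r c f \<Longrightarrow> mat_measurable M c r (\<lambda>\<omega>. (f \<omega>)\<^sup>T)"
  unfolding mat_measurable_def
  by (auto intro!: measurable_cong[THEN iffD2, OF index_transpose_mat(1)])

lemma mat_measurable_mult:
  assumes f: "mat_measurable M r c f" and g: "mat_measurable M c d g"
  shows "mat_measurable M r d (\<lambda>\<omega>. f \<omega> * g \<omega>)"
proof -
  have "(\<lambda>\<omega>. (f \<omega> * g \<omega>) $$ (i, j)) \<in> borel_measurable M" if "i < r" "j < d" for i j
  proof -
    have "(\<lambda>\<omega>. \<Sum>l<c. f \<omega> $$ (i, l) * g \<omega> $$ (l, j)) \<in> borel_measurable M"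
      using f g that unfolding mat_measurable_def by (intro borel_measurable_sum borel_measurable_times) auto
    moreover have "(f \<omega> * g \<omega>) $$ (i, j) = (\<Sum>l<c. f \<omega> $$ (i, l) * g \<omega> $$ (l, j))" if "\<omega> \<in> space M" for \<omega>
    proof -
      have "f \<omega> \<in> carrier_mat r c" "g \<omega> \<in> carrier_mat c d"
        using f g that by (auto simp: mat_measurable_def)
      thus ?thesis using \<open>i < r\<close> \<open>j < d\<close> by (simp add: scalar_prod_sum)
    qed
    ultimately show ?thesis by (subst measurable_cong) auto
  qed
  thus ?thesis using f g unfolding mat_measurable_def by (meson mult_carrier_mat)
qed

lemma mat_measurable_minus:
  assumes f: "mat_measurable M r c f" and g: "mat_measurable M r c g"
  shows "mat_measurable M r c (\<lambda>\<omega>. f \<omega> - g \<omega>)"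
proof -
  have "(\<lambda>\<omega>. (f \<omega> - g \<omega>) $$ (i, j)) \<in> borel_measurable M" if "i < r" "j < c" for i j
  proof -
    have "(\<lambda>\<omega>. f \<omega> $$ (i, j) - g \<omega> $$ (i, j)) \<in> borel_measurable M"
      using f g that unfolding mat_measurable_def by (intro borel_measurable_diff) auto
    moreover have "(f \<omega> - g \<omega>) $$ (i, j) = f \<omega> $$ (i, j) - g \<omega> $$ (i, j)" if "\<omega> \<in> space M" for \<omega>
    proof -
      have "f \<omega> \<in> carrier_mat r c" "g \<omega> \<in> carrier_mat r c"
        using f g that by (auto simp: mat_measurable_def)
      thus ?thesis using \<open>i < r\<close> \<open>j < c\<close> by simp
    qed
    ultimately show ?thesis by (subst measurable_cong) auto
  qed
  thus ?thesis using f g unfolding mat_measurable_def by (meson minus_carrier_mat)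
qed

lemma det_measurable:
  assumes f: "mat_measurable M n n f"
  shows "(\<lambda>\<omega>. det (f \<omega>)) \<in> borel_measurable M"
proof -
  have "(\<lambda>\<omega>. \<Sum>p\<in>{p. p permutes {0..<n}}. signof p * (\<Prod>i = 0..<n. f \<omega> $$ (i, p i))) \<in> borel_measurable M"
    using f unfolding mat_measurable_def
    by (intro borel_measurable_sum borel_measurable_times borel_measurable_prod borel_measurable_const)
      (auto dest: permutes_in_image)
  moreover have "det (f \<omega>) = (\<Sum>p\<in>{p. p permutes {0..<n}}. signof p * (\<Prod>i = 0..<n. f \<omega> $$ (i, p i)))"
    if "\<omega> \<in> space M" for \<omega>
    using f that by (intro det_def') (simp add: mat_measurable_def)
  ultimately show ?thesis by (subst measurable_cong) auto
qed

lemma mat_measurable_delete: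
  assumes f: "mat_measurable M n n f" and ij: "i < n" "j < n"
  shows "mat_measurable M (n - 1) (n - 1) (\<lambda>\<omega>. mat_delete (f \<omega>) i j)"
  unfolding mat_measurable_def
proof (intro conjI ballI allI impI)
  fix \<omega> assume "\<omega> \<in> space M"
  thus "mat_delete (f \<omega>) i j \<in> carrier_mat (n - 1) (n - 1)"
    using f by (intro mat_delete_carrier) (simp add: mat_measurable_def)
next
  fix a b assume ab: "a < n - 1" "b < n - 1"
  define a' b' where "a' = (if a < i then a else Suc a)" and "b' = (if b < j then b else Suc b)"
  have "(\<lambda>\<omega>. f \<omega> $$ (a', b')) \<in> borel_measurable M"
    using f ab ij unfolding mat_measurable_def a'_def b'_def by auto
  moreover have "mat_delete (f \<omega>) i j $$ (a, b) = f \<omega> $$ (a', b')" if "\<omega> \<in> space M" for \<omega>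
  proof -
    have "f \<omega> \<in> carrier_mat n n" using f that by (simp add: mat_measurable_def)
    thus ?thesis using ab unfolding mat_delete_def a'_def b'_def by simp
  qed
  ultimately show "(\<lambda>\<omega>. mat_delete (f \<omega>) i j $$ (a, b)) \<in> borel_measurable M"
    by (subst measurable_cong) auto
qed

lemma mat_measurable_adj_inverse:
  assumes f: "mat_measurable M n n f"
  shows "mat_measurable M n n (\<lambda>\<omega>. adj_inverse (f \<omega>))"
  unfolding mat_measurable_def
proof (intro conjI ballI allI impI)
  fix \<omega> assume "\<omega> \<in> space M"
  thus "adj_inverse (f \<omega>) \<in> carrier_mat n n"
    using f adj_mat(1)[of "f \<omega>" n] by (simp add: mat_measurable_def adj_inverse_def)
next
  fix i j assume ij: "i < n" "j < n"
  have "(\<lambda>\<omega>. (1 / det (f \<omega>)) * ((-1) ^ (j + i) * det (mat_delete (f \<omega>) j i))) \<in> borel_measurable M"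
    using det_measurable[OF f] det_measurable[OF mat_measurable_delete[OF f ij(2,1)]] by measurable
  moreover have "adj_inverse (f \<omega>) $$ (i, j) = (1 / det (f \<omega>)) * ((-1) ^ (j + i) * det (mat_delete (f \<omega>) j i))"
    if "\<omega> \<in> space M" for \<omega>
  proof -
    have "f \<omega> \<in> carrier_mat n n" using f that by (simp add: mat_measurable_def)
    thus ?thesis using ij by (simp add: adj_inverse_def adj_mat_def cofactor_def)
  qed
  ultimately show "(\<lambda>\<omega>. adj_inverse (f \<omega>) $$ (i, j)) \<in> borel_measurable M"
    by (subst measurable_cong) auto
qed

lemma vec_measurable_mult:
  assumes f: "mat_measurable M r c f" and g: "vec_measurable M c g"
  shows "vec_measurable M r (\<lambda>\<omega>. f \<omega> *\<^sub>v g \<omega>)"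
proof -
  have "(\<lambda>\<omega>. (f \<omega> *\<^sub>v g \<omega>) $ i) \<in> borel_measurable M" if "i < r" for i
  proof -
    have "(\<lambda>\<omega>. \<Sum>l<c. f \<omega> $$ (i, l) * g \<omega> $ l) \<in> borel_measurable M"
      using f g that unfolding mat_measurable_def vec_measurable_def
      by (intro borel_measurable_sum borel_measurable_times) auto
    moreover have "(f \<omega> *\<^sub>v g \<omega>) $ i = (\<Sum>l<c. f \<omega> $$ (i, l) * g \<omega> $ l)" if "\<omega> \<in> space M" for \<omega>
    proof -
      have "f \<omega> \<in> carrier_mat r c" "g \<omega> \<in> carrier_vec c"
        using f g that by (auto simp: mat_measurable_def vec_measurable_def)
      thus ?thesis using \<open>i < r\<close> by (simp add: scalar_prod_sum)
    qed
    ultimately show ?thesis by (subst measurable_cong) auto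
  qed
  thus ?thesis using f g unfolding mat_measurable_def vec_measurable_def by (meson mult_mat_vec_carrier)
qed

lemma vec_measurable_minus:
  assumes f: "vec_measurable M r f" and g: "vec_measurable M r g"
  shows "vec_measurable M r (\<lambda>\<omega>. f \<omega> - g \<omega>)"
proof -
  have "(\<lambda>\<omega>. (f \<omega> - g \<omega>) $ i) \<in> borel_measurable M" if "i < r" for i
  proof -
    have "(\<lambda>\<omega>. f \<omega> $ i - g \<omega> $ i) \<in> borel_measurable M"
      using f g that unfolding vec_measurable_def by (intro borel_measurable_diff) auto
    moreover have "(f \<omega> - g \<omega>) $ i = f \<omega> $ i - g \<omega> $ i" if "\<omega> \<in> space M" for \<omega>
    proof -
      have "g \<omega> \<in> carrier_vec r" using g that by (auto simp: vec_measurable_def)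
      thus ?thesis using \<open>i < r\<close> by simp
    qed
    ultimately show ?thesis by (subst measurable_cong) auto
  qed
  thus ?thesis using f g unfolding vec_measurable_def by (meson minus_carrier_vec)
qed

lemma scalar_prod_measurable:
  assumes f: "vec_measurable M r f" and g: "vec_measurable M r g"
  shows "(\<lambda>\<omega>. f \<omega> \<bullet> g \<omega>) \<in> borel_measurable M"
proof -
  have "(\<lambda>\<omega>. \<Sum>l<r. f \<omega> $ l * g \<omega> $ l) \<in> borel_measurable M"
    using f g unfolding vec_measurable_def by (intro borel_measurable_sum borel_measurable_times) auto
  moreover have "f \<omega> \<bullet> g \<omega> = (\<Sum>l<r. f \<omega> $ l * g \<omega> $ l)" if "\<omega> \<in> space M" for \<omega>
    using g that by (auto simp: scalar_prod_sum vec_measurable_def)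
  ultimately show ?thesis by (subst measurable_cong) auto
qed

text \<open>The residual projection wherever the Gram matrix is invertible, and a measurable
  function of \<open>V\<close> everywhere; events are phrased with this version.\<close>

definition adj_resid :: "nat \<Rightarrow> real mat \<Rightarrow> real mat" where
  "adj_resid n V = 1\<^sub>m n - V * (adj_inverse (V\<^sup>T * V) * V\<^sup>T)"

lemma adj_resid_eq: "V \<in> carrier_mat n k \<Longrightarrow> invertible_mat (V\<^sup>T * V) \<Longrightarrow> resid_mat n V = adj_resid n V"
  unfolding adj_resid_def resid_mat_def using adj_inverse_eq[OF gram_mat_carrier] by metis

lemma mat_measurable_adj_resid:
  assumes f: "mat_measurable M n k f"
  shows "mat_measurable M n n (\<lambda>\<omega>. adj_resid n (f \<omega>))"
proof -
  note fT = mat_measurable_transpose[OF f]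
  note i = mat_measurable_adj_inverse[OF mat_measurable_mult[OF fT f]]
  show ?thesis unfolding adj_resid_def
    by (intro mat_measurable_minus mat_measurable_const mat_measurable_mult[OF f mat_measurable_mult[OF i fT]]) auto
qed

text \<open>The guard of the statistic returns 0 in the singular cases, so \<open>inv_mat\<close>
  matters only where it agrees with the measurable \<open>adj_inverse\<close>; rewriting the guard
  by determinants makes the case distinction measurable too.\<close>

lemma F_statistic_measurable:
  assumes U: "mat_measurable M n m U" and Y: "vec_measurable M n Y"
    and R: "R \<in> carrier_mat q m" and r: "r \<in> carrier_vec q"
  shows "(\<lambda>\<omega>. F_statistic n p q R r (U \<omega>) (Y \<omega>)) \<in> borel_measurable M"
proof -
  define G where "G \<omega> = (U \<omega>)\<^sup>T * U \<omega>" for \<omega>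
  define \<gamma>h where "\<gamma>h \<omega> = adj_inverse (G \<omega>) *\<^sub>v ((U \<omega>)\<^sup>T *\<^sub>v Y \<omega>)" for \<omega>
  define W where "W \<omega> = R * adj_inverse (G \<omega>) * R\<^sup>T" for \<omega>
  define d where "d \<omega> = R *\<^sub>v \<gamma>h \<omega> - r" for \<omega>
  define e where "e \<omega> = Y \<omega> - U \<omega> *\<^sub>v \<gamma>h \<omega>" for \<omega>
  have G: "mat_measurable M m m G"
    unfolding G_def by (rule mat_measurable_mult[OF mat_measurable_transpose[OF U] U])
  have \<gamma>h: "vec_measurable M m \<gamma>h"
    unfolding \<gamma>h_def by (rule vec_measurable_mult[OF mat_measurable_adj_inverse[OF G]
          vec_measurable_mult[OF mat_measurable_transpose[OF U] Y]])
  have W: "mat_measurable M q q W"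
    unfolding W_def using R
    by (intro mat_measurable_mult[OF mat_measurable_mult[OF _ mat_measurable_adj_inverse[OF G]]]
        mat_measurable_const) auto
  have d: "vec_measurable M q d"
    unfolding d_def using R r
    by (intro vec_measurable_minus vec_measurable_mult[OF _ \<gamma>h] mat_measurable_const vec_measurable_const) auto
  have e: "vec_measurable M n e"
    unfolding e_def by (rule vec_measurable_minus[OF Y vec_measurable_mult[OF U \<gamma>h]])
  have m [measurable]: "(\<lambda>\<omega>. det (G \<omega>)) \<in> borel_measurable M" "(\<lambda>\<omega>. det (W \<omega>)) \<in> borel_measurable M"
    "(\<lambda>\<omega>. e \<omega> \<bullet> e \<omega>) \<in> borel_measurable M"
    "(\<lambda>\<omega>. d \<omega> \<bullet> (adj_inverse (W \<omega>) *\<^sub>v d \<omega>)) \<in> borel_measurable M"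
    using G W d e
    by (auto intro!: det_measurable scalar_prod_measurable vec_measurable_mult mat_measurable_adj_inverse)
  have "(\<lambda>\<omega>. if det (G \<omega>) \<noteq> 0 \<and> det (W \<omega>) \<noteq> 0 \<and> e \<omega> \<bullet> e \<omega> \<noteq> 0
         then ((d \<omega> \<bullet> (adj_inverse (W \<omega>) *\<^sub>v d \<omega>)) / real q) / ((e \<omega> \<bullet> e \<omega>) / (real n - real p - 1))
         else 0) \<in> borel_measurable M" by measurable
  moreover have "F_statistic n p q R r (U \<omega>) (Y \<omega>) =
      (if det (G \<omega>) \<noteq> 0 \<and> det (W \<omega>) \<noteq> 0 \<and> e \<omega> \<bullet> e \<omega> \<noteq> 0
         then ((d \<omega> \<bullet> (adj_inverse (W \<omega>) *\<^sub>v d \<omega>)) / real q) / ((e \<omega> \<bullet> e \<omega>) / (real n - real p - 1))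
         else 0)" if "\<omega> \<in> space M" for \<omega>
  proof -
    have c: "G \<omega> \<in> carrier_mat m m" "W \<omega> \<in> carrier_mat q q"
      using G W that by (auto simp: mat_measurable_def)
    show ?thesis
    proof (cases "det (G \<omega>) = 0")
      case True
      hence "\<not> invertible_mat ((U \<omega>)\<^sup>T * U \<omega>)" using invertible_mat_iff_det[OF c(1)] by (simp add: G_def)
      thus ?thesis using True by (simp add: F_statistic_def Let_def)
    next
      case False
      have iG: "inv_mat ((U \<omega>)\<^sup>T * U \<omega>) = adj_inverse (G \<omega>)" "invertible_mat ((U \<omega>)\<^sup>T * U \<omega>)"
        using adj_inverse_eq[OF c(1)] invertible_mat_iff_det[OF c(1)] False by (auto simp: G_def)
      have iW: "inv_mat (W \<omega>) = adj_inverse (W \<omega>)" if "det (W \<omega>) \<noteq> 0"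
        using adj_inverse_eq[OF c(2)] invertible_mat_iff_det[OF c(2)] that by auto
      show ?thesis using False iG iW invertible_mat_iff_det[OF c(2)]
        by (simp add: F_statistic_def Let_def W_def d_def e_def \<gamma>h_def)
    qed
  qed
  ultimately show ?thesis by (subst measurable_cong) auto
qed

section \<open>Convergence, independence and quadratic forms\<close>

text \<open>A Slutsky argument with a constant law: the probability of \<open>Y n \<le> x\<close>
  lies between the values of the distribution function of \<nu> at \<open>x - \<zeta>\<close> and
  \<open>x + \<zeta>\<close>, up to the probability that \<open>Y n\<close> and \<open>X n\<close>
  differ by more than \<zeta>. Continuity at \<open>x\<close> closes the gap. The spaces
  \<open>M n\<close> may be unrelated.\<close>

lemma weak_conv_m_of_close:
  fixes X Y :: "nat \<Rightarrow> 'a \<Rightarrow> real" and \<nu> :: "real measure"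
  assumes P: "\<And>n. n \<ge> N \<Longrightarrow> prob_space (M n)"
    and X: "\<And>n. n \<ge> N \<Longrightarrow> X n \<in> borel_measurable (M n)"
    and Y: "\<And>n. n \<ge> N \<Longrightarrow> Y n \<in> borel_measurable (M n)"
    and law: "\<And>n. n \<ge> N \<Longrightarrow> distr (M n) borel (X n) = \<nu>"
    and close: "\<And>\<zeta>. \<zeta> > 0 \<Longrightarrow> (\<lambda>n. measure (M n) {\<omega> \<in> space (M n). \<bar>Y n \<omega> - X n \<omega>\<bar> > \<zeta>}) \<longlonglongrightarrow> 0"
  shows "weak_conv_m (\<lambda>n. distr (M n) borel (Y n)) \<nu>"
  unfolding weak_conv_m_def weak_conv_def
proof (intro allI impI)
  fix x assume cont: "isCont (cdf \<nu>) x"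
  show "(\<lambda>n. cdf (distr (M n) borel (Y n)) x) \<longlonglongrightarrow> cdf \<nu> x"
  proof (rule LIMSEQ_I)
    fix e :: real assume e: "e > 0"
    have "\<forall>e>0. \<exists>d>0. \<forall>u. \<bar>u - x\<bar> < d \<longrightarrow> \<bar>cdf \<nu> u - cdf \<nu> x\<bar> < e"
      using cont by (simp add: continuous_at_eps_delta dist_real_def)
    from this[rule_format, of "e / 2"] e obtain d where d: "d > 0"
      "\<And>u. \<bar>u - x\<bar> < d \<Longrightarrow> \<bar>cdf \<nu> u - cdf \<nu> x\<bar> < e / 2" by auto
    define \<zeta> where "\<zeta> = d / 2"
    have \<zeta>: "\<zeta> > 0" and nr: "\<bar>cdf \<nu> (x + \<zeta>) - cdf \<nu> x\<bar> < e / 2" "\<bar>cdf \<nu> (x - \<zeta>) - cdf \<nu> x\<bar> < e / 2"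
      using d by (auto simp: \<zeta>_def intro!: d(2))
    obtain N1 where N1: "\<And>n. n \<ge> N1 \<Longrightarrow> norm (measure (M n) {\<omega> \<in> space (M n). \<bar>Y n \<omega> - X n \<omega>\<bar> > \<zeta>} - 0) < e / 2"
      using LIMSEQ_D[OF close[OF \<zeta>], of "e / 2"] e by auto
    show "\<exists>no. \<forall>n\<ge>no. norm (cdf (distr (M n) borel (Y n)) x - cdf \<nu> x) < e"
    proof (intro exI allI impI)
      fix n assume n: "n \<ge> max N N1"
      interpret prob_space "M n" using P n by simp
      have [measurable]: "X n \<in> borel_measurable (M n)" "Y n \<in> borel_measurable (M n)"
        using X Y n by auto
      define b where "b = measure (M n) {\<omega> \<in> space (M n). \<bar>Y n \<omega> - X n \<omega>\<bar> > \<zeta>}"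
      have b: "b < e / 2" using N1[of n] n by (simp add: b_def)
      have cX: "cdf \<nu> u = measure (M n) {\<omega> \<in> space (M n). X n \<omega> \<le> u}" for u
        using law[of n] n unfolding cdf_def
        by (subst law[symmetric, of n]) (auto simp: measure_distr vimage_def Int_def conj_commute)
      have cY: "cdf (distr (M n) borel (Y n)) u = measure (M n) {\<omega> \<in> space (M n). Y n \<omega> \<le> u}" for u
        unfolding cdf_def by (auto simp: measure_distr vimage_def Int_def conj_commute)
      have up: "measure (M n) {\<omega> \<in> space (M n). Y n \<omega> \<le> x} \<le>
          measure (M n) {\<omega> \<in> space (M n). X n \<omega> \<le> x + \<zeta>} + b"
        unfolding b_def
        by (rule order_trans[OF finite_measure_mono measure_Un_le]) auto
      have lo: "measure (M n) {\<omega> \<in> space (M n). X n \<omega> \<le> x - \<zeta>} \<le>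
          measure (M n) {\<omega> \<in> space (M n). Y n \<omega> \<le> x} + b"
        unfolding b_def
        by (rule order_trans[OF finite_measure_mono measure_Un_le]) auto
      show "norm (cdf (distr (M n) borel (Y n)) x - cdf \<nu> x) < e"
        using up lo b nr unfolding cX[symmetric] cY[symmetric] real_norm_def by linarith
    qed
  qed
qed

section \<open>Conditioning on an independent variable\<close>

context prob_space
begin

text \<open>Stands in for a bound on a conditional probability: the joint law is a product, so by
  Fubini the probability is an average over the values \<open>a\<close> of \<open>X\<close>, and
  each section is bounded by \<open>c\<close>.\<close>

lemma prob_le_of_indep:
  assumes ind: "indep_var S X T Y" and meas: "{z \<in> space (S \<Otimes>\<^sub>M T). P z} \<in> sets (S \<Otimes>\<^sub>M T)"
    and c: "0 \<le> c" and le: "\<And>a. a \<in> space S \<Longrightarrow> prob {\<omega> \<in> space M. P (a, Y \<omega>)} \<le> c"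
  shows "prob {\<omega> \<in> space M. P (X \<omega>, Y \<omega>)} \<le> c"
proof -
  have X [measurable]: "X \<in> measurable M S" and Y [measurable]: "Y \<in> measurable M T"
    using ind indep_var_distribution_eq by blast+
  have eq: "distr M S X \<Otimes>\<^sub>M distr M T Y = distr M (S \<Otimes>\<^sub>M T) (\<lambda>\<omega>. (X \<omega>, Y \<omega>))"
    using ind indep_var_distribution_eq by blast
  interpret X: prob_space "distr M S X" by (rule prob_space_distr[OF X])
  interpret Y: prob_space "distr M T Y" by (rule prob_space_distr[OF Y])
  define B where "B = {z \<in> space (S \<Otimes>\<^sub>M T). P z}"
  have B: "B \<in> sets (S \<Otimes>\<^sub>M T)" using meas by (simp add: B_def)
  have B': "B \<in> sets (distr M S X \<Otimes>\<^sub>M distr M T Y)"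
    using B by (simp cong: sets_pair_measure_cong)
  have XYs: "(X \<omega>, Y \<omega>) \<in> space (S \<Otimes>\<^sub>M T)" if "\<omega> \<in> space M" for \<omega>
    using that measurable_space[OF X] measurable_space[OF Y] by (auto simp: space_pair_measure)
  have "emeasure M {\<omega> \<in> space M. P (X \<omega>, Y \<omega>)} = emeasure M ((\<lambda>\<omega>. (X \<omega>, Y \<omega>)) -` B \<inter> space M)"
    using XYs by (intro arg_cong[where f = "emeasure M"]) (auto simp: B_def)
  also have "\<dots> = emeasure (distr M S X \<Otimes>\<^sub>M distr M T Y) B"
    unfolding eq using B by (subst emeasure_distr) auto
  also have "\<dots> = (\<integral>\<^sup>+a. emeasure (distr M T Y) (Pair a -` B) \<partial>distr M S X)"
    by (rule Y.emeasure_pair_measure_alt[OF B'])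
  also have "\<dots> \<le> (\<integral>\<^sup>+a. ennreal c \<partial>distr M S X)"
  proof (rule nn_integral_mono)
    fix a assume a: "a \<in> space (distr M S X)"
    have "Pair a -` B \<in> sets T" using B by (rule sets_Pair1)
    hence "emeasure (distr M T Y) (Pair a -` B) = emeasure M (Y -` (Pair a -` B) \<inter> space M)"
      by (subst emeasure_distr) auto
    also have "\<dots> = emeasure M {\<omega> \<in> space M. P (a, Y \<omega>)}"
      using a measurable_space[OF Y]
      by (intro arg_cong[where f = "emeasure M"]) (auto simp: B_def space_pair_measure)
    also have "\<dots> \<le> ennreal c" using le[of a] a by (simp add: emeasure_eq_measure c)
    finally show "emeasure (distr M T Y) (Pair a -` B) \<le> ennreal c" .
  qed
  also have "\<dots> = ennreal c" by (simp add: X.emeasure_space_1[simplified])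
  finally show ?thesis using c by (simp add: emeasure_eq_measure)
qed

lemma distr_of_indep:
  assumes ind: "indep_var S X T Y" and f: "f \<in> measurable (S \<Otimes>\<^sub>M T) N"
    and law: "\<And>a. a \<in> space S \<Longrightarrow> distr M N (\<lambda>\<omega>. f (a, Y \<omega>)) = \<nu>"
  shows "distr M N (\<lambda>\<omega>. f (X \<omega>, Y \<omega>)) = \<nu>"
proof (rule measure_eqI)
  have X [measurable]: "X \<in> measurable M S" and Y [measurable]: "Y \<in> measurable M T"
    using ind indep_var_distribution_eq by blast+
  obtain \<omega>0 where \<omega>0: "\<omega>0 \<in> space M" using not_empty by blast
  show s: "sets (distr M N (\<lambda>\<omega>. f (X \<omega>, Y \<omega>))) = sets \<nu>"
    using law[of "X \<omega>0"] measurable_space[OF X \<omega>0] by auto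
  have eq: "distr M S X \<Otimes>\<^sub>M distr M T Y = distr M (S \<Otimes>\<^sub>M T) (\<lambda>\<omega>. (X \<omega>, Y \<omega>))"
    using ind indep_var_distribution_eq by blast
  interpret X: prob_space "distr M S X" by (rule prob_space_distr[OF X])
  interpret Y: prob_space "distr M T Y" by (rule prob_space_distr[OF Y])
  fix A assume "A \<in> sets (distr M N (\<lambda>\<omega>. f (X \<omega>, Y \<omega>)))"
  hence A: "A \<in> sets N" by simp
  define B where "B = f -` A \<inter> space (S \<Otimes>\<^sub>M T)"
  have B: "B \<in> sets (S \<Otimes>\<^sub>M T)" using measurable_sets[OF f A] by (simp add: B_def)
  have B': "B \<in> sets (distr M S X \<Otimes>\<^sub>M distr M T Y)"
    using B by (simp cong: sets_pair_measure_cong)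
  have fXY: "(\<lambda>\<omega>. f (X \<omega>, Y \<omega>)) \<in> measurable M N"
    using measurable_compose[OF measurable_Pair[OF X Y] f] by simp
  have XYs: "(X \<omega>, Y \<omega>) \<in> space (S \<Otimes>\<^sub>M T)" if "\<omega> \<in> space M" for \<omega>
    using that measurable_space[OF X] measurable_space[OF Y] by (auto simp: space_pair_measure)
  have "emeasure (distr M N (\<lambda>\<omega>. f (X \<omega>, Y \<omega>))) A = emeasure M ((\<lambda>\<omega>. (X \<omega>, Y \<omega>)) -` B \<inter> space M)"
    unfolding emeasure_distr[OF fXY A]
    using XYs by (intro arg_cong[where f = "emeasure M"]) (auto simp: B_def)
  also have "\<dots> = emeasure (distr M S X \<Otimes>\<^sub>M distr M T Y) B"
    unfolding eq using B by (subst emeasure_distr) auto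
  also have "\<dots> = (\<integral>\<^sup>+a. emeasure (distr M T Y) (Pair a -` B) \<partial>distr M S X)"
    by (rule Y.emeasure_pair_measure_alt[OF B'])
  also have "\<dots> = (\<integral>\<^sup>+a. emeasure \<nu> A \<partial>distr M S X)"
  proof (rule nn_integral_cong)
    fix a assume "a \<in> space (distr M S X)"
    hence a: "a \<in> space S" by simp
    have fa: "(\<lambda>\<omega>. f (a, Y \<omega>)) \<in> measurable M N"
      using a by (intro measurable_compose[OF _ f] measurable_Pair) auto
    have "Pair a -` B \<in> sets T" using B by (rule sets_Pair1)
    hence "emeasure (distr M T Y) (Pair a -` B) = emeasure M (Y -` (Pair a -` B) \<inter> space M)"
      by (subst emeasure_distr) auto
    also have "\<dots> = emeasure (distr M N (\<lambda>\<omega>. f (a, Y \<omega>))) A"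
      unfolding emeasure_distr[OF fa A] using a measurable_space[OF Y]
      by (intro arg_cong[where f = "emeasure M"]) (auto simp: B_def space_pair_measure)
    finally show "emeasure (distr M T Y) (Pair a -` B) = emeasure \<nu> A" by (simp add: law[OF a])
  qed
  also have "\<dots> = emeasure \<nu> A" by (simp add: X.emeasure_space_1[simplified])
  finally show "emeasure (distr M N (\<lambda>\<omega>. f (X \<omega>, Y \<omega>))) A = emeasure \<nu> A" .
qed

end

section \<open>Fourth moments and deviations of quadratic forms\<close>

lemma abs_power_le_one_plus_power4: "c \<le> 4 \<Longrightarrow> \<bar>x ^ c\<bar> \<le> 1 + (x::real) ^ 4"
proof -
  assume c: "c \<le> 4"
  have "\<bar>x\<bar> ^ c \<le> 1 + \<bar>x\<bar> ^ 4"
  proof (cases "\<bar>x\<bar> \<le> 1")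
    case True
    hence "\<bar>x\<bar> ^ c \<le> 1" by (simp add: power_le_one)
    thus ?thesis using zero_le_power[of "\<bar>x\<bar>" 4] by linarith
  next
    case False
    hence "\<bar>x\<bar> ^ c \<le> \<bar>x\<bar> ^ 4" using c by (intro power_increasing) auto
    thus ?thesis by simp
  qed
  thus ?thesis by (simp add: power_abs)
qed

text \<open>Here \<open>m t e\<close> plays the role of the \<open>e\<close>-th moment of variable
  \<open>t\<close>, and the exponent counts how often \<open>t\<close> occurs among the four
  indices. An index occurring once kills the product and two pairs give 1. If all coincide, the
  three pairings already contribute 3, hence the correction \<open>m a 4 - 3\<close>, which vanishes
  for normal variables.\<close>

lemma prod_four_indices:
  fixes m :: "nat \<Rightarrow> nat \<Rightarrow> real"
  assumes m: "\<And>t. t < n \<Longrightarrow> m t 0 = 1" "\<And>t. t < n \<Longrightarrow> m t 1 = 0" "\<And>t. t < n \<Longrightarrow> m t 2 = 1"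
    and lt: "a < n" "b < n" "c < n" "d < n"
  shows "(\<Prod>t<n. m t (of_bool (t = a) + of_bool (t = b) + of_bool (t = c) + of_bool (t = d)))
    = of_bool (a = b) * of_bool (c = d) + of_bool (a = c) * of_bool (b = d) + of_bool (a = d) * of_bool (b = c)
      + (m a 4 - 3) * (of_bool (a = b) * of_bool (b = c) * of_bool (c = d))"
    (is "_ = ?r")
proof -
  define k where "k t = (of_bool (t = a) + of_bool (t = b) + of_bool (t = c) + of_bool (t = d) :: nat)" for t
  consider (all) "a = b" "b = c" "c = d"
    | (pairs) "(a = b \<and> c = d \<and> a \<noteq> c) \<or> (a = c \<and> b = d \<and> a \<noteq> b) \<or> (a = d \<and> b = c \<and> a \<noteq> b)"
    | (single) "(a \<noteq> b \<and> a \<noteq> c \<and> a \<noteq> d) \<or> (b \<noteq> a \<and> b \<noteq> c \<and> b \<noteq> d) \<or> (c \<noteq> a \<and> c \<noteq> b \<and> c \<noteq> d)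
        \<or> (d \<noteq> a \<and> d \<noteq> b \<and> d \<noteq> c)"
    by fastforce
  hence "(\<Prod>t<n. m t (k t)) = ?r"
  proof cases
    case all
    have "m t (k t) = (if t = a then m a 4 else 1)" if "t < n" for t
      using m(1)[OF that] all by (auto simp: k_def numeral_eq_Suc)
    hence "(\<Prod>t<n. m t (k t)) = (\<Prod>t<n. if t = a then m a 4 else 1)" by (intro prod.cong) auto
    thus ?thesis using all lt by simp
  next
    case pairs
    have "k t = 0 \<or> k t = 2" for t
      using pairs unfolding k_def by (elim disjE conjE) auto
    hence "m t (k t) = 1" if "t < n" for t using m that by metis
    hence "(\<Prod>t<n. m t (k t)) = 1" by (intro prod.neutral) auto
    thus ?thesis using pairs by (elim disjE conjE) auto
  next
    case single
    have "\<exists>t\<in>{a, b, c, d}. k t = 1"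
      using single unfolding k_def by (elim disjE conjE) auto
    then obtain t where t: "t < n" "k t = 1" using lt by auto
    hence "(\<Prod>t<n. m t (k t)) = 0" using m(2)[of t] by (intro prod_zero) (auto intro!: bexI[of _ t])
    thus ?thesis using single by (elim disjE conjE) auto
  qed
  thus ?thesis by (simp only: k_def)
qed

context prob_space
begin

text \<open>Collecting equal indices writes the product of four variables as a product over all
  \<open>t < n\<close> of powers of \<open>z t\<close>, with exponent 0 for absent indices, so that
  independence factorises the expectation.\<close>

lemma indep_fourth_moments:
  fixes z :: "nat \<Rightarrow> 'a \<Rightarrow> real"
  assumes ind: "indep_vars (\<lambda>_. borel) z {..<n}" and int4: "\<And>i. i < n \<Longrightarrow> integrable M (\<lambda>\<omega>. z i \<omega> ^ 4)"
    and m1: "\<And>i. i < n \<Longrightarrow> expectation (z i) = 0"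
    and m2: "\<And>i. i < n \<Longrightarrow> expectation (\<lambda>\<omega>. (z i \<omega>)\<^sup>2) = 1"
    and lt: "a < n" "b < n" "c < n" "d < n"
  shows "integrable M (\<lambda>\<omega>. z a \<omega> * z b \<omega> * z c \<omega> * z d \<omega>)" (is ?int)
    and "expectation (\<lambda>\<omega>. z a \<omega> * z b \<omega> * z c \<omega> * z d \<omega>)
      = of_bool (a = b) * of_bool (c = d) + of_bool (a = c) * of_bool (b = d) + of_bool (a = d) * of_bool (b = c)
      + (expectation (\<lambda>\<omega>. z a \<omega> ^ 4) - 3) * (of_bool (a = b) * of_bool (b = c) * of_bool (c = d))" (is ?ex)
proof -
  have zm [measurable]: "z i \<in> borel_measurable M" if "i < n" for i
    using ind that by (auto simp: indep_vars_def)
  have int: "integrable M (\<lambda>\<omega>. z i \<omega> ^ k)" if "i < n" "k \<le> 4" for i k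
  proof (rule Bochner_Integration.integrable_bound[where f = "\<lambda>\<omega>. 1 + z i \<omega> ^ 4"])
    show "AE \<omega> in M. norm (z i \<omega> ^ k) \<le> norm (1 + z i \<omega> ^ 4)"
      using abs_power_le_one_plus_power4[OF that(2)] by (auto intro!: AE_I2 order_trans[OF _ abs_ge_self])
  qed (use int4 that in auto)
  define k where "k t = (of_bool (t = a) + of_bool (t = b) + of_bool (t = c) + of_bool (t = d) :: nat)" for t
  have k4: "k t \<le> 4" for t by (simp add: k_def)
  have pd: "(\<Prod>t<n. z t \<omega> ^ k t) = z a \<omega> * z b \<omega> * z c \<omega> * z d \<omega>" for \<omega>
    using lt by (simp add: k_def power_add prod.distrib of_bool_def if_distrib[of "\<lambda>e. _ ^ e"] cong: if_cong)
  have ind': "indep_vars (\<lambda>_. borel) (\<lambda>t \<omega>. z t \<omega> ^ k t) {..<n}"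
    by (rule indep_vars_compose2[OF ind, where Y = "\<lambda>t x. x ^ k t"]) auto
  show ?int using indep_vars_integrable[OF _ ind'] int k4 by (simp add: pd)
  have "expectation (\<lambda>\<omega>. z a \<omega> * z b \<omega> * z c \<omega> * z d \<omega>) = (\<Prod>t<n. expectation (\<lambda>\<omega>. z t \<omega> ^ k t))"
    using indep_vars_lebesgue_integral[OF _ ind'] int k4 by (simp add: pd)
  also have "\<dots> = of_bool (a = b) * of_bool (c = d) + of_bool (a = c) * of_bool (b = d) + of_bool (a = d) * of_bool (b = c)
      + (expectation (\<lambda>\<omega>. z a \<omega> ^ 4) - 3) * (of_bool (a = b) * of_bool (b = c) * of_bool (c = d))"
    unfolding k_def
    by (rule prod_four_indices[where m = "\<lambda>t e. expectation (\<lambda>\<omega>. z t \<omega> ^ e)"]) (use lt m1 m2 in \<open>auto simp: prob_space\<close>)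
  finally show ?ex .
qed

lemma indep_second_moments:
  fixes z :: "nat \<Rightarrow> 'a \<Rightarrow> real"
  assumes ind: "indep_vars (\<lambda>_. borel) z {..<n}" and int4: "\<And>i. i < n \<Longrightarrow> integrable M (\<lambda>\<omega>. z i \<omega> ^ 4)"
    and m1: "\<And>i. i < n \<Longrightarrow> expectation (z i) = 0"
    and m2: "\<And>i. i < n \<Longrightarrow> expectation (\<lambda>\<omega>. (z i \<omega>)\<^sup>2) = 1"
    and lt: "a < n" "b < n"
  shows "integrable M (\<lambda>\<omega>. z a \<omega> * z b \<omega>)" and "expectation (\<lambda>\<omega>. z a \<omega> * z b \<omega>) = of_bool (a = b)"
proof -
  have zm [measurable]: "z i \<in> borel_measurable M" if "i < n" for i
    using ind that by (auto simp: indep_vars_def)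
  have int: "integrable M (\<lambda>\<omega>. z i \<omega> ^ k)" if "i < n" "k \<le> 4" for i k
  proof (rule Bochner_Integration.integrable_bound[where f = "\<lambda>\<omega>. 1 + z i \<omega> ^ 4"])
    show "AE \<omega> in M. norm (z i \<omega> ^ k) \<le> norm (1 + z i \<omega> ^ 4)"
      using abs_power_le_one_plus_power4[OF that(2)] by (auto intro!: AE_I2 order_trans[OF _ abs_ge_self])
  qed (use int4 that in auto)
  define k where "k t = (of_bool (t = a) + of_bool (t = b) :: nat)" for t
  have k4: "k t \<le> 4" for t by (simp add: k_def)
  have pd: "(\<Prod>t<n. z t \<omega> ^ k t) = z a \<omega> * z b \<omega>" for \<omega>
    using lt by (simp add: k_def power_add prod.distrib of_bool_def if_distrib[of "\<lambda>e. _ ^ e"] cong: if_cong)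
  have ind': "indep_vars (\<lambda>_. borel) (\<lambda>t \<omega>. z t \<omega> ^ k t) {..<n}"
    by (rule indep_vars_compose2[OF ind, where Y = "\<lambda>t x. x ^ k t"]) auto
  show "integrable M (\<lambda>\<omega>. z a \<omega> * z b \<omega>)"
    using indep_vars_integrable[OF _ ind'] int k4 by (simp add: pd)
  have ex: "expectation (\<lambda>\<omega>. z a \<omega> * z b \<omega>) = (\<Prod>t<n. expectation (\<lambda>\<omega>. z t \<omega> ^ k t))"
    using indep_vars_lebesgue_integral[OF _ ind'] int k4 by (simp add: pd)
  show "expectation (\<lambda>\<omega>. z a \<omega> * z b \<omega>) = of_bool (a = b)"
  proof (cases "a = b")
    case True
    thus ?thesis using m2[of a] lt by (simp add: power2_eq_square)
  next
    case False
    hence "expectation (\<lambda>\<omega>. z a \<omega> ^ k a) = 0" using m1[of a] lt by (simp add: k_def)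
    hence "(\<Prod>t<n. expectation (\<lambda>\<omega>. z t \<omega> ^ k t)) = 0"
      using lt by (intro prod_zero) (auto intro!: bexI[of _ a])
    thus ?thesis using ex False by simp
  qed
qed

text \<open>Chebyshev's inequality. The three pairings in the fourth moments give the square of the
  trace and, by symmetry of \<open>Q\<close>, twice the sum of squared entries; the diagonal
  correction is at most \<kappa> times that sum. The variance is therefore at most
  \<open>\<kappa> + 2\<close> times the sum of squares.\<close>

lemma quadratic_form_deviation:
  fixes z :: "nat \<Rightarrow> 'a \<Rightarrow> real" and Q :: "nat \<Rightarrow> nat \<Rightarrow> real"
  assumes ind: "indep_vars (\<lambda>_. borel) z {..<n}" and int4: "\<And>i. i < n \<Longrightarrow> integrable M (\<lambda>\<omega>. z i \<omega> ^ 4)"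
    and m1: "\<And>i. i < n \<Longrightarrow> expectation (z i) = 0"
    and m2: "\<And>i. i < n \<Longrightarrow> expectation (\<lambda>\<omega>. (z i \<omega>)\<^sup>2) = 1"
    and m4: "\<And>i. i < n \<Longrightarrow> expectation (\<lambda>\<omega>. z i \<omega> ^ 4) \<le> \<kappa>"
    and Q: "\<And>i j. i < n \<Longrightarrow> j < n \<Longrightarrow> Q i j = Q j i" and \<kappa>: "0 \<le> \<kappa>" and t: "0 < t"
  shows "prob {\<omega> \<in> space M. t < \<bar>(\<Sum>i<n. \<Sum>j<n. Q i j * z i \<omega> * z j \<omega>) - (\<Sum>i<n. Q i i)\<bar>}
    \<le> (\<kappa> + 2) * (\<Sum>i<n. \<Sum>j<n. (Q i j)\<^sup>2) / t\<^sup>2"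
proof -
  have zm [measurable]: "z i \<in> borel_measurable M" if "i < n" for i
    using ind that by (auto simp: indep_vars_def)
  define S where "S \<omega> = (\<Sum>i<n. \<Sum>j<n. Q i j * z i \<omega> * z j \<omega>)" for \<omega>
  define T where "T = (\<Sum>i<n. Q i i)"
  define R where "R = (\<Sum>i<n. \<Sum>j<n. (Q i j)\<^sup>2)"
  define f where "f i = expectation (\<lambda>\<omega>. z i \<omega> ^ 4)" for i
  have M4: "integrable M (\<lambda>\<omega>. z a \<omega> * z b \<omega> * z c \<omega> * z d \<omega>)"
    "expectation (\<lambda>\<omega>. z a \<omega> * z b \<omega> * z c \<omega> * z d \<omega>)
      = of_bool (a = b) * of_bool (c = d) + of_bool (a = c) * of_bool (b = d) + of_bool (a = d) * of_bool (b = c)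
      + (f a - 3) * (of_bool (a = b) * of_bool (b = c) * of_bool (c = d))"
    if "a < n" "b < n" "c < n" "d < n" for a b c d
    unfolding f_def
     apply (rule indep_fourth_moments(1)[OF ind]; use int4 m1 m2 that in simp)
    apply (rule indep_fourth_moments(2)[OF ind]; use int4 m1 m2 that in simp)
    done
  have M2: "integrable M (\<lambda>\<omega>. z a \<omega> * z b \<omega>)" "expectation (\<lambda>\<omega>. z a \<omega> * z b \<omega>) = of_bool (a = b)"
    if "a < n" "b < n" for a b
     apply (rule indep_second_moments(1)[OF ind]; use int4 m1 m2 that in simp)
    apply (rule indep_second_moments(2)[OF ind]; use int4 m1 m2 that in simp)
    done
  have if_sum: "(\<Sum>k\<in>A. if P then g k else 0) = (if P then \<Sum>k\<in>A. g k else 0)" for A :: "nat set" and P and g :: "nat \<Rightarrow> real"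
    by simp
  have [measurable]: "S \<in> borel_measurable M"
    unfolding S_def by (intro borel_measurable_sum borel_measurable_times) auto
  have S2: "(S \<omega>)\<^sup>2 = (\<Sum>i<n. \<Sum>j<n. \<Sum>k<n. \<Sum>l<n. Q i j * Q k l * (z i \<omega> * z j \<omega> * z k \<omega> * z l \<omega>))" for \<omega>
    unfolding S_def power2_eq_square sum_distrib_right
    unfolding sum_distrib_left by (intro sum.cong refl) (simp add: mult_ac)
  have intS2: "integrable M (\<lambda>\<omega>. (S \<omega>)\<^sup>2)"
    unfolding S2 by (intro Bochner_Integration.integrable_sum integrable_mult_right M4(1)) auto
  have intS: "integrable M S"
    unfolding S_def mult.assoc by (intro Bochner_Integration.integrable_sum integrable_mult_right M2(1)) auto
  have ES: "expectation S = T"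
  proof -
    have "expectation S = (\<Sum>i<n. \<Sum>j<n. Q i j * of_bool (i = j))"
      unfolding S_def mult.assoc
      by (subst Bochner_Integration.integral_sum, (intro Bochner_Integration.integrable_sum integrable_mult_right M2(1); simp),
          intro sum.cong refl, subst Bochner_Integration.integral_sum, (intro integrable_mult_right M2(1); simp),
          intro sum.cong refl, simp add: M2(2))
    thus ?thesis by (simp add: T_def of_bool_def if_distrib[of "\<lambda>x. _ * x"] cong: if_cong)
  qed
  have "expectation (\<lambda>\<omega>. (S \<omega>)\<^sup>2) = (\<Sum>i<n. \<Sum>j<n. \<Sum>k<n. \<Sum>l<n. Q i j * Q k l *
      (of_bool (i = j) * of_bool (k = l) + of_bool (i = k) * of_bool (j = l) + of_bool (i = l) * of_bool (j = k)
      + (f i - 3) * (of_bool (i = j) * of_bool (j = k) * of_bool (k = l))))"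
  proof -
    have "has_bochner_integral M (\<lambda>\<omega>. Q i j * Q k l * (z i \<omega> * z j \<omega> * z k \<omega> * z l \<omega>))
       (Q i j * Q k l * (of_bool (i = j) * of_bool (k = l) + of_bool (i = k) * of_bool (j = l) + of_bool (i = l) * of_bool (j = k)
      + (f i - 3) * (of_bool (i = j) * of_bool (j = k) * of_bool (k = l))))"
      if "i < n" "j < n" "k < n" "l < n" for i j k l
      using has_bochner_integral_integrable[OF M4(1)[OF that]]
      by (intro has_bochner_integral_mult_right) (simp add: M4(2)[OF that])
    thus ?thesis unfolding S2
      by (intro has_bochner_integral_integral_eq has_bochner_integral_sum) auto
  qed
  also have "\<dots> = T\<^sup>2 + R + (\<Sum>i<n. \<Sum>j<n. Q i j * Q j i) + (\<Sum>i<n. (f i - 3) * (Q i i)\<^sup>2)"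
  proof -
    have 1: "(\<Sum>i<n. \<Sum>j<n. \<Sum>k<n. \<Sum>l<n. Q i j * Q k l * (of_bool (i = j) * of_bool (k = l))) = T\<^sup>2"
      by (simp add: of_bool_def if_distrib[of "\<lambda>x. _ * x"] T_def power2_eq_square sum_product mult_ac if_sum cong: if_cong)
    have 2: "(\<Sum>i<n. \<Sum>j<n. \<Sum>k<n. \<Sum>l<n. Q i j * Q k l * (of_bool (i = k) * of_bool (j = l))) = R"
      by (simp add: of_bool_def if_distrib[of "\<lambda>x. _ * x"] R_def power2_eq_square mult_ac cong: if_cong)
    have 3: "(\<Sum>i<n. \<Sum>j<n. \<Sum>k<n. \<Sum>l<n. Q i j * Q k l * (of_bool (i = l) * of_bool (j = k))) = (\<Sum>i<n. \<Sum>j<n. Q i j * Q j i)"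
      by (simp add: of_bool_def if_distrib[of "\<lambda>x. _ * x"] if_sum cong: if_cong)
    have 4: "(\<Sum>i<n. \<Sum>j<n. \<Sum>k<n. \<Sum>l<n. Q i j * Q k l * ((f i - 3) * (of_bool (i = j) * of_bool (j = k) * of_bool (k = l)))) = (\<Sum>i<n. (f i - 3) * (Q i i)\<^sup>2)"
      by (simp add: of_bool_def if_distrib[of "\<lambda>x. _ * x"] if_distrib[of "\<lambda>x. x * _"] power2_eq_square mult_ac if_sum cong: if_cong)
    show ?thesis unfolding distrib_left sum.distrib 1 2 3 4 ..
  qed
  also have "(\<Sum>i<n. \<Sum>j<n. Q i j * Q j i) = R"
    unfolding R_def by (intro sum.cong refl) (simp add: Q power2_eq_square)
  \<comment> \<open>The \<open>- 3\<close> is dropped, and each squared diagonal entry is enlarged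
    to the sum of squares of its row.\<close>
  also have "(\<Sum>i<n. (f i - 3) * (Q i i)\<^sup>2) \<le> \<kappa> * R"
  proof -
    have "(\<Sum>i<n. (f i - 3) * (Q i i)\<^sup>2) \<le> (\<Sum>i<n. \<kappa> * (\<Sum>j<n. (Q i j)\<^sup>2))"
    proof (rule sum_mono)
      fix i assume i: "i \<in> {..<n}"
      have "(f i - 3) * (Q i i)\<^sup>2 \<le> \<kappa> * (Q i i)\<^sup>2"
        using m4[of i] i by (intro mult_right_mono) (auto simp: f_def)
      also have "\<dots> \<le> \<kappa> * (\<Sum>j<n. (Q i j)\<^sup>2)"
        using i \<kappa> by (intro mult_left_mono member_le_sum) auto
      finally show "(f i - 3) * (Q i i)\<^sup>2 \<le> \<kappa> * (\<Sum>j<n. (Q i j)\<^sup>2)" .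
    qed
    thus ?thesis by (simp add: R_def sum_distrib_left)
  qed
  finally have E2: "expectation (\<lambda>\<omega>. (S \<omega>)\<^sup>2) \<le> T\<^sup>2 + (\<kappa> + 2) * R" by (simp add: algebra_simps)
  have "variance S \<le> (\<kappa> + 2) * R"
    using E2 variance_eq[OF intS intS2] ES by simp
  moreover have "prob {\<omega> \<in> space M. t \<le> \<bar>S \<omega> - expectation S\<bar>} \<le> variance S / t\<^sup>2"
    using Chebyshev_inequality[OF _ intS2 t] by simp
  moreover have "prob {\<omega> \<in> space M. t < \<bar>S \<omega> - T\<bar>} \<le> prob {\<omega> \<in> space M. t \<le> \<bar>S \<omega> - expectation S\<bar>}"
    by (rule finite_measure_mono) (auto simp: ES, measurable)
  ultimately have "prob {\<omega> \<in> space M. t < \<bar>S \<omega> - T\<bar>} \<le> (\<kappa> + 2) * R / t\<^sup>2"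
    using t by (meson divide_right_mono order_trans zero_le_power2)
  thus ?thesis by (simp add: S_def T_def R_def)
qed

end

section \<open>Linear images of normal vectors\<close>

interpretation lborel_product: product_sigma_finite "\<lambda>_::'i. lborel :: real measure"
  by standard

text \<open>On a box the claim splits into coordinates, where a map
  \<open>x \<mapsto> a + s * x\<close> with \<open>\<bar>s\<bar> = 1\<close> preserves length.
  Translations and the reflection are the invariances that the uniqueness argument for linear images
  uses.\<close>

lemma Rn_affine_reflection:
  fixes a :: "nat \<Rightarrow> real"
  assumes s: "\<bar>s\<bar> = 1"
  shows "distr (Rn p) (Rn p) (\<lambda>z. \<lambda>i\<in>{..<p}. a i + s * z i) = Rn p"
proof (rule lborel_product.PiM_eqI)
  have m [measurable]: "(\<lambda>z. \<lambda>i\<in>{..<p}. a i + s * z i) \<in> measurable (Rn p) (Rn p)"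
    by measurable
  fix A :: "nat \<Rightarrow> real set" assume A: "\<And>i. i \<in> {..<p} \<Longrightarrow> A i \<in> sets lborel"
  define B where "B i = {x. a i + s * x \<in> A i}" for i
  have B: "B i \<in> sets lborel" if "i \<in> {..<p}" for i
  proof -
    have "(\<lambda>x. a i + s * x) -` A i \<inter> space borel \<in> sets borel"
      using A[OF that] by (intro measurable_sets[of _ borel borel]) auto
    thus ?thesis by (simp add: B_def vimage_def)
  qed
  have eB: "emeasure lborel (B i) = emeasure lborel (A i)" if "i \<in> {..<p}" for i
  proof -
    have "emeasure lborel (A i) = emeasure (density (distr lborel borel (\<lambda>x. a i + s * x)) (\<lambda>_. ennreal \<bar>s\<bar>)) (A i)"
      using s by (intro arg_cong[OF lborel_real_affine, of _ "\<lambda>N. emeasure N (A i)"]) auto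
    also have "\<dots> = emeasure (distr lborel borel (\<lambda>x. a i + s * x)) (A i)"
      using A[OF that] s by (simp add: emeasure_density)
    also have "\<dots> = emeasure lborel (B i)"
      using A[OF that] by (subst emeasure_distr) (auto simp: B_def vimage_def)
    finally show ?thesis ..
  qed
  have "emeasure (distr (Rn p) (Rn p) (\<lambda>z. \<lambda>i\<in>{..<p}. a i + s * z i)) (Pi\<^sub>E {..<p} A)
     = emeasure (Rn p) ((\<lambda>z. \<lambda>i\<in>{..<p}. a i + s * z i) -` Pi\<^sub>E {..<p} A \<inter> space (Rn p))"
    using A by (intro emeasure_distr m sets_PiM_I_finite) auto
  also have "(\<lambda>z. \<lambda>i\<in>{..<p}. a i + s * z i) -` Pi\<^sub>E {..<p} A \<inter> space (Rn p) = Pi\<^sub>E {..<p} B"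
    by (rule Set.set_eqI) (simp add: B_def space_PiM PiE_iff conj_commute)
  also have "emeasure (Rn p) (Pi\<^sub>E {..<p} B) = (\<Prod>i<p. emeasure lborel (B i))"
    using B by (intro lborel_product.emeasure_PiM) auto
  also have "\<dots> = (\<Prod>i<p. emeasure lborel (A i))" using eB by (intro prod.cong) auto
  finally show "emeasure (distr (Rn p) (Rn p) (\<lambda>z. \<lambda>i\<in>{..<p}. a i + s * z i)) (Pi\<^sub>E {..<p} A)
     = (\<Prod>i<p. emeasure lborel (A i))" .
qed auto

lemma nn_integral_Rn_affine_reflection:
  assumes s: "\<bar>s\<bar> = 1" and f: "f \<in> borel_measurable (Rn p)"
  shows "(\<integral>\<^sup>+z. f (\<lambda>i\<in>{..<p}. a i + s * z i) \<partial>Rn p) = (\<integral>\<^sup>+z. f z \<partial>Rn p)"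
proof -
  have "(\<integral>\<^sup>+z. f z \<partial>Rn p) = (\<integral>\<^sup>+z. f z \<partial>distr (Rn p) (Rn p) (\<lambda>z. \<lambda>i\<in>{..<p}. a i + s * z i))"
    by (simp add: Rn_affine_reflection[OF s])
  also have "\<dots> = (\<integral>\<^sup>+z. f (\<lambda>i\<in>{..<p}. a i + s * z i) \<partial>Rn p)"
    using f by (intro nn_integral_distr) auto
  finally show ?thesis ..
qed

section \<open>Linear maps and Lebesgue measure\<close>

definition mat_fun :: "nat \<Rightarrow> real mat \<Rightarrow> (nat \<Rightarrow> real) \<Rightarrow> nat \<Rightarrow> real" where
  "mat_fun p T z = (\<lambda>i\<in>{..<p}. \<Sum>j<p. T $$ (i, j) * z j)"

lemma mat_fun_measurable [measurable]: "mat_fun p T \<in> measurable (Rn p) (Rn p)"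
  unfolding mat_fun_def by measurable

lemma mat_fun_mult:
  assumes "T \<in> carrier_mat p p" "S \<in> carrier_mat p p"
  shows "mat_fun p T (mat_fun p S z) = mat_fun p (T * S) z"
proof
  fix i
  show "mat_fun p T (mat_fun p S z) i = mat_fun p (T * S) z i"
  proof (cases "i < p")
    case True
    have "(\<Sum>j<p. T $$ (i, j) * (\<Sum>l<p. S $$ (j, l) * z l)) = (\<Sum>l<p. \<Sum>j<p. T $$ (i, j) * S $$ (j, l) * z l)"
      by (subst sum.swap) (simp add: sum_distrib_left mult_ac)
    also have "\<dots> = (\<Sum>l<p. (T * S) $$ (i, l) * z l)"
      using assms True by (intro sum.cong refl) (simp add: scalar_prod_def atLeast0LessThan sum_distrib_right)
    finally show ?thesis using True by (simp add: mat_fun_def)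
  qed (simp add: mat_fun_def)
qed

lemma mat_fun_one: "z \<in> space (Rn p) \<Longrightarrow> mat_fun p (1\<^sub>m p) z = z"
  by (rule ext) (auto simp: mat_fun_def space_PiM PiE_iff extensional_def of_bool_def
      if_distrib[of "\<lambda>x. x * _"] cong: if_cong)

text \<open>Uniqueness of Haar measure on \<open>Rn p\<close>: the integral of \<open>f (T x) * g (T x + y)\<close> over
  \<open>(x, y)\<close> is evaluated in both orders, using only the invariance of Lebesgue measure under
  translations and reflection.\<close>

lemma nn_integral_linear_exchange:
  assumes T: "T \<in> carrier_mat p p" and S: "S \<in> carrier_mat p p" and TS: "T * S = 1\<^sub>m p"
    and f [measurable]: "f \<in> borel_measurable (Rn p)" and g [measurable]: "g \<in> borel_measurable (Rn p)"
  shows "(\<integral>\<^sup>+x. f (mat_fun p T x) \<partial>Rn p) * (\<integral>\<^sup>+y. g y \<partial>Rn p)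
    = (\<integral>\<^sup>+x. g (mat_fun p T x) \<partial>Rn p) * (\<integral>\<^sup>+y. f y \<partial>Rn p)"
proof -
  interpret pair_sigma_finite "Rn p" "Rn p"
    by (intro pair_sigma_finite.intro lborel_product.sigma_finite) auto
  define pl where "pl s u v = (\<lambda>i\<in>{..<p}. u i + s * v i)" for s :: real and u v :: "nat \<Rightarrow> real"
  have pl_m [measurable]: "(\<lambda>w. pl s (fst w) (snd w)) \<in> measurable (Rn p \<Otimes>\<^sub>M Rn p) (Rn p)" for s
    unfolding pl_def by measurable
  have [measurable]: "(\<lambda>w. pl s (mat_fun p T (fst w)) (snd w)) \<in> measurable (Rn p \<Otimes>\<^sub>M Rn p) (Rn p)" for s
    using measurable_compose[OF _ pl_m, of "\<lambda>w. (mat_fun p T (fst w), snd w)"] by simp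
  have [measurable]: "(\<lambda>w. pl s (mat_fun p T (snd w)) (fst w)) \<in> measurable (Rn p \<Otimes>\<^sub>M Rn p) (Rn p)" for s
    using measurable_compose[OF _ pl_m, of "\<lambda>w. (mat_fun p T (snd w), fst w)"] by simp
  have [measurable]: "(\<lambda>x. pl s u x) \<in> measurable (Rn p) (Rn p)" for s u
    unfolding pl_def by measurable
  have [measurable]: "(\<lambda>x. pl s (mat_fun p T x) u) \<in> measurable (Rn p) (Rn p)" for s u
    by (rule measurable_compose[OF mat_fun_measurable]) (unfold pl_def, measurable)
  have "(\<integral>\<^sup>+x. f (mat_fun p T x) \<partial>Rn p) * (\<integral>\<^sup>+y. g y \<partial>Rn p)
      = (\<integral>\<^sup>+x. f (mat_fun p T x) * (\<integral>\<^sup>+y. g y \<partial>Rn p) \<partial>Rn p)"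
    by (simp add: nn_integral_multc)
  also have "\<dots> = (\<integral>\<^sup>+x. f (mat_fun p T x) * (\<integral>\<^sup>+y. g (pl 1 (mat_fun p T x) y) \<partial>Rn p) \<partial>Rn p)"
    by (intro nn_integral_cong) (simp only: pl_def nn_integral_Rn_affine_reflection[OF abs_one g])
  also have "\<dots> = (\<integral>\<^sup>+x. (\<integral>\<^sup>+y. f (mat_fun p T x) * g (pl 1 (mat_fun p T x) y) \<partial>Rn p) \<partial>Rn p)"
    by (intro nn_integral_cong nn_integral_cmult[symmetric]) measurable
  also have "\<dots> = (\<integral>\<^sup>+y. (\<integral>\<^sup>+x. f (mat_fun p T x) * g (pl 1 (mat_fun p T x) y) \<partial>Rn p) \<partial>Rn p)"
    by (rule Fubini') measurable
  also have "\<dots> = (\<integral>\<^sup>+y. (\<integral>\<^sup>+x. g (mat_fun p T x) * f (pl (- 1) (mat_fun p T x) y) \<partial>Rn p) \<partial>Rn p)"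
  proof (rule nn_integral_cong)
    fix y assume y: "y \<in> space (Rn p)"
    define h where "h x = f (mat_fun p T x) * g (pl 1 (mat_fun p T x) y)" for x
    have h: "h \<in> borel_measurable (Rn p)" unfolding h_def using y by measurable
    \<comment> \<open>Translating \<open>x\<close> by \<open>- S y\<close> changes
      \<open>T x\<close> into \<open>T x - y\<close>, because \<open>T S\<close> is the identity.
      The argument \<open>T x + y\<close> of \<open>g\<close> thereby becomes \<open>T x\<close>,
      and the shift moves over to \<open>f\<close>.\<close>
    have "(\<integral>\<^sup>+x. h x \<partial>Rn p) = (\<integral>\<^sup>+x. h (\<lambda>i\<in>{..<p}. - mat_fun p S y i + 1 * x i) \<partial>Rn p)"
      by (rule nn_integral_Rn_affine_reflection[OF _ h, symmetric]) simp
    also have "\<dots> = (\<integral>\<^sup>+x. g (mat_fun p T x) * f (pl (- 1) (mat_fun p T x) y) \<partial>Rn p)"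
    proof (rule nn_integral_cong)
      fix x assume x: "x \<in> space (Rn p)"
      have TSy: "mat_fun p T (mat_fun p S y) = y" by (simp add: mat_fun_mult[OF T S] TS mat_fun_one[OF y])
      have 1: "mat_fun p T (\<lambda>i\<in>{..<p}. - mat_fun p S y i + 1 * x i) = pl (- 1) (mat_fun p T x) y"
      proof
        fix i
        have "y i = (\<Sum>j<p. T $$ (i, j) * mat_fun p S y j)" if "i < p"
          using fun_cong[OF TSy, of i] that by (simp add: mat_fun_def[of p T])
        thus "mat_fun p T (\<lambda>i\<in>{..<p}. - mat_fun p S y i + 1 * x i) i = pl (- 1) (mat_fun p T x) y i"
          by (simp add: mat_fun_def[of p T] pl_def distrib_left sum.distrib sum_negf sum_subtractf right_diff_distrib)
      qed
      have 2: "pl 1 (pl (- 1) (mat_fun p T x) y) y = mat_fun p T x"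
        by (rule ext) (simp add: pl_def mat_fun_def)
      show "h (\<lambda>i\<in>{..<p}. - mat_fun p S y i + 1 * x i) = g (mat_fun p T x) * f (pl (- 1) (mat_fun p T x) y)"
        unfolding h_def 1 2 by (simp add: mult.commute)
    qed
    finally show "(\<integral>\<^sup>+x. f (mat_fun p T x) * g (pl 1 (mat_fun p T x) y) \<partial>Rn p)
      = (\<integral>\<^sup>+x. g (mat_fun p T x) * f (pl (- 1) (mat_fun p T x) y) \<partial>Rn p)" by (simp add: h_def)
  qed
  also have "\<dots> = (\<integral>\<^sup>+x. (\<integral>\<^sup>+y. g (mat_fun p T x) * f (pl (- 1) (mat_fun p T x) y) \<partial>Rn p) \<partial>Rn p)"
    by (rule Fubini') measurable
  also have "\<dots> = (\<integral>\<^sup>+x. g (mat_fun p T x) * (\<integral>\<^sup>+y. f (pl (- 1) (mat_fun p T x) y) \<partial>Rn p) \<partial>Rn p)"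
    by (intro nn_integral_cong nn_integral_cmult) measurable
  \<comment> \<open>For fixed \<open>x\<close>, the map \<open>y \<mapsto> T x - y\<close> is a
    reflection followed by a translation, so the inner integral does not depend on
    \<open>x\<close>.\<close>
  also have "\<dots> = (\<integral>\<^sup>+x. g (mat_fun p T x) * (\<integral>\<^sup>+y. f y \<partial>Rn p) \<partial>Rn p)"
    by (intro nn_integral_cong) (simp only: pl_def nn_integral_Rn_affine_reflection[of "- 1", OF _ f] abs_minus abs_one)
  also have "\<dots> = (\<integral>\<^sup>+x. g (mat_fun p T x) \<partial>Rn p) * (\<integral>\<^sup>+y. f y \<partial>Rn p)"
    by (simp add: nn_integral_multc)
  finally show ?thesis .
qed

text \<open>Taking for \<open>g\<close> the indicator of the unit cube, whose integral is 1, in the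
  exchange identity. The constant \<open>c\<close> is the volume of the preimage of the cube under
  \<open>T\<close>; its value as a determinant is never computed.\<close>

lemma nn_integral_Rn_linear:
  assumes T: "T \<in> carrier_mat p p" and S: "S \<in> carrier_mat p p" and TS: "T * S = 1\<^sub>m p"
  shows "\<exists>c. \<forall>f\<in>borel_measurable (Rn p). (\<integral>\<^sup>+x. f (mat_fun p T x) \<partial>Rn p) = c * (\<integral>\<^sup>+x. f x \<partial>Rn p)"
proof -
  define g :: "(nat \<Rightarrow> real) \<Rightarrow> ennreal" where "g = indicator (Pi\<^sub>E {..<p} (\<lambda>_. {0..1}))"
  have B: "Pi\<^sub>E {..<p} (\<lambda>_. {0..1}) \<in> sets (Rn p)" by (intro sets_PiM_I_finite) auto
  hence g: "g \<in> borel_measurable (Rn p)" unfolding g_def by measurable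
  have "emeasure (Rn p) (Pi\<^sub>E {..<p} (\<lambda>_. {0..1})) = (\<Prod>i<p. emeasure lborel {0..1::real})"
    by (intro lborel_product.emeasure_PiM) auto
  hence g1: "(\<integral>\<^sup>+x. g x \<partial>Rn p) = 1" unfolding g_def using B by simp
  show ?thesis
    using nn_integral_linear_exchange[OF T S TS _ g] by (intro exI[of _ "\<integral>\<^sup>+x. g (mat_fun p T x) \<partial>Rn p"]) (simp add: g1)
qed

section \<open>Standard normal vectors\<close>

abbreviation std_normal :: "real measure" where
  "std_normal \<equiv> density lborel (\<lambda>x. ennreal (std_normal_density x))"

lemma prob_space_std_normal: "prob_space std_normal"
  by (rule prob_space_normal_density) simp

lemma PiM_std_normal:
  "PiM {..<p} (\<lambda>_. std_normal) = density (Rn p) (\<lambda>z. \<Prod>i<p. ennreal (std_normal_density (z i)))"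
proof -
  interpret N: product_sigma_finite "\<lambda>_::nat. std_normal"
    by (rule product_sigma_finite.intro) (rule prob_space_imp_sigma_finite[OF prob_space_std_normal])
  have sets: "sets (PiM {..<p} (\<lambda>_. std_normal)) = sets (Rn p)"
    by (intro sets_PiM_cong) auto
  show ?thesis
  proof (rule N.PiM_eqI[symmetric])
    show "sets (density (Rn p) (\<lambda>z. \<Prod>i<p. ennreal (std_normal_density (z i)))) = sets (PiM {..<p} (\<lambda>_. std_normal))"
      using sets by simp
    fix A :: "nat \<Rightarrow> real set" assume A: "\<And>i. i \<in> {..<p} \<Longrightarrow> A i \<in> sets std_normal"
    hence A': "A i \<in> sets borel" if "i < p" for i using that by auto
    have "emeasure (density (Rn p) (\<lambda>z. \<Prod>i<p. ennreal (std_normal_density (z i)))) (Pi\<^sub>E {..<p} A)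
        = (\<integral>\<^sup>+z. (\<Prod>i<p. ennreal (std_normal_density (z i))) * indicator (Pi\<^sub>E {..<p} A) z \<partial>Rn p)"
      using A' by (intro emeasure_density sets_PiM_I_finite) auto
    also have "\<dots> = (\<integral>\<^sup>+z. (\<Prod>i<p. ennreal (std_normal_density (z i)) * indicator (A i) (z i)) \<partial>Rn p)"
    proof (rule nn_integral_cong)
      fix z assume z: "z \<in> space (Rn p)"
      have "indicator (Pi\<^sub>E {..<p} A) z = (\<Prod>i<p. indicator (A i) (z i) :: ennreal)"
        using z by (auto simp: indicator_def space_PiM PiE_iff intro!: prod_zero[symmetric])
      thus "(\<Prod>i<p. ennreal (std_normal_density (z i))) * indicator (Pi\<^sub>E {..<p} A) z
        = (\<Prod>i<p. ennreal (std_normal_density (z i)) * indicator (A i) (z i))"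
        by (simp add: prod.distrib)
    qed
    also have "\<dots> = (\<Prod>i<p. \<integral>\<^sup>+x. ennreal (std_normal_density x) * indicator (A i) x \<partial>lborel)"
      using A' by (intro lborel_product.product_nn_integral_prod) auto
    also have "\<dots> = (\<Prod>i<p. emeasure std_normal (A i))"
      using A' by (intro prod.cong refl) (simp add: emeasure_density)
    finally show "emeasure (density (Rn p) (\<lambda>z. \<Prod>i<p. ennreal (std_normal_density (z i)))) (Pi\<^sub>E {..<p} A)
      = (\<Prod>i<p. emeasure std_normal (A i))" .
  qed simp
qed

text \<open>Both laws have a density proportional to \<open>exp (- \<bar>z\<bar>^2 / 2)\<close>, and being probability
  measures they share the normalising constant, so no Jacobian has to be computed.\<close>

lemma linear_image_std_normal:
  assumes M: "prob_space M" and D: "distributed M (Rn p) X (\<lambda>z. ennreal (\<phi> z))"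
    and T: "T \<in> carrier_mat p p" and S: "S \<in> carrier_mat p p" and TS: "T * S = 1\<^sub>m p"
    and \<phi>: "\<And>z. z \<in> space (Rn p) \<Longrightarrow>
      \<phi> z = C * exp (- (\<Sum>i<p. (\<Sum>j<p. T $$ (i, j) * (z j - \<mu> j))\<^sup>2) / 2)" and C: "0 \<le> C"
  shows "distr M (Rn p) (\<lambda>\<omega>. mat_fun p T (\<lambda>j\<in>{..<p}. X \<omega> j - \<mu> j)) = PiM {..<p} (\<lambda>_. std_normal)"
proof -
  interpret prob_space M by fact
  define E :: "(nat \<Rightarrow> real) \<Rightarrow> ennreal" where "E z = ennreal (exp (- (\<Sum>i<p. (z i)\<^sup>2) / 2))" for z
  define K where "K = ennreal (1 / sqrt (2 * pi) ^ p)"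
  have E [measurable]: "E \<in> borel_measurable (Rn p)" unfolding E_def by measurable
  have X [measurable]: "X \<in> measurable M (Rn p)" using D by (rule distributed_measurable)
  have sm: "(\<lambda>z. mat_fun p T (\<lambda>j\<in>{..<p}. z j - \<mu> j)) \<in> measurable (Rn p) (Rn p)"
    by (rule measurable_compose[OF _ mat_fun_measurable]) measurable
  define Z where "Z \<omega> = mat_fun p T (\<lambda>j\<in>{..<p}. X \<omega> j - \<mu> j)" for \<omega>
  have Z [measurable]: "Z \<in> measurable M (Rn p)"
    unfolding Z_def by (rule measurable_compose[OF X sm])
  obtain c where c: "\<And>f. f \<in> borel_measurable (Rn p) \<Longrightarrow> (\<integral>\<^sup>+x. f (mat_fun p T x) \<partial>Rn p) = c * (\<integral>\<^sup>+x. f x \<partial>Rn p)"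
    using nn_integral_Rn_linear[OF T S TS] by blast
  have intZ: "(\<integral>\<^sup>+\<omega>. f (Z \<omega>) \<partial>M) = ennreal C * c * (\<integral>\<^sup>+z. f z * E z \<partial>Rn p)"
    if f [measurable]: "f \<in> borel_measurable (Rn p)" for f
  proof -
    have "(\<integral>\<^sup>+\<omega>. f (Z \<omega>) \<partial>M) = (\<integral>\<^sup>+z. f (mat_fun p T (\<lambda>j\<in>{..<p}. z j - \<mu> j)) \<partial>distr M (Rn p) X)"
      unfolding Z_def using sm by (subst nn_integral_distr) (auto intro: measurable_compose[OF sm f])
    also have "\<dots> = (\<integral>\<^sup>+z. ennreal (\<phi> z) * f (mat_fun p T (\<lambda>j\<in>{..<p}. z j - \<mu> j)) \<partial>Rn p)"
      unfolding distributed_distr_eq_density[OF D]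
      using D by (intro nn_integral_density) (auto simp: distributed_def intro: measurable_compose[OF sm f])
    also have "\<dots> = (\<integral>\<^sup>+z. ennreal C * (\<lambda>x. f (mat_fun p T x) * E (mat_fun p T x)) (\<lambda>j\<in>{..<p}. - \<mu> j + 1 * z j) \<partial>Rn p)"
    proof (rule nn_integral_cong)
      fix z assume z: "z \<in> space (Rn p)"
      have eq: "(\<lambda>j\<in>{..<p}. - \<mu> j + 1 * z j) = (\<lambda>j\<in>{..<p}. z j - \<mu> j)" by (rule ext) simp
      have "ennreal (\<phi> z) = ennreal C * E (mat_fun p T (\<lambda>j\<in>{..<p}. z j - \<mu> j))"
        unfolding \<phi>[OF z] E_def using C by (simp add: mat_fun_def ennreal_mult)
      thus "ennreal (\<phi> z) * f (mat_fun p T (\<lambda>j\<in>{..<p}. z j - \<mu> j))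
        = ennreal C * (\<lambda>x. f (mat_fun p T x) * E (mat_fun p T x)) (\<lambda>j\<in>{..<p}. - \<mu> j + 1 * z j)"
        unfolding eq by (simp add: mult_ac)
    qed
    also have "\<dots> = ennreal C * (\<integral>\<^sup>+z. (\<lambda>x. f (mat_fun p T x) * E (mat_fun p T x)) (\<lambda>j\<in>{..<p}. - \<mu> j + 1 * z j) \<partial>Rn p)"
      by (intro nn_integral_cmult) measurable
    also have "\<dots> = ennreal C * (\<integral>\<^sup>+x. f (mat_fun p T x) * E (mat_fun p T x) \<partial>Rn p)"
      by (subst nn_integral_Rn_affine_reflection) (auto, measurable)
    also have "\<dots> = ennreal C * (c * (\<integral>\<^sup>+x. f x * E x \<partial>Rn p))"
      by (subst c[of "\<lambda>x. f x * E x"]) auto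
    finally show ?thesis by (simp add: mult.assoc)
  qed
  have dens: "(\<Prod>i<p. ennreal (std_normal_density (z i))) = K * E z" for z
  proof -
    have "(\<Prod>i<p. std_normal_density (z i)) = 1 / sqrt (2 * pi) ^ p * exp (- (\<Sum>i<p. (z i)\<^sup>2) / 2)"
      by (simp add: std_normal_density_def prod_dividef exp_sum sum_divide_distrib flip: sum_negf) 
    thus ?thesis unfolding K_def E_def by (simp add: prod_ennreal flip: ennreal_mult)
  qed
  interpret N: prob_space "PiM {..<p} (\<lambda>_. std_normal)"
    by (rule prob_space_PiM) (rule prob_space_std_normal)
  have "1 = emeasure (PiM {..<p} (\<lambda>_. std_normal)) (space (PiM {..<p} (\<lambda>_. std_normal)))"
    by (simp add: N.emeasure_space_1)
  also have "\<dots> = K * (\<integral>\<^sup>+z. E z \<partial>Rn p)"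
    unfolding PiM_std_normal by (simp add: emeasure_density dens nn_integral_cmult)
  finally have KE: "K * (\<integral>\<^sup>+z. E z \<partial>Rn p) = 1" ..
  have "1 = ennreal C * c * (\<integral>\<^sup>+z. E z \<partial>Rn p)"
    using intZ[of "\<lambda>_. 1"] by (simp add: emeasure_space_1)
  \<comment> \<open>Both \<open>K\<close> and \<open>C * c\<close> have product 1 with the integral
    of \<open>E\<close>. Multiplying one identity by the other factor gives equality without
    division in the extended reals.\<close>
  hence CK: "ennreal C * c = K" using KE by (metis mult.commute mult.left_commute mult.right_neutral)
  show ?thesis
  proof (rule measure_eqI)
    show "sets (distr M (Rn p) (\<lambda>\<omega>. mat_fun p T (\<lambda>j\<in>{..<p}. X \<omega> j - \<mu> j))) = sets (PiM {..<p} (\<lambda>_. std_normal))"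
      by (simp add: PiM_std_normal)
    fix A assume "A \<in> sets (distr M (Rn p) (\<lambda>\<omega>. mat_fun p T (\<lambda>j\<in>{..<p}. X \<omega> j - \<mu> j)))"
    hence A [measurable]: "A \<in> sets (Rn p)" by simp
    have "emeasure (distr M (Rn p) Z) A = (\<integral>\<^sup>+z. indicator A z \<partial>distr M (Rn p) Z)" by simp
    also have "\<dots> = (\<integral>\<^sup>+\<omega>. indicator A (Z \<omega>) \<partial>M)" by (intro nn_integral_distr) auto
    also have "\<dots> = K * (\<integral>\<^sup>+z. indicator A z * E z \<partial>Rn p)"
      by (subst intZ) (auto simp: CK)
    also have "\<dots> = (\<integral>\<^sup>+z. (\<Prod>i<p. ennreal (std_normal_density (z i))) * indicator A z \<partial>Rn p)"
      by (simp add: dens mult.assoc mult.commute[of "E _"] nn_integral_cmult)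
    also have "\<dots> = emeasure (PiM {..<p} (\<lambda>_. std_normal)) A"
      unfolding PiM_std_normal by (subst emeasure_density) auto
    finally show "emeasure (distr M (Rn p) (\<lambda>\<omega>. mat_fun p T (\<lambda>j\<in>{..<p}. X \<omega> j - \<mu> j))) A
      = emeasure (PiM {..<p} (\<lambda>_. std_normal)) A" by (simp add: Z_def[abs_def])
  qed
qed

context prob_space
begin

lemma std_normal_unit_combination:
  fixes X :: "'i \<Rightarrow> 'a \<Rightarrow> real"
  assumes J: "finite J" and ind: "indep_vars (\<lambda>_. borel) X J"
    and law: "\<And>i. i \<in> J \<Longrightarrow> distr M borel (X i) = std_normal" and h: "(\<Sum>i\<in>J. (h i)\<^sup>2) = 1"
  shows "distr M borel (\<lambda>\<omega>. \<Sum>i\<in>J. h i * X i \<omega>) = std_normal"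
proof -
  \<comment> \<open>Sums of independent normal variables are available for positive variances and
    nonempty index sets. Zero coefficients are therefore dropped; unit length of \<open>h\<close>
    leaves at least one index.\<close>
  define I where "I = {i. i \<in> J \<and> h i \<noteq> 0}"
  have I: "finite I" "I \<subseteq> J" using J by (auto simp: I_def)
  have "I \<noteq> {}"
  proof
    assume "I = {}"
    hence "(\<Sum>i\<in>J. (h i)\<^sup>2) = 0" by (intro sum.neutral) (auto simp: I_def)
    thus False using h by simp
  qed
  have dist: "distributed M lborel (X i) std_normal_density" if "i \<in> J" for i
  proof -
    have "distr M lborel (X i) = distr M borel (X i)" by (intro distr_cong) auto
    moreover have "X i \<in> borel_measurable M" using ind that by (simp add: indep_vars_def)
    ultimately show ?thesis using law[OF that] by (simp add: distributed_def)
  qed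
  have "distributed M lborel (\<lambda>\<omega>. \<Sum>i\<in>I. h i * X i \<omega>)
     (normal_density (\<Sum>i\<in>I. 0) (sqrt (\<Sum>i\<in>I. (\<bar>h i\<bar>)\<^sup>2)))"
  proof (rule sum_indep_normal[OF I(1) \<open>I \<noteq> {}\<close>])
    show "indep_vars (\<lambda>_. borel) (\<lambda>i \<omega>. h i * X i \<omega>) I"
      by (rule indep_vars_compose2[OF indep_vars_subset[OF ind I(2)], where Y = "\<lambda>i x. h i * x"]) auto
    fix i assume i: "i \<in> I"
    show "0 < \<bar>h i\<bar>" using i by (simp add: I_def)
    show "distributed M lborel (\<lambda>\<omega>. h i * X i \<omega>) (normal_density 0 \<bar>h i\<bar>)"
      using normal_density_affine[OF dist, of i "h i" 0] i by (simp add: I_def)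
  qed
  moreover have "(\<Sum>i\<in>I. h i * X i \<omega>) = (\<Sum>i\<in>J. h i * X i \<omega>)" for \<omega>
    using J by (intro sum.mono_neutral_left) (auto simp: I_def)
  moreover have "(\<Sum>i\<in>I. (\<bar>h i\<bar>)\<^sup>2) = 1"
    unfolding h[symmetric] power2_abs using J by (intro sum.mono_neutral_left) (auto simp: I_def)
  ultimately have "distr M lborel (\<lambda>\<omega>. \<Sum>i\<in>J. h i * X i \<omega>) = std_normal"
    by (simp add: distributed_def)
  moreover have "distr M borel f = distr M lborel f" for f :: "'a \<Rightarrow> real" by (intro distr_cong) auto
  ultimately show ?thesis by simp
qed

text \<open>For different \<open>j\<close> the inner sums use disjoint columns of the array, so they
  are independent, and unit length of \<open>h\<close> makes each of them standard normal.\<close>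

lemma sum_squares_unit_combinations:
  fixes W :: "nat \<times> nat \<Rightarrow> 'a \<Rightarrow> real"
  assumes ind: "indep_vars (\<lambda>_. borel) W ({..<n} \<times> {..<q})"
    and law: "\<And>i j. i < n \<Longrightarrow> j < q \<Longrightarrow> distr M borel (W (i, j)) = std_normal"
    and h: "(\<Sum>i<n. (h i)\<^sup>2) = 1" and q: "1 \<le> q"
  shows "distr M borel (\<lambda>\<omega>. \<Sum>j<q. (\<Sum>i<n. h i * W (i, j) \<omega>)\<^sup>2) = chi_squared q"
proof -
  define G where "G j \<omega> = (\<Sum>i<n. h i * W (i, j) \<omega>)" for j \<omega>
  have "indep_vars (\<lambda>j. PiM ({..<n} \<times> {j}) (\<lambda>_. borel)) (\<lambda>j \<omega>. restrict (\<lambda>i. W i \<omega>) ({..<n} \<times> {j})) {..<q}"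
    by (rule indep_vars_restrict[OF ind]) (auto simp: disjoint_family_on_def)
  hence "indep_vars (\<lambda>_. borel) (\<lambda>j \<omega>. \<Sum>i<n. h i * restrict (\<lambda>i. W i \<omega>) ({..<n} \<times> {j}) (i, j)) {..<q}"
    by (rule indep_vars_compose2[where Y = "\<lambda>j f. \<Sum>i<n. h i * f (i, j)"])
      (auto intro!: borel_measurable_sum borel_measurable_times measurable_component_singleton)
  hence indG: "indep_vars (\<lambda>_. borel) G {..<q}"
    by (rule indep_vars_cong[THEN iffD1, rotated 3]) (auto simp: G_def fun_eq_iff)
  have lawG: "distr M borel (G j) = std_normal" if "j < q" for j
  proof -
    have inj: "inj_on (\<lambda>i. (i, j)) {..<n}" and img: "{..<n} \<times> {j} = (\<lambda>i. (i, j)) ` {..<n}"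
      by (auto simp: inj_on_def)
    have "distr M borel (\<lambda>\<omega>. \<Sum>v\<in>{..<n} \<times> {j}. h (fst v) * W v \<omega>) = std_normal"
    proof (rule std_normal_unit_combination)
      show "indep_vars (\<lambda>_. borel) W ({..<n} \<times> {j})" using that by (intro indep_vars_subset[OF ind]) auto
      show "(\<Sum>v\<in>{..<n} \<times> {j}. (h (fst v))\<^sup>2) = 1" unfolding img by (simp add: sum.reindex[OF inj] h)
    qed (use law that in auto)
    thus ?thesis unfolding img by (simp add: sum.reindex[OF inj] G_def[abs_def])
  qed
  have rvG [measurable]: "G j \<in> borel_measurable M" if "j < q" for j
    using indG that by (auto simp: indep_vars_def)
  have "distr M (PiM {..<q} (\<lambda>_. borel)) (\<lambda>\<omega>. \<lambda>j\<in>{..<q}. G j \<omega>) = PiM {..<q} (\<lambda>j. distr M borel (G j))"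
    using q by (intro iffD1[OF indep_vars_iff_distr_eq_PiM' indG] rvG) (auto simp: lessThan_empty_iff)
  also have "\<dots> = PiM {..<q} (\<lambda>_. std_normal)" using lawG by (intro PiM_cong) auto
  finally have eq: "distr M (PiM {..<q} (\<lambda>_. borel)) (\<lambda>\<omega>. \<lambda>j\<in>{..<q}. G j \<omega>) = PiM {..<q} (\<lambda>_. std_normal)" .
  have "chi_squared q = distr (distr M (PiM {..<q} (\<lambda>_. borel)) (\<lambda>\<omega>. \<lambda>j\<in>{..<q}. G j \<omega>)) borel (\<lambda>z. \<Sum>i<q. (z i)\<^sup>2)"
    unfolding chi_squared_def eq ..
  also have "\<dots> = distr M borel ((\<lambda>z. \<Sum>i<q. (z i)\<^sup>2) \<circ> (\<lambda>\<omega>. \<lambda>j\<in>{..<q}. G j \<omega>))"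
    by (rule distr_distr) (auto intro!: measurable_restrict borel_measurable_sum borel_measurable_power measurable_component_singleton)
  also have "\<dots> = distr M borel (\<lambda>\<omega>. \<Sum>j<q. (\<Sum>i<n. h i * W (i, j) \<omega>)\<^sup>2)"
    by (intro distr_cong) (auto simp: G_def)
  finally show ?thesis ..
qed

end

section \<open>Regressions with a standard normal design\<close>

lemma std_normal_singleton:
  assumes "prob_space M" "distr M borel X = std_normal" "X \<in> borel_measurable M"
  shows "measure M {\<omega> \<in> space M. X \<omega> = (x::real)} = 0"
proof -
  have "emeasure M {\<omega> \<in> space M. X \<omega> = x} = emeasure (distr M borel X) {x}"
    using assms(3) by (subst emeasure_distr) (auto intro!: arg_cong[where f = "emeasure M"])
  also have "\<dots> = 0" unfolding assms(2) by (simp add: emeasure_density nn_integral_indicator_singleton)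
  finally show ?thesis by (simp add: measure_def)
qed

text \<open>Used with \<open>s = q - 1\<close>, so that the columns 1, 2, ... come from the array
  columns \<open>q\<close>, \<open>q + 1\<close>, ...; column 0 is the constant regressor and
  consumes no entry of the array.\<close>

definition intercept_mat :: "nat \<Rightarrow> nat \<Rightarrow> nat \<Rightarrow> (nat \<times> nat \<Rightarrow> real) \<Rightarrow> real mat" where
  "intercept_mat n k s a = mat n k (\<lambda>(i, j). if j = 0 then 1 else a (i, s + j))"

lemma intercept_mat_carrier [simp]: "intercept_mat n k s a \<in> carrier_mat n k"
  by (simp add: intercept_mat_def)

lemma intercept_mat_measurable:
  assumes "\<And>i j. i < n \<Longrightarrow> 0 < j \<Longrightarrow> j < k \<Longrightarrow> (i, s + j) \<in> A"
  shows "mat_measurable (PiM A (\<lambda>_. borel)) n k (intercept_mat n k s)"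
  unfolding mat_measurable_def
proof (intro conjI ballI allI impI)
  fix i j assume ij: "i < n" "j < k"
  show "(\<lambda>a. intercept_mat n k s a $$ (i, j)) \<in> borel_measurable (PiM A (\<lambda>_. borel))"
  proof (cases "j = 0")
    case False
    hence "(i, s + j) \<in> A" using assms ij by auto
    hence "(\<lambda>a. a (i, s + j)) \<in> borel_measurable (PiM A (\<lambda>_. borel))"
      by (rule measurable_component_singleton)
    thus ?thesis using ij False by (simp add: intercept_mat_def)
  qed (use ij in \<open>simp add: intercept_mat_def\<close>)
qed simp

text \<open>The determinant is affine in the bottom right entry, with the determinant of the leading
  minor as slope, and that entry is independent of all others and has no atoms.\<close>

lemma (in prob_space) AE_det_intercept_mat:
  fixes W :: "nat \<times> nat \<Rightarrow> 'a \<Rightarrow> real"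
  assumes ind: "indep_vars (\<lambda>_. borel) W I"
    and I: "\<And>i j. i < k \<Longrightarrow> 0 < j \<Longrightarrow> j < k \<Longrightarrow> (i, s + j) \<in> I"
    and law: "\<And>i j. i < k \<Longrightarrow> 0 < j \<Longrightarrow> j < k \<Longrightarrow> distr M borel (W (i, s + j)) = std_normal"
    and k: "1 \<le> k"
  shows "AE \<omega> in M. det (intercept_mat k k s (\<lambda>t. W t \<omega>)) \<noteq> 0"
  using k I law
proof (induction k rule: dec_induct)
  case base
  have "intercept_mat 1 1 s a = 1\<^sub>m 1" for a by (rule eq_matI) (auto simp: intercept_mat_def)
  thus ?case by simp
next
  case (step k)
  \<comment> \<open>All array entries of the enlarged matrix except its bottom right corner;
    \<open>X\<close> and \<open>Y\<close> are thus independent and together determine the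
    determinant.\<close>
  define A where "A = {(i, s + j) | i j. i < Suc k \<and> 0 < j \<and> j < Suc k} - {(k, s + k)}"
  define X where "X \<omega> = restrict (\<lambda>t. W t \<omega>) A" for \<omega>
  define Y where "Y \<omega> = restrict (\<lambda>t. W t \<omega>) {(k, s + k)}" for \<omega>
  define f where "f a = det (intercept_mat k k s a)" for a
  define cf where "cf i a = (-1) ^ (i + k) * det (mat_delete (intercept_mat (Suc k) (Suc k) s a) i k)" for i and a :: "nat \<times> nat \<Rightarrow> real"
  define c where "c a = (\<Sum>i<k. a (i, s + k) * cf i a)" for a
  have k0: "0 < k" using step by simp
  have "A \<subseteq> I" using step.prems by (auto simp: A_def)
  moreover have "(k, s + k) \<in> I" using step.prems k0 by simp
  ultimately have indXY: "indep_var (PiM A (\<lambda>_. borel)) X (PiM {(k, s + k)} (\<lambda>_. borel)) Y"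
    unfolding X_def Y_def by (intro indep_var_restrict[OF ind]) (auto simp: A_def)
  have Wk: "W (k, s + k) \<in> borel_measurable M"
    using ind \<open>(k, s + k) \<in> I\<close> by (simp add: indep_vars_def)
  have del: "mat_delete (intercept_mat (Suc k) (Suc k) s a) i k = mat k k (\<lambda>(i', j). if j = 0 then 1 else a (if i' < i then i' else Suc i', s + j))"
    if "i < Suc k" for i a
    using that by (intro eq_matI) (auto simp: intercept_mat_def mat_delete_def)
  have del_k: "mat_delete (intercept_mat (Suc k) (Suc k) s a) k k = intercept_mat k k s a" for a
    by (intro eq_matI) (auto simp: intercept_mat_def mat_delete_def)
  have expand: "det (intercept_mat (Suc k) (Suc k) s a) = a (k, s + k) * f a + c a" for a
  proof -
    have "det (intercept_mat (Suc k) (Suc k) s a)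
       = (\<Sum>i<Suc k. intercept_mat (Suc k) (Suc k) s a $$ (i, k) * cofactor (intercept_mat (Suc k) (Suc k) s a) i k)"
      by (rule laplace_expansion_column) auto
    also have "\<dots> = (\<Sum>i<Suc k. a (i, s + k) * cf i a)"
      using k0 by (intro sum.cong refl) (simp add: cf_def cofactor_def intercept_mat_def)
    also have "\<dots> = a (k, s + k) * f a + c a"
      by (simp add: c_def cf_def f_def del_k)
    finally show ?thesis .
  qed
  have fX: "f (X \<omega>) = f (\<lambda>t. W t \<omega>)" and cX: "c (X \<omega>) = c (\<lambda>t. W t \<omega>)" for \<omega>
  proof -
    have X: "X \<omega> (i, s + j) = W (i, s + j) \<omega>" if "i < Suc k" "0 < j" "j < Suc k" "i \<noteq> k \<or> j \<noteq> k" for i j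
      using that by (auto simp: X_def A_def)
    have "intercept_mat k k s (X \<omega>) = intercept_mat k k s (\<lambda>t. W t \<omega>)"
      by (intro eq_matI) (auto simp: intercept_mat_def X)
    thus "f (X \<omega>) = f (\<lambda>t. W t \<omega>)" by (simp add: f_def)
    have "cf i (X \<omega>) = cf i (\<lambda>t. W t \<omega>)" if "i < k" for i
    proof -
      have "mat k k (\<lambda>(i', j). if j = 0 then 1 else X \<omega> (if i' < i then i' else Suc i', s + j))
        = mat k k (\<lambda>(i', j). if j = 0 then 1 else W (if i' < i then i' else Suc i', s + j) \<omega>)"
        by (intro eq_matI) (auto simp: X)
      thus ?thesis using that by (simp add: cf_def del)
    qed
    thus "c (X \<omega>) = c (\<lambda>t. W t \<omega>)" using k0 by (simp add: c_def X)
  qed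
  have fm [measurable]: "f \<in> borel_measurable (PiM A (\<lambda>_. borel))"
    unfolding f_def by (intro det_measurable[of _ k] intercept_mat_measurable) (auto simp: A_def)
  have cfm: "cf i \<in> borel_measurable (PiM A (\<lambda>_. borel))" if "i < k" for i
  proof -
    have "mat_measurable (PiM A (\<lambda>_. borel)) k k (\<lambda>a. mat_delete (intercept_mat (Suc k) (Suc k) s a) i k)"
      unfolding mat_measurable_def
    proof (intro conjI ballI allI impI)
      fix i' j assume ij: "i' < k" "j < k"
      show "(\<lambda>a. mat_delete (intercept_mat (Suc k) (Suc k) s a) i k $$ (i', j)) \<in> borel_measurable (PiM A (\<lambda>_. borel))"
      proof (cases "j = 0")
        case True
        thus ?thesis using that ij by (simp add: del)
      next
        case False
        hence "(if i' < i then i' else Suc i', s + j) \<in> A" using ij by (auto simp: A_def)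
        hence "(\<lambda>a. a (if i' < i then i' else Suc i', s + j)) \<in> borel_measurable (PiM A (\<lambda>_. borel))"
          by (rule measurable_component_singleton)
        thus ?thesis using that ij False by (simp add: del)
      qed
    next
      fix a show "mat_delete (intercept_mat (Suc k) (Suc k) s a) i k \<in> carrier_mat k k"
        using that by (simp add: del)
    qed
    from det_measurable[OF this] show ?thesis unfolding cf_def by measurable
  qed
  have cm [measurable]: "c \<in> borel_measurable (PiM A (\<lambda>_. borel))"
    unfolding c_def
  proof (intro borel_measurable_sum borel_measurable_times cfm)
    fix i assume i: "i \<in> {..<k}"
    hence "(i, s + k) \<in> A" using k0 by (auto simp: A_def)
    thus "(\<lambda>a. a (i, s + k)) \<in> borel_measurable (PiM A (\<lambda>_. borel))" by (rule measurable_component_singleton)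
  qed auto
  \<comment> \<open>The determinant vanishes although the slope does not. For frozen first argument
    this forces the corner entry to be the single value \<open>- c a / f a\<close>, an event of
    probability 0.\<close>
  define P where "P z \<longleftrightarrow> f (fst z) \<noteq> 0 \<and> snd z (k, s + k) * f (fst z) + c (fst z) = 0" for z :: "(nat \<times> nat \<Rightarrow> real) \<times> (nat \<times> nat \<Rightarrow> real)"
  have "prob {\<omega> \<in> space M. P (X \<omega>, Y \<omega>)} \<le> 0"
  proof (rule prob_le_of_indep[OF indXY])
    have [measurable]: "(\<lambda>b. b (k, s + k)) \<in> borel_measurable (PiM {(k, s + k)} (\<lambda>_. borel))"
      by (rule measurable_component_singleton) simp
    show "{z \<in> space (PiM A (\<lambda>_. borel) \<Otimes>\<^sub>M PiM {(k, s + k)} (\<lambda>_. borel)). P z}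
      \<in> sets (PiM A (\<lambda>_. borel) \<Otimes>\<^sub>M PiM {(k, s + k)} (\<lambda>_. borel))"
      unfolding P_def by measurable
    fix a assume "a \<in> space (PiM A (\<lambda>_. borel :: real measure))"
    have law_k: "distr M borel (W (k, s + k)) = std_normal" using step.prems k0 by simp
    have "{\<omega> \<in> space M. P (a, Y \<omega>)} \<subseteq> {\<omega> \<in> space M. W (k, s + k) \<omega> = - c a / f a}"
      by (auto simp: P_def Y_def field_simps)
    hence "prob {\<omega> \<in> space M. P (a, Y \<omega>)} \<le> prob {\<omega> \<in> space M. W (k, s + k) \<omega> = - c a / f a}"
      by (rule finite_measure_mono[OF _ borel_measurable_eq[OF Wk borel_measurable_const]])
    thus "prob {\<omega> \<in> space M. P (a, Y \<omega>)} \<le> 0"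
      using std_normal_singleton[OF prob_space_axioms law_k Wk] by simp
  qed simp
  hence z: "prob {\<omega> \<in> space M. P (X \<omega>, Y \<omega>)} = 0" using measure_nonneg[of M] by (simp add: antisym)
  have "AE \<omega> in M. \<not> P (X \<omega>, Y \<omega>)"
  proof (rule AE_I[of _ _ "{\<omega> \<in> space M. P (X \<omega>, Y \<omega>)}"])
    show "emeasure M {\<omega> \<in> space M. P (X \<omega>, Y \<omega>)} = 0" using z by (simp add: emeasure_eq_measure)
    have [measurable]: "X \<in> measurable M (PiM A (\<lambda>_. borel))"
      using indXY indep_var_distribution_eq by blast
    show "{\<omega> \<in> space M. P (X \<omega>, Y \<omega>)} \<in> events"
      using Wk unfolding P_def fst_conv snd_conv Y_def by simp
  qed auto
  moreover have "AE \<omega> in M. f (\<lambda>t. W t \<omega>) \<noteq> 0"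
    unfolding f_def using step.prems by (intro step.IH) auto
  ultimately show ?case
  proof eventually_elim
    case (elim \<omega>)
    thus ?case by (simp add: P_def expand fX cX Y_def)
  qed
qed

text \<open>A kernel vector of the Gram matrix is a kernel vector of the tall matrix, hence of its
  first \<open>k\<close> rows, and these form a nonsingular square block.\<close>

lemma intercept_mat_gram_invertible:
  assumes "det (intercept_mat k k s a) \<noteq> 0" and "k \<le> n"
  shows "invertible_mat ((intercept_mat n k s a)\<^sup>T * intercept_mat n k s a)"
proof (rule invertible_matI)
  show "(intercept_mat n k s a)\<^sup>T * intercept_mat n k s a \<in> carrier_mat k k"
    by (rule gram_mat_carrier) (rule intercept_mat_carrier)
  fix v assume v: "v \<in> carrier_vec k" "(intercept_mat n k s a)\<^sup>T * intercept_mat n k s a *\<^sub>v v = 0\<^sub>v k"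
  define V where "V = intercept_mat n k s a"
  have V: "V \<in> carrier_mat n k" by (simp add: V_def)
  have "(V *\<^sub>v v) \<bullet> (V *\<^sub>v v) = v \<bullet> (V\<^sup>T * V *\<^sub>v v)"
    using v V by (subst scalar_prod_mult_mat_vec_both) auto
  hence "(V *\<^sub>v v) \<bullet> (V *\<^sub>v v) = 0" using v by (simp add: V_def)
  hence Vv: "V *\<^sub>v v = 0\<^sub>v n" using scalar_prod_self_eq_0_iff[of "V *\<^sub>v v"] V by simp
  have "intercept_mat k k s a *\<^sub>v v = 0\<^sub>v k"
  proof (rule eq_vecI)
    fix i assume "i < dim_vec (0\<^sub>v k :: real vec)"
    hence i: "i < k" by simp
    have "row (intercept_mat k k s a) i = row V i"
      using i assms(2) by (auto simp: V_def intercept_mat_def)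
    hence "(intercept_mat k k s a *\<^sub>v v) $ i = (V *\<^sub>v v) $ i"
      using i assms(2) V by (simp add: mult_mat_vec_def intercept_mat_def)
    thus "(intercept_mat k k s a *\<^sub>v v) $ i = 0\<^sub>v k $ i" using Vv i assms(2) by simp
  qed (simp add: intercept_mat_def)
  thus "v = 0\<^sub>v k"
    using assms(1) v(1) det_0_iff_vec_prod_zero_field[of "intercept_mat k k s a" k] by auto
qed

lemma mat_measurable_plus:
  assumes f: "mat_measurable M r c f" and g: "mat_measurable M r c g"
  shows "mat_measurable M r c (\<lambda>\<omega>. f \<omega> + g \<omega>)"
proof -
  have "(\<lambda>\<omega>. (f \<omega> + g \<omega>) $$ (i, j)) \<in> borel_measurable M" if "i < r" "j < c" for i j
  proof -
    have "(\<lambda>\<omega>. f \<omega> $$ (i, j) + g \<omega> $$ (i, j)) \<in> borel_measurable M"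
      using f g that unfolding mat_measurable_def by (intro borel_measurable_add) auto
    moreover have "(f \<omega> + g \<omega>) $$ (i, j) = f \<omega> $$ (i, j) + g \<omega> $$ (i, j)" if "\<omega> \<in> space M" for \<omega>
    proof -
      have "f \<omega> \<in> carrier_mat r c" "g \<omega> \<in> carrier_mat r c"
        using f g that by (auto simp: mat_measurable_def)
      thus ?thesis using \<open>i < r\<close> \<open>j < c\<close> by simp
    qed
    ultimately show ?thesis by (subst measurable_cong) auto
  qed
  thus ?thesis using f g unfolding mat_measurable_def by (meson add_carrier_mat)
qed

lemma mat_measurable_compose:
  assumes f: "mat_measurable N r c f" and X: "X \<in> measurable M N"
  shows "mat_measurable M r c (\<lambda>\<omega>. f (X \<omega>))"
  unfolding mat_measurable_def
proof (intro conjI ballI allI impI)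
  fix i j assume "i < r" "j < c"
  thus "(\<lambda>\<omega>. f (X \<omega>) $$ (i, j)) \<in> borel_measurable M"
    using f by (intro measurable_compose[OF X, of "\<lambda>x. f x $$ (i, j)"]) (simp add: mat_measurable_def)
qed (use f measurable_space[OF X] in \<open>simp add: mat_measurable_def\<close>)

lemma vec_measurable_compose:
  assumes f: "vec_measurable N r f" and X: "X \<in> measurable M N"
  shows "vec_measurable M r (\<lambda>\<omega>. f (X \<omega>))"
  unfolding vec_measurable_def
proof (intro conjI ballI allI impI)
  fix i assume "i < r"
  thus "(\<lambda>\<omega>. f (X \<omega>) $ i) \<in> borel_measurable M"
    using f by (intro measurable_compose[OF X, of "\<lambda>x. f x $ i"]) (simp add: vec_measurable_def)
qed (use f measurable_space[OF X] in \<open>simp add: vec_measurable_def\<close>)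

lemma vec_measurable_vec:
  assumes "\<And>i. i < r \<Longrightarrow> f i \<in> borel_measurable M"
  shows "vec_measurable M r (\<lambda>\<omega>. vec r (\<lambda>i. f i \<omega>))"
  using assms by (auto simp: vec_measurable_def)

section \<open>Quadratic forms in a random residual projection\<close>

context prob_space
begin

lemma std_normal_moments:
  assumes law: "distr M borel X = std_normal" and X: "X \<in> borel_measurable M"
  shows "integrable M (\<lambda>\<omega>. X \<omega> ^ 4)" "expectation X = 0" "expectation (\<lambda>\<omega>. (X \<omega>)\<^sup>2) = 1"
    "expectation (\<lambda>\<omega>. X \<omega> ^ 4) = 3"
proof -
  have gen: "integrable M (\<lambda>\<omega>. X \<omega> ^ k) \<and> expectation (\<lambda>\<omega>. X \<omega> ^ k) = c"
    if "has_bochner_integral lborel (\<lambda>x. std_normal_density x * x ^ k) c" for k c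
  proof -
    have "integrable std_normal (\<lambda>x. x ^ k)" "(\<integral>x. x ^ k \<partial>std_normal) = c"
      using that by (auto simp: integrable_density integral_density has_bochner_integral_iff)
    thus ?thesis
      using integrable_distr[of X M borel "\<lambda>x. x ^ k"] integral_distr[of X M borel "\<lambda>x. x ^ k"] X law
      by auto
  qed
  have "has_bochner_integral lborel (\<lambda>x. std_normal_density x * x ^ 4) 3"
    using std_normal_moment_even[of 2] by (simp add: fact_numeral)
  from gen[OF this] show "integrable M (\<lambda>\<omega>. X \<omega> ^ 4)" "expectation (\<lambda>\<omega>. X \<omega> ^ 4) = 3" by auto
  have "has_bochner_integral lborel (\<lambda>x. std_normal_density x * x ^ 2) 1"
    using std_normal_moment_even[of 1] by (simp add: fact_numeral)
  from gen[OF this] show "expectation (\<lambda>\<omega>. (X \<omega>)\<^sup>2) = 1" by auto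
  have "has_bochner_integral lborel (\<lambda>x. std_normal_density x * x ^ 1) 0"
    using std_normal_moment_odd[of 0] by simp
  from gen[OF this] show "expectation X = 0" by simp
qed

text \<open>Trace and sum of squared entries of the projection are both \<open>n - k\<close>: mean
  and variance bound are of the same order, so deviations proportional to the mean become improbable
  as \<open>n - k\<close> grows.\<close>

lemma resid_form_deviation:
  fixes z :: "nat \<Rightarrow> 'a \<Rightarrow> real"
  assumes ind: "indep_vars (\<lambda>_. borel) z {..<n}"
    and moments: "\<And>i. i < n \<Longrightarrow> integrable M (\<lambda>\<omega>. z i \<omega> ^ 4)" "\<And>i. i < n \<Longrightarrow> expectation (z i) = 0"
      "\<And>i. i < n \<Longrightarrow> expectation (\<lambda>\<omega>. (z i \<omega>)\<^sup>2) = 1" "\<And>i. i < n \<Longrightarrow> expectation (\<lambda>\<omega>. z i \<omega> ^ 4) \<le> \<kappa>"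
    and \<kappa>: "0 \<le> \<kappa>" and t: "0 < t"
    and V: "V \<in> carrier_mat n k" and inv: "invertible_mat (V\<^sup>T * V)"
  shows "prob {\<omega> \<in> space M. t < \<bar>vec n (\<lambda>i. z i \<omega>) \<bullet> (resid_mat n V *\<^sub>v vec n (\<lambda>i. z i \<omega>)) - (real n - real k)\<bar>}
     \<le> (\<kappa> + 2) * (real n - real k) / t\<^sup>2"
proof -
  define Q where "Q i j = resid_mat n V $$ (i, j)" for i j
  have c: "resid_mat n V \<in> carrier_mat n n" by (rule resid_mat_carrier[OF V inv])
  have sym: "Q i j = Q j i" if "i < n" "j < n" for i j
    using arg_cong[OF resid_mat_symmetric[OF V inv], of "\<lambda>A. A $$ (i, j)"] c that by (simp add: Q_def)
  have "vec n (\<lambda>i. z i \<omega>) \<bullet> (resid_mat n V *\<^sub>v vec n (\<lambda>i. z i \<omega>)) = (\<Sum>i<n. \<Sum>j<n. Q i j * z i \<omega> * z j \<omega>)" for \<omega>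
    using c by (simp add: scalar_prod_sum Q_def sum_distrib_left mult_ac)
  thus ?thesis
    using quadratic_form_deviation[where Q = Q, OF ind moments sym \<kappa> t] resid_mat_trace[OF V inv] resid_mat_sum_squares[OF V inv]
    by (simp add: Q_def)
qed

text \<open>The matrix depends on the entries in \<open>A\<close> and the vector on those in the
  disjoint set \<open>B\<close>, so the matrix may be frozen and the deterministic case applied.
  Including the determinant condition in \<open>E\<close> makes the section empty for singular
  frozen matrices, and \<open>adj_resid\<close> keeps the event measurable.\<close>

lemma conditional_resid_form_deviation:
  fixes W :: "'i \<Rightarrow> 'a \<Rightarrow> real"
  assumes ind: "indep_vars (\<lambda>_. borel) W I" and AB: "A \<inter> B = {}" "A \<subseteq> I" "B \<subseteq> I"
    and V: "mat_measurable (PiM A (\<lambda>_. borel)) n k V"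
    and u: "\<And>i. i < n \<Longrightarrow> u i \<in> borel_measurable (PiM B (\<lambda>_. borel))"
    and VW: "\<And>\<omega>. V (restrict (\<lambda>t. W t \<omega>) A) = V (\<lambda>t. W t \<omega>)"
    and uW: "\<And>i \<omega>. i < n \<Longrightarrow> u i (restrict (\<lambda>t. W t \<omega>) B) = z i \<omega>"
    and indz: "indep_vars (\<lambda>_. borel) z {..<n}"
    and moments: "\<And>i. i < n \<Longrightarrow> integrable M (\<lambda>\<omega>. z i \<omega> ^ 4)" "\<And>i. i < n \<Longrightarrow> expectation (z i) = 0"
      "\<And>i. i < n \<Longrightarrow> expectation (\<lambda>\<omega>. (z i \<omega>)\<^sup>2) = 1" "\<And>i. i < n \<Longrightarrow> expectation (\<lambda>\<omega>. z i \<omega> ^ 4) \<le> \<kappa>"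
    and \<kappa>: "0 \<le> \<kappa>" and t: "0 < t" and kn: "k \<le> n"
  defines "E \<equiv> {\<omega> \<in> space M. det ((V (\<lambda>t. W t \<omega>))\<^sup>T * V (\<lambda>t. W t \<omega>)) \<noteq> 0 \<and>
     t < \<bar>vec n (\<lambda>i. z i \<omega>) \<bullet> (adj_resid n (V (\<lambda>t. W t \<omega>)) *\<^sub>v vec n (\<lambda>i. z i \<omega>)) - (real n - real k)\<bar>}"
  shows "prob E \<le> (\<kappa> + 2) * (real n - real k) / t\<^sup>2" "E \<in> events"
proof -
  define X where "X \<omega> = restrict (\<lambda>t. W t \<omega>) A" for \<omega>
  define Y where "Y \<omega> = restrict (\<lambda>t. W t \<omega>) B" for \<omega>
  define P where "P ab \<longleftrightarrow> det ((V (fst ab))\<^sup>T * V (fst ab)) \<noteq> 0 \<and>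
     t < \<bar>vec n (\<lambda>i. u i (snd ab)) \<bullet> (adj_resid n (V (fst ab)) *\<^sub>v vec n (\<lambda>i. u i (snd ab))) - (real n - real k)\<bar>" for ab
  have indXY: "indep_var (PiM A (\<lambda>_. borel)) X (PiM B (\<lambda>_. borel)) Y"
    unfolding X_def Y_def by (rule indep_var_restrict[OF ind AB])
  have XY [measurable]: "X \<in> measurable M (PiM A (\<lambda>_. borel))" "Y \<in> measurable M (PiM B (\<lambda>_. borel))"
    using indXY indep_var_distribution_eq by blast+
  have vz: "vec n (\<lambda>i. u i (Y \<omega>)) = vec n (\<lambda>i. z i \<omega>)" for \<omega> by (rule eq_vecI) (auto simp: Y_def uW)
  have E_eq: "E = {\<omega> \<in> space M. P (X \<omega>, Y \<omega>)}"
    unfolding E_def P_def fst_conv snd_conv vz by (simp add: X_def VW)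
  let ?N = "PiM A (\<lambda>_. borel :: real measure) \<Otimes>\<^sub>M PiM B (\<lambda>_. borel :: real measure)"
  have V': "mat_measurable ?N n k (\<lambda>ab. V (fst ab))" by (rule mat_measurable_compose[OF V measurable_fst])
  have u': "vec_measurable ?N n (\<lambda>ab. vec n (\<lambda>i. u i (snd ab)))"
    by (rule vec_measurable_compose[OF vec_measurable_vec[OF u] measurable_snd])
  have [measurable]: "(\<lambda>ab. det ((V (fst ab))\<^sup>T * V (fst ab))) \<in> borel_measurable ?N"
    by (rule det_measurable[OF mat_measurable_mult[OF mat_measurable_transpose[OF V'] V']])
  have [measurable]: "(\<lambda>ab. vec n (\<lambda>i. u i (snd ab)) \<bullet> (adj_resid n (V (fst ab)) *\<^sub>v vec n (\<lambda>i. u i (snd ab)))) \<in> borel_measurable ?N"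
    by (rule scalar_prod_measurable[OF u' vec_measurable_mult[OF mat_measurable_adj_resid[OF V'] u']])
  have P: "{ab \<in> space ?N. P ab} \<in> sets ?N" unfolding P_def by measurable
  have "E = (\<lambda>\<omega>. (X \<omega>, Y \<omega>)) -` {ab \<in> space ?N. P ab} \<inter> space M"
    unfolding E_eq using measurable_space[OF XY(1)] measurable_space[OF XY(2)]
    by (auto simp: space_pair_measure)
  thus "E \<in> events" using P by (auto intro!: measurable_sets[where A = ?N])
  show "prob E \<le> (\<kappa> + 2) * (real n - real k) / t\<^sup>2"
    unfolding E_eq
  proof (rule prob_le_of_indep[OF indXY P])
    show "0 \<le> (\<kappa> + 2) * (real n - real k) / t\<^sup>2" using \<kappa> kn by simp
    fix a assume a: "a \<in> space (PiM A (\<lambda>_. borel :: real measure))"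
    have Va: "V a \<in> carrier_mat n k" using V a by (simp add: mat_measurable_def)
    have G: "(V a)\<^sup>T * V a \<in> carrier_mat k k" by (rule gram_mat_carrier[OF Va])
    show "prob {\<omega> \<in> space M. P (a, Y \<omega>)} \<le> (\<kappa> + 2) * (real n - real k) / t\<^sup>2"
    proof (cases "det ((V a)\<^sup>T * V a) = 0")
      case True
      hence "{\<omega> \<in> space M. P (a, Y \<omega>)} = {}" by (simp add: P_def)
      thus ?thesis using \<kappa> kn by (simp only: measure_empty) simp
    next
      case False
      hence inv: "invertible_mat ((V a)\<^sup>T * V a)" using invertible_mat_iff_det[OF G] by simp
      have "{\<omega> \<in> space M. P (a, Y \<omega>)} = {\<omega> \<in> space M. t < \<bar>vec n (\<lambda>i. z i \<omega>) \<bullet> (resid_mat n (V a) *\<^sub>v vec n (\<lambda>i. z i \<omega>)) - (real n - real k)\<bar>}"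
        unfolding P_def fst_conv snd_conv vz adj_resid_eq[OF Va inv] using False by simp
      thus ?thesis using resid_form_deviation[OF indz moments \<kappa> t Va inv] by simp
    qed
  qed
qed

end

text \<open>Columns \<open>0, \<dots>, q - 1\<close> of the array \<open>W\<close> are \<open>Z\<close>, the columns from \<open>q\<close> to \<open>p - 1\<close> are those of
  \<open>V\<close> after its constant column 0, and column \<open>p\<close> holds the standardised errors.\<close>

locale regression_array = prob_space M for M :: "'a measure" +
  fixes W :: "nat \<times> nat \<Rightarrow> 'a \<Rightarrow> real" and n p q :: nat and \<kappa> :: real and E2 E1 :: "real mat"
  assumes ind: "indep_vars (\<lambda>_. borel) W ({..<n} \<times> {..p})"
    and law: "\<And>i j. i < n \<Longrightarrow> j < p \<Longrightarrow> distr M borel (W (i, j)) = std_normal"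
    and err: "\<And>i. i < n \<Longrightarrow> integrable M (\<lambda>\<omega>. W (i, p) \<omega> ^ 4)" "\<And>i. i < n \<Longrightarrow> expectation (W (i, p)) = 0"
      "\<And>i. i < n \<Longrightarrow> expectation (\<lambda>\<omega>. (W (i, p) \<omega>)\<^sup>2) = 1" "\<And>i. i < n \<Longrightarrow> expectation (\<lambda>\<omega>. W (i, p) \<omega> ^ 4) \<le> \<kappa>"
    and \<kappa>: "3 \<le> \<kappa>" and q: "1 \<le> q" "q \<le> p" and pn: "p + 1 < n"
    and E2: "E2 \<in> carrier_mat q (p + 1)" and E1: "E1 \<in> carrier_mat (p + 1 - q) (p + 1)"
begin

abbreviation "k \<equiv> p + 1 - q"
text \<open>Residual degrees of freedom: \<open>m\<close> after regression on \<open>V\<close>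
  alone, \<open>m'\<close> after regression on all regressors.\<close>

abbreviation "m \<equiv> real n - real k"
abbreviation "m' \<equiv> real n - real (p + 1)"

definition "Zm a = mat n q (\<lambda>(i, j). a (i, j))" for a :: "nat \<times> nat \<Rightarrow> real"
definition "Vm a = intercept_mat n k (q - 1) a" for a :: "nat \<times> nat \<Rightarrow> real"
definition "Um a = Zm a * E2 + Vm a * E1" for a :: "nat \<times> nat \<Rightarrow> real"
definition "epsv a = vec n (\<lambda>i. a (i, p))" for a :: "nat \<times> nat \<Rightarrow> real"
definition "Qm a = adj_resid n (Vm a)" for a :: "nat \<times> nat \<Rightarrow> real"
definition "zv a j = vec n (\<lambda>i. a (i, j))" for a :: "nat \<times> nat \<Rightarrow> real"
definition "xv a j l = vec n (\<lambda>i. (a (i, j) + a (i, l)) / sqrt 2)" for a :: "nat \<times> nat \<Rightarrow> real"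

text \<open>The quadratic forms in \<open>xv\<close> control the off-diagonal entries of \<open>Z'QZ\<close> by polarisation, and
  the determinant condition makes \<open>V'V\<close> invertible.\<close>

definition good :: "real \<Rightarrow> (nat \<times> nat \<Rightarrow> real) \<Rightarrow> bool" where
  "good \<eta> a \<longleftrightarrow> det (intercept_mat k k (q - 1) a) \<noteq> 0 \<and>
    (\<forall>j<q. \<bar>zv a j \<bullet> (Qm a *\<^sub>v zv a j) - m\<bar> \<le> \<eta> * m / 2) \<and>
    (\<forall>j<q. \<forall>l<q. j \<noteq> l \<longrightarrow> \<bar>xv a j l \<bullet> (Qm a *\<^sub>v xv a j l) - m\<bar> \<le> \<eta> * m / 2) \<and>
    \<bar>epsv a \<bullet> (Qm a *\<^sub>v epsv a) - m\<bar> \<le> \<eta> * m \<and>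
    (det ((Um a)\<^sup>T * Um a) \<noteq> 0 \<longrightarrow> \<bar>epsv a \<bullet> (adj_resid n (Um a) *\<^sub>v epsv a) - m'\<bar> \<le> \<eta> * m')"

lemma m_bounds: "1 \<le> m'" "m' \<le> m" "k \<le> n" "1 \<le> k"
  using q pn by auto

lemma rv [measurable]: "(i, j) \<in> {..<n} \<times> {..p} \<Longrightarrow> W (i, j) \<in> borel_measurable M"
  using ind by (auto simp: indep_vars_def)

lemma rv_entry: "v \<in> {..<n} \<times> {..p} \<Longrightarrow> W v \<in> borel_measurable M"
  using ind by (auto simp: indep_vars_def)

lemma indep_column:
  assumes j: "j \<le> p"
  shows "indep_vars (\<lambda>_. borel) (\<lambda>i. W (i, j)) {..<n}"
proof -
  have "indep_vars (\<lambda>i. PiM {(i, j)} (\<lambda>_. borel)) (\<lambda>i \<omega>. restrict (\<lambda>t. W t \<omega>) {(i, j)}) {..<n}"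
    using j by (intro indep_vars_restrict[OF ind]) (auto simp: disjoint_family_on_def)
  hence "indep_vars (\<lambda>_. borel) (\<lambda>i \<omega>. restrict (\<lambda>t. W t \<omega>) {(i, j)} (i, j)) {..<n}"
    by (rule indep_vars_compose2[where Y = "\<lambda>i f. f (i, j)"]) (auto intro!: measurable_component_singleton)
  thus ?thesis by simp
qed

lemma indep_column_pair:
  assumes jl: "j \<le> p" "l \<le> p"
  shows "indep_vars (\<lambda>_. borel) (\<lambda>i \<omega>. (W (i, j) \<omega> + W (i, l) \<omega>) / sqrt 2) {..<n}"
proof -
  have "indep_vars (\<lambda>i. PiM {(i, j), (i, l)} (\<lambda>_. borel)) (\<lambda>i \<omega>. restrict (\<lambda>t. W t \<omega>) {(i, j), (i, l)}) {..<n}"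
    using jl by (intro indep_vars_restrict[OF ind]) (auto simp: disjoint_family_on_def)
  hence "indep_vars (\<lambda>_. borel) (\<lambda>i \<omega>. (restrict (\<lambda>t. W t \<omega>) {(i, j), (i, l)} (i, j) +
      restrict (\<lambda>t. W t \<omega>) {(i, j), (i, l)} (i, l)) / sqrt 2) {..<n}"
    by (rule indep_vars_compose2[where Y = "\<lambda>i f. (f (i, j) + f (i, l)) / sqrt 2"])
      (auto intro!: borel_measurable_divide borel_measurable_add measurable_component_singleton)
  thus ?thesis by simp
qed

lemma law_pair:
  assumes "i < n" "j < p" "l < p" "j \<noteq> l"
  shows "distr M borel (\<lambda>\<omega>. (W (i, j) \<omega> + W (i, l) \<omega>) / sqrt 2) = std_normal"
proof -
  have "distr M borel (\<lambda>\<omega>. \<Sum>t\<in>{(i, j), (i, l)}. (1 / sqrt 2) * W t \<omega>) = std_normal"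
    using assms law
    by (intro std_normal_unit_combination indep_vars_subset[OF ind]) (auto simp: power_divide)
  thus ?thesis using assms(4) by (simp add: add_divide_distrib)
qed

lemma Vm_measurable: "mat_measurable (PiM ({..<n} \<times> {q..<p}) (\<lambda>_. borel)) n k Vm"
  unfolding Vm_def using q by (intro intercept_mat_measurable) auto

lemma Vm_cong: "(\<And>i j. i < n \<Longrightarrow> q \<le> j \<Longrightarrow> j < p \<Longrightarrow> a (i, j) = b (i, j)) \<Longrightarrow> Vm a = Vm b"
  unfolding Vm_def intercept_mat_def using q by (intro eq_matI) auto

lemma Vm_measurable': "mat_measurable (PiM ({..<n} \<times> {..<p}) (\<lambda>_. borel)) n k Vm"
  unfolding Vm_def using q by (intro intercept_mat_measurable) auto

lemma Um_measurable: "mat_measurable (PiM ({..<n} \<times> {..<p}) (\<lambda>_. borel)) n (p + 1) Um"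
proof -
  have "mat_measurable (PiM ({..<n} \<times> {..<p}) (\<lambda>_. borel)) n q Zm"
    unfolding mat_measurable_def
  proof (intro conjI ballI allI impI)
    fix i j assume ij: "i < n" "j < q"
    hence "(\<lambda>a. a (i, j)) \<in> borel_measurable (PiM ({..<n} \<times> {..<p}) (\<lambda>_. borel))"
      using q by (intro measurable_component_singleton) auto
    thus "(\<lambda>a. Zm a $$ (i, j)) \<in> borel_measurable (PiM ({..<n} \<times> {..<p}) (\<lambda>_. borel))"
      using ij by (simp add: Zm_def)
  qed (simp add: Zm_def)
  from mat_measurable_plus[OF mat_measurable_mult[OF this mat_measurable_const[OF E2]]
      mat_measurable_mult[OF Vm_measurable' mat_measurable_const[OF E1]]]
  show ?thesis by (simp add: Um_def[abs_def])
qed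

lemma Um_cong:
  assumes "\<And>i j. i < n \<Longrightarrow> j < p \<Longrightarrow> a (i, j) = b (i, j)"
  shows "Um a = Um b"
proof -
  have "Vm a = Vm b" using assms by (intro Vm_cong) auto
  moreover have "Zm a = Zm b" unfolding Zm_def using assms q by (intro eq_matI) auto
  ultimately show ?thesis by (simp add: Um_def)
qed

section \<open>Exceptional events and their probabilities\<close>

definition "bad0 = {\<omega> \<in> space M. det (intercept_mat k k (q - 1) (\<lambda>t. W t \<omega>)) = 0}"

text \<open>Also used with \<open>j = p\<close>, where the column consists of the standardised
  errors.\<close>

definition "badZ t j = {\<omega> \<in> space M. det ((Vm (\<lambda>t. W t \<omega>))\<^sup>T * Vm (\<lambda>t. W t \<omega>)) \<noteq> 0 \<and>
     t < \<bar>vec n (\<lambda>i. W (i, j) \<omega>) \<bullet> (adj_resid n (Vm (\<lambda>t. W t \<omega>)) *\<^sub>v vec n (\<lambda>i. W (i, j) \<omega>)) - m\<bar>}"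

definition "badX t j l = {\<omega> \<in> space M. det ((Vm (\<lambda>t. W t \<omega>))\<^sup>T * Vm (\<lambda>t. W t \<omega>)) \<noteq> 0 \<and>
     t < \<bar>vec n (\<lambda>i. (W (i, j) \<omega> + W (i, l) \<omega>) / sqrt 2) \<bullet>
       (adj_resid n (Vm (\<lambda>t. W t \<omega>)) *\<^sub>v vec n (\<lambda>i. (W (i, j) \<omega> + W (i, l) \<omega>) / sqrt 2)) - m\<bar>}"

definition "badU t = {\<omega> \<in> space M. det ((Um (\<lambda>t. W t \<omega>))\<^sup>T * Um (\<lambda>t. W t \<omega>)) \<noteq> 0 \<and>
     t < \<bar>vec n (\<lambda>i. W (i, p) \<omega>) \<bullet> (adj_resid n (Um (\<lambda>t. W t \<omega>)) *\<^sub>v vec n (\<lambda>i. W (i, p) \<omega>)) - m'\<bar>}"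

lemma bad0: "prob bad0 = 0" "bad0 \<in> events"
proof -
  have "mat_measurable (PiM ({..<n} \<times> {..p}) (\<lambda>_. borel)) k k (intercept_mat k k (q - 1))"
    using m_bounds q by (intro intercept_mat_measurable) auto
  from mat_measurable_compose[OF this, of "\<lambda>\<omega>. restrict (\<lambda>t. W t \<omega>) ({..<n} \<times> {..p})" M]
  have "mat_measurable M k k (\<lambda>\<omega>. intercept_mat k k (q - 1) (restrict (\<lambda>t. W t \<omega>) ({..<n} \<times> {..p})))"
    using measurable_restrict[of "{..<n} \<times> {..p}" W M "\<lambda>_. borel"] rv_entry by simp
  moreover have "intercept_mat k k (q - 1) (restrict (\<lambda>t. W t \<omega>) ({..<n} \<times> {..p})) = intercept_mat k k (q - 1) (\<lambda>t. W t \<omega>)" for \<omega>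
    using m_bounds q by (intro eq_matI) (auto simp: intercept_mat_def)
  ultimately have "mat_measurable M k k (\<lambda>\<omega>. intercept_mat k k (q - 1) (\<lambda>t. W t \<omega>))" by simp
  from det_measurable[OF this] show ev: "bad0 \<in> events" unfolding bad0_def by measurable
  have "AE \<omega> in M. det (intercept_mat k k (q - 1) (\<lambda>t. W t \<omega>)) \<noteq> 0"
    using m_bounds q by (intro AE_det_intercept_mat[OF ind] law) auto
  hence "AE \<omega> in M. \<omega> \<notin> bad0" by eventually_elim (auto simp: bad0_def)
  thus "prob bad0 = 0" using ev by (simp add: prob_eq_0)
qed

lemma badZ:
  assumes "0 < t" "j < q"
  shows "prob (badZ t j) \<le> (\<kappa> + 2) * m / t\<^sup>2" "badZ t j \<in> events"
proof -
  have "indep_vars (\<lambda>_. borel) (\<lambda>i. W (i, j)) {..<n}" using assms q by (intro indep_column) auto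
  note * = conditional_resid_form_deviation[OF ind, of "{..<n} \<times> {q..<p}" "{..<n} \<times> {..<q}" n k Vm "\<lambda>i b. b (i, j)"
      "\<lambda>i. W (i, j)" \<kappa> t, folded badZ_def, OF _ _ _ Vm_measurable _ _ _ this]
  \<comment> \<open>The fourth moment of a standard normal variable is 3, and
    \<open>3 \<le> \<kappa>\<close> lets one bound serve the design and the errors alike.\<close>
  have mom: "integrable M (\<lambda>\<omega>. W (i, j) \<omega> ^ 4)" "expectation (W (i, j)) = 0"
      "expectation (\<lambda>\<omega>. (W (i, j) \<omega>)\<^sup>2) = 1" "expectation (\<lambda>\<omega>. W (i, j) \<omega> ^ 4) \<le> \<kappa>" if "i < n" for i
    using std_normal_moments[OF law[of i j] rv[of i j]] that assms q \<kappa> by auto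
  have Vr: "Vm (restrict (\<lambda>t. W t \<omega>) ({..<n} \<times> {q..<p})) = Vm (\<lambda>t. W t \<omega>)" for \<omega>
    by (rule Vm_cong) simp
  show "prob (badZ t j) \<le> (\<kappa> + 2) * m / t\<^sup>2" "badZ t j \<in> events"
    by (rule *; use mom assms q \<kappa> m_bounds Vr in \<open>auto intro!: measurable_component_singleton\<close>)+
qed

lemma badX:
  assumes "0 < t" "j < q" "l < q" "j \<noteq> l"
  shows "prob (badX t j l) \<le> (\<kappa> + 2) * m / t\<^sup>2" "badX t j l \<in> events"
proof -
  have i: "indep_vars (\<lambda>_. borel) (\<lambda>i \<omega>. (W (i, j) \<omega> + W (i, l) \<omega>) / sqrt 2) {..<n}"
    using assms q by (intro indep_column_pair) auto
  note * = conditional_resid_form_deviation[OF ind, of "{..<n} \<times> {q..<p}" "{..<n} \<times> {..<q}" n k Vm "\<lambda>i b. (b (i, j) + b (i, l)) / sqrt 2"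
      "\<lambda>i \<omega>. (W (i, j) \<omega> + W (i, l) \<omega>) / sqrt 2" \<kappa> t, folded badX_def, OF _ _ _ Vm_measurable _ _ _ i]
  have mom: "integrable M (\<lambda>\<omega>. ((W (i, j) \<omega> + W (i, l) \<omega>) / sqrt 2) ^ 4)" "expectation (\<lambda>\<omega>. (W (i, j) \<omega> + W (i, l) \<omega>) / sqrt 2) = 0"
      "expectation (\<lambda>\<omega>. ((W (i, j) \<omega> + W (i, l) \<omega>) / sqrt 2)\<^sup>2) = 1"
      "expectation (\<lambda>\<omega>. ((W (i, j) \<omega> + W (i, l) \<omega>) / sqrt 2) ^ 4) \<le> \<kappa>" if "i < n" for i
    using std_normal_moments[OF law_pair[of i j l]] rv[of i j] rv[of i l] that assms q \<kappa> by auto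
  have Vr: "Vm (restrict (\<lambda>t. W t \<omega>) ({..<n} \<times> {q..<p})) = Vm (\<lambda>t. W t \<omega>)" for \<omega>
    by (rule Vm_cong) simp
  have u: "(\<lambda>b. (b (i, j) + b (i, l)) / sqrt 2) \<in> borel_measurable (PiM ({..<n} \<times> {..<q}) (\<lambda>_. borel))" if "i < n" for i
    using assms that by (intro borel_measurable_divide borel_measurable_add measurable_component_singleton) auto
  show "prob (badX t j l) \<le> (\<kappa> + 2) * m / t\<^sup>2" "badX t j l \<in> events"
    by (rule *; (rule mom u Vr; assumption)?; use assms q \<kappa> m_bounds Vr in \<open>auto\<close>)+
qed

lemma badE:
  assumes "0 < t"
  shows "prob (badZ t p) \<le> (\<kappa> + 2) * m / t\<^sup>2" "badZ t p \<in> events"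
proof -
  have "indep_vars (\<lambda>_. borel) (\<lambda>i. W (i, p)) {..<n}" by (intro indep_column) auto
  note * = conditional_resid_form_deviation[OF ind, of "{..<n} \<times> {q..<p}" "{..<n} \<times> {p}" n k Vm "\<lambda>i b. b (i, p)"
      "\<lambda>i. W (i, p)" \<kappa> t, folded badZ_def, OF _ _ _ Vm_measurable _ _ _ this]
  have Vr: "Vm (restrict (\<lambda>t. W t \<omega>) ({..<n} \<times> {q..<p})) = Vm (\<lambda>t. W t \<omega>)" for \<omega>
    by (rule Vm_cong) simp
  show "prob (badZ t p) \<le> (\<kappa> + 2) * m / t\<^sup>2" "badZ t p \<in> events"
    by (rule *; use err assms q \<kappa> m_bounds Vr in \<open>auto intro!: measurable_component_singleton\<close>)+
qed

lemma badU:
  assumes "0 < t"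
  shows "prob (badU t) \<le> (\<kappa> + 2) * m' / t\<^sup>2" "badU t \<in> events"
proof -
  have "indep_vars (\<lambda>_. borel) (\<lambda>i. W (i, p)) {..<n}" by (intro indep_column) auto
  note * = conditional_resid_form_deviation[OF ind, of "{..<n} \<times> {..<p}" "{..<n} \<times> {p}" n "p + 1" Um "\<lambda>i b. b (i, p)"
      "\<lambda>i. W (i, p)" \<kappa> t, folded badU_def, OF _ _ _ Um_measurable _ _ _ this]
  have Ur: "Um (restrict (\<lambda>t. W t \<omega>) ({..<n} \<times> {..<p})) = Um (\<lambda>t. W t \<omega>)" for \<omega>
    by (rule Um_cong) simp
  show "prob (badU t) \<le> (\<kappa> + 2) * m' / t\<^sup>2" "badU t \<in> events"
    by (rule *; use err assms q \<kappa> m_bounds pn Ur in \<open>auto intro!: measurable_component_singleton\<close>)+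
qed

text \<open>A union bound: \<open>q\<close> events for the columns of \<open>Z\<close>, at most the
  square of \<open>q\<close> for pairs of columns, two for the errors, and the null event of a
  singular minor. Each probability is at most \<open>c\<close>; its factor 4 pays for the tolerance
  \<open>\<eta> * m / 2\<close> in place of \<open>\<eta> * m\<close>, and \<open>m' \<le> m\<close>
  allows a common denominator.\<close>

lemma good_outside_small_event:
  assumes \<eta>: "0 < \<eta>"
  shows "\<exists>B\<in>events. prob B \<le> 4 * (\<kappa> + 2) * (real q + real q ^ 2 + 2) / (\<eta>\<^sup>2 * m') \<and>
    (\<forall>\<omega>\<in>space M - B. good \<eta> (\<lambda>t. W t \<omega>))"
proof -
  define J where "J = {(j, l). j < q \<and> l < q \<and> j \<noteq> l}"
  have J: "finite J" "card J \<le> q ^ 2"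
  proof -
    have sub: "J \<subseteq> {..<q} \<times> {..<q}" by (auto simp: J_def)
    show "finite J" by (rule finite_subset[OF sub]) simp
    show "card J \<le> q ^ 2" using card_mono[OF _ sub] by (simp add: power2_eq_square)
  qed
  define Bz where "Bz = (\<Union>j\<in>{..<q}. badZ (\<eta> * m / 2) j)"
  define Bx where "Bx = (\<Union>(j, l)\<in>J. badX (\<eta> * m / 2) j l)"
  define c where "c = 4 * (\<kappa> + 2) / (\<eta>\<^sup>2 * m')"
  have pos: "0 < m'" "0 < m" "0 < \<eta> * m / 2" "0 < \<eta> * m" "0 < \<eta> * m'" using m_bounds \<eta> by auto
  have c0: "0 \<le> c" using \<kappa> pos by (simp add: c_def)
  have cancel: "(\<kappa> + 2) * x / (\<eta> * x)\<^sup>2 = (\<kappa> + 2) / (\<eta>\<^sup>2 * x)" if "0 < x" for x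
    using that by (simp add: power2_eq_square)
  have c1: "(\<kappa> + 2) * m / (\<eta> * m / 2)\<^sup>2 \<le> c"
  proof -
    have "(\<kappa> + 2) * m / (\<eta> * m / 2)\<^sup>2 = 4 * (\<kappa> + 2) / (\<eta>\<^sup>2 * m)"
    proof -
      have "(\<kappa> + 2) * m / (\<eta> * m / 2)\<^sup>2 = 4 * ((\<kappa> + 2) * m / (\<eta> * m)\<^sup>2)" by (simp add: power_divide)
      also have "\<dots> = 4 * ((\<kappa> + 2) / (\<eta>\<^sup>2 * m))" by (simp only: cancel[OF pos(2)])
      finally show ?thesis by simp
    qed
    also have "\<dots> \<le> c" unfolding c_def using pos m_bounds \<kappa> \<eta> by (intro divide_left_mono mult_left_mono mult_pos_pos) auto
    finally show ?thesis .
  qed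
  have c2: "(\<kappa> + 2) * m / (\<eta> * m)\<^sup>2 \<le> c"
  proof -
    have "(\<kappa> + 2) * m / (\<eta> * m)\<^sup>2 = (\<kappa> + 2) / (\<eta>\<^sup>2 * m)"
      by (rule cancel[OF pos(2)])
    also have "\<dots> \<le> c" unfolding c_def using pos m_bounds \<kappa> \<eta> by (intro frac_le mult_left_mono mult_pos_pos) auto
    finally show ?thesis .
  qed
  have c3: "(\<kappa> + 2) * m' / (\<eta> * m')\<^sup>2 \<le> c"
  proof -
    have "(\<kappa> + 2) * m' / (\<eta> * m')\<^sup>2 = (\<kappa> + 2) / (\<eta>\<^sup>2 * m')"
      by (rule cancel[OF pos(1)])
    also have "\<dots> \<le> c" unfolding c_def using pos m_bounds \<kappa> \<eta> by (intro frac_le mult_left_mono mult_pos_pos) auto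
    finally show ?thesis .
  qed
  have evs: "Bz \<in> events" "Bx \<in> events"
    unfolding Bz_def Bx_def using badZ(2)[OF pos(3)] badX(2)[OF pos(3)] J
    by (auto intro!: sets.finite_UN simp: J_def split: prod.splits)
  have pz: "prob Bz \<le> real q * c"
  proof -
    have "prob Bz \<le> (\<Sum>j\<in>{..<q}. prob (badZ (\<eta> * m / 2) j))"
      unfolding Bz_def using badZ(2)[OF pos(3)] by (intro finite_measure_subadditive_finite) auto
    also have "\<dots> \<le> (\<Sum>j\<in>{..<q}. c)" using badZ(1)[OF pos(3)] c1 by (intro sum_mono) (auto intro: order_trans)
    finally show ?thesis by simp
  qed
  have px: "prob Bx \<le> real q ^ 2 * c"
  proof -
    have "prob Bx \<le> (\<Sum>v\<in>J. prob (case v of (j, l) \<Rightarrow> badX (\<eta> * m / 2) j l))"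
      unfolding Bx_def using badX(2)[OF pos(3)] J
      by (intro finite_measure_subadditive_finite) (auto simp: J_def)
    also have "\<dots> \<le> (\<Sum>v\<in>J. c)" using badX(1)[OF pos(3)] c1
      by (intro sum_mono) (auto simp: J_def intro: order_trans)
    also have "\<dots> \<le> real q ^ 2 * c" using J(2) c0
      by (simp add: mult_right_mono flip: of_nat_power)
    finally show ?thesis .
  qed
  have "{\<omega> \<in> space M. \<not> good \<eta> (\<lambda>t. W t \<omega>)} \<subseteq> bad0 \<union> (Bz \<union> (Bx \<union> (badZ (\<eta> * m) p \<union> badU (\<eta> * m'))))"
  proof
    fix \<omega> assume "\<omega> \<in> {\<omega> \<in> space M. \<not> good \<eta> (\<lambda>t. W t \<omega>)}"
    hence \<omega>: "\<omega> \<in> space M" "\<not> good \<eta> (\<lambda>t. W t \<omega>)" by auto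
    show "\<omega> \<in> bad0 \<union> (Bz \<union> (Bx \<union> (badZ (\<eta> * m) p \<union> badU (\<eta> * m'))))"
    proof (rule ccontr)
      assume no: "\<omega> \<notin> bad0 \<union> (Bz \<union> (Bx \<union> (badZ (\<eta> * m) p \<union> badU (\<eta> * m'))))"
      have d: "det (intercept_mat k k (q - 1) (\<lambda>t. W t \<omega>)) \<noteq> 0" using no \<omega> by (auto simp: bad0_def)
      have "invertible_mat ((Vm (\<lambda>t. W t \<omega>))\<^sup>T * Vm (\<lambda>t. W t \<omega>))"
        unfolding Vm_def by (rule intercept_mat_gram_invertible[OF d m_bounds(3)])
      hence d': "det ((Vm (\<lambda>t. W t \<omega>))\<^sup>T * Vm (\<lambda>t. W t \<omega>)) \<noteq> 0"
        using invertible_mat_iff_det[OF gram_mat_carrier[of "Vm (\<lambda>t. W t \<omega>)" n k]] by (simp add: Vm_def)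
      have "good \<eta> (\<lambda>t. W t \<omega>)"
        unfolding good_def
      proof (intro conjI allI impI)
        fix j assume "j < q"
        hence "\<omega> \<notin> badZ (\<eta> * m / 2) j" using no by (auto simp: Bz_def)
        thus "\<bar>zv (\<lambda>t. W t \<omega>) j \<bullet> (Qm (\<lambda>t. W t \<omega>) *\<^sub>v zv (\<lambda>t. W t \<omega>) j) - m\<bar> \<le> \<eta> * m / 2"
          using \<omega> d' by (auto simp: badZ_def zv_def Qm_def)
      next
        fix j l assume "j < q" "l < q" "j \<noteq> l"
        hence "\<omega> \<notin> badX (\<eta> * m / 2) j l" using no by (auto simp: Bx_def J_def)
        thus "\<bar>xv (\<lambda>t. W t \<omega>) j l \<bullet> (Qm (\<lambda>t. W t \<omega>) *\<^sub>v xv (\<lambda>t. W t \<omega>) j l) - m\<bar> \<le> \<eta> * m / 2"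
          using \<omega> d' by (auto simp: badX_def xv_def Qm_def)
      next
        show "\<bar>epsv (\<lambda>t. W t \<omega>) \<bullet> (Qm (\<lambda>t. W t \<omega>) *\<^sub>v epsv (\<lambda>t. W t \<omega>)) - m\<bar> \<le> \<eta> * m"
          using no \<omega> d' by (auto simp: badZ_def epsv_def Qm_def)
      next
        assume "det ((Um (\<lambda>t. W t \<omega>))\<^sup>T * Um (\<lambda>t. W t \<omega>)) \<noteq> 0"
        thus "\<bar>epsv (\<lambda>t. W t \<omega>) \<bullet> (adj_resid n (Um (\<lambda>t. W t \<omega>)) *\<^sub>v epsv (\<lambda>t. W t \<omega>)) - m'\<bar> \<le> \<eta> * m'"
          using no \<omega> by (auto simp: badU_def epsv_def)
      qed (rule d)
      thus False using \<omega> by simp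
    qed
  qed
  hence "\<forall>\<omega>\<in>space M - (bad0 \<union> (Bz \<union> (Bx \<union> (badZ (\<eta> * m) p \<union> badU (\<eta> * m'))))). good \<eta> (\<lambda>t. W t \<omega>)"
    by blast
  moreover have "bad0 \<union> (Bz \<union> (Bx \<union> (badZ (\<eta> * m) p \<union> badU (\<eta> * m')))) \<in> events"
    using evs bad0(2) badE(2)[OF pos(4)] badU(2)[OF pos(5)] by auto
  moreover have "prob (bad0 \<union> (Bz \<union> (Bx \<union> (badZ (\<eta> * m) p \<union> badU (\<eta> * m')))))
      \<le> 4 * (\<kappa> + 2) * (real q + real q ^ 2 + 2) / (\<eta>\<^sup>2 * m')"
  proof -
    have "prob (bad0 \<union> (Bz \<union> (Bx \<union> (badZ (\<eta> * m) p \<union> badU (\<eta> * m')))))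
      \<le> prob bad0 + (prob Bz + (prob Bx + (prob (badZ (\<eta> * m) p) + prob (badU (\<eta> * m')))))"
    using evs bad0(2) badE(2)[OF pos(4)] badU(2)[OF pos(5)]
    by (intro order_trans[OF measure_Un_le] add_left_mono) auto
  also have "\<dots> \<le> 0 + (real q * c + (real q ^ 2 * c + (c + c)))"
    using bad0(1) pz px badE(1)[OF pos(4)] badU(1)[OF pos(5)] c2 c3 by (intro add_mono) auto
  also have "\<dots> = 4 * (\<kappa> + 2) * (real q + real q ^ 2 + 2) / (\<eta>\<^sup>2 * m')"
    by (simp add: c_def algebra_simps add_divide_distrib)
    finally show ?thesis .
  qed
  ultimately show ?thesis by blast
qed

text \<open>The squared length of \<open>Qe\<close>, hence the square root wherever it serves as a
  normaliser.\<close>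

definition "resid_norm a = (\<Sum>i<n. ((Qm a *\<^sub>v epsv a) $ i)\<^sup>2)"

text \<open>The value chosen for a vanishing residual keeps \<open>dir\<close> a unit vector always, so that \<open>gsq\<close>
  has exactly the chi-squared law.\<close>

definition "dir a i = (if resid_norm a = 0 then of_bool (i = 0) else (Qm a *\<^sub>v epsv a) $ i / sqrt (resid_norm a))"

lemma dir_unit: "(\<Sum>i<n. (dir a i)\<^sup>2) = 1"
proof (cases "resid_norm a = 0")
  case True
  thus ?thesis using pn by (simp add: dir_def power2_eq_square of_bool_def if_distrib[of "\<lambda>x. x * _"] cong: if_cong)
next
  case False
  have "0 \<le> resid_norm a" by (simp add: resid_norm_def sum_nonneg)
  hence "(\<Sum>i<n. (dir a i)\<^sup>2) = resid_norm a / resid_norm a"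
    using False by (simp add: dir_def power_divide resid_norm_def flip: sum_divide_distrib)
  thus ?thesis using False by simp
qed

text \<open>The quantity \<open>g'g\<close> of the overview, with \<open>dir a\<close> as the
  normalised residual \<open>Qe / |Qe|\<close>.\<close>

definition "gsq a = (\<Sum>j<q. (\<Sum>i<n. dir a i * a (i, j))\<^sup>2)"

lemma dir_measurable:
  assumes "i < n"
  shows "(\<lambda>a. dir a i) \<in> borel_measurable (PiM ({..<n} \<times> {q..p}) (\<lambda>_. borel))"
proof -
  have V: "mat_measurable (PiM ({..<n} \<times> {q..p}) (\<lambda>_. borel)) n k Vm"
    unfolding Vm_def using q by (intro intercept_mat_measurable) auto
  have e: "vec_measurable (PiM ({..<n} \<times> {q..p}) (\<lambda>_. borel)) n epsv"
    unfolding epsv_def[abs_def] using q by (intro vec_measurable_vec measurable_component_singleton) auto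
  have "vec_measurable (PiM ({..<n} \<times> {q..p}) (\<lambda>_. borel)) n (\<lambda>a. Qm a *\<^sub>v epsv a)"
    unfolding Qm_def by (rule vec_measurable_mult[OF mat_measurable_adj_resid[OF V] e])
  hence Qe [measurable]: "(\<lambda>a. (Qm a *\<^sub>v epsv a) $ i) \<in> borel_measurable (PiM ({..<n} \<times> {q..p}) (\<lambda>_. borel))" if "i < n" for i
    using that by (simp add: vec_measurable_def)
  have [measurable]: "resid_norm \<in> borel_measurable (PiM ({..<n} \<times> {q..p}) (\<lambda>_. borel))"
    unfolding resid_norm_def[abs_def] by (intro borel_measurable_sum borel_measurable_power Qe) auto
  show ?thesis unfolding dir_def using Qe[OF assms] by measurable
qed

lemma dir_cong:
  assumes "\<And>i j. i < n \<Longrightarrow> q \<le> j \<Longrightarrow> j \<le> p \<Longrightarrow> a (i, j) = b (i, j)"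
  shows "dir a = dir b"
proof -
  have "Vm a = Vm b" using assms by (intro Vm_cong) auto
  moreover have "epsv a = epsv b" unfolding epsv_def using assms q by (intro eq_vecI) auto
  ultimately show ?thesis by (simp add: dir_def[abs_def] resid_norm_def Qm_def cong: if_cong)
qed

text \<open>Given everything but \<open>Z\<close>, the coordinates of \<open>g\<close> are combinations of disjoint blocks of
  normal variables with coefficients of unit length.\<close>

lemma gsq_law: "distr M borel (\<lambda>\<omega>. gsq (\<lambda>t. W t \<omega>)) = chi_squared q"
proof -
  define X where "X \<omega> = restrict (\<lambda>t. W t \<omega>) ({..<n} \<times> {q..p})" for \<omega>
  define Y where "Y \<omega> = restrict (\<lambda>t. W t \<omega>) ({..<n} \<times> {..<q})" for \<omega>
  define f where "f ab = (\<Sum>j<q. (\<Sum>i<n. dir (fst ab) i * snd ab (i, j))\<^sup>2)" for ab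
  have indXY: "indep_var (PiM ({..<n} \<times> {q..p}) (\<lambda>_. borel)) X (PiM ({..<n} \<times> {..<q}) (\<lambda>_. borel)) Y"
    unfolding X_def Y_def using q by (intro indep_var_restrict[OF ind]) auto
  have "f \<in> borel_measurable (PiM ({..<n} \<times> {q..p}) (\<lambda>_. borel) \<Otimes>\<^sub>M PiM ({..<n} \<times> {..<q}) (\<lambda>_. borel))"
    unfolding f_def[abs_def]
  proof (intro borel_measurable_sum borel_measurable_power borel_measurable_times)
    fix i j assume "j \<in> {..<q}" "i \<in> {..<n}"
    thus "(\<lambda>ab. dir (fst ab) i) \<in> borel_measurable (PiM ({..<n} \<times> {q..p}) (\<lambda>_. borel) \<Otimes>\<^sub>M PiM ({..<n} \<times> {..<q}) (\<lambda>_. borel))"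
      by (intro measurable_compose[OF measurable_fst dir_measurable]) auto
    show "(\<lambda>ab. snd ab (i, j)) \<in> borel_measurable (PiM ({..<n} \<times> {q..p}) (\<lambda>_. borel) \<Otimes>\<^sub>M PiM ({..<n} \<times> {..<q}) (\<lambda>_. borel))"
      using \<open>j \<in> {..<q}\<close> \<open>i \<in> {..<n}\<close>
      by (intro measurable_compose[OF measurable_snd measurable_component_singleton]) auto
  qed
  from distr_of_indep[OF indXY this, of "chi_squared q"]
  have "distr M borel (\<lambda>\<omega>. f (X \<omega>, Y \<omega>)) = chi_squared q"
  proof -
    have "distr M borel (\<lambda>\<omega>. f (a, Y \<omega>)) = chi_squared q" for a
    proof -
      have "f (a, Y \<omega>) = (\<Sum>j<q. (\<Sum>i<n. dir a i * W (i, j) \<omega>)\<^sup>2)" for \<omega>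
        by (simp add: f_def Y_def)
      moreover have "distr M borel (\<lambda>\<omega>. \<Sum>j<q. (\<Sum>i<n. dir a i * W (i, j) \<omega>)\<^sup>2) = chi_squared q"
        using q by (intro sum_squares_unit_combinations indep_vars_subset[OF ind] law dir_unit) auto
      ultimately show ?thesis by simp
    qed
    thus ?thesis using \<open>\<lbrakk>\<And>a. a \<in> space (PiM ({..<n} \<times> {q..p}) (\<lambda>_. borel)) \<Longrightarrow> distr M borel (\<lambda>\<omega>. f (a, Y \<omega>)) = chi_squared q\<rbrakk>
        \<Longrightarrow> distr M borel (\<lambda>\<omega>. f (X \<omega>, Y \<omega>)) = chi_squared q\<close> by blast
  qed
  moreover have "f (X \<omega>, Y \<omega>) = gsq (\<lambda>t. W t \<omega>)" for \<omega>
  proof -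
    have "dir (X \<omega>) = dir (\<lambda>t. W t \<omega>)" by (rule dir_cong) (simp add: X_def)
    thus ?thesis by (simp add: f_def gsq_def Y_def)
  qed
  ultimately show ?thesis by simp
qed

lemma gsq_measurable: "(\<lambda>\<omega>. gsq (\<lambda>t. W t \<omega>)) \<in> borel_measurable M"
proof -
  have "(\<lambda>\<omega>. dir (restrict (\<lambda>t. W t \<omega>) ({..<n} \<times> {q..p})) i) \<in> borel_measurable M" if "i < n" for i
    using rv_entry by (intro measurable_compose[OF measurable_restrict dir_measurable[OF that]]) auto
  moreover have "dir (restrict (\<lambda>t. W t \<omega>) ({..<n} \<times> {q..p})) = dir (\<lambda>t. W t \<omega>)" for \<omega>
    by (rule dir_cong) simp
  ultimately have "(\<lambda>\<omega>. dir (\<lambda>t. W t \<omega>) i) \<in> borel_measurable M" if "i < n" for i using that by simp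
  thus ?thesis unfolding gsq_def using rv q
    by (intro borel_measurable_sum borel_measurable_power borel_measurable_times) auto
qed

section \<open>Deterministic estimates outside the exceptional events\<close>

context
  fixes a :: "nat \<times> nat \<Rightarrow> real" and \<eta> :: real
  assumes good: "good \<eta> a"
begin

lemma good_gram: "invertible_mat ((Vm a)\<^sup>T * Vm a)"
  using good m_bounds unfolding Vm_def good_def by (intro intercept_mat_gram_invertible) auto

lemma Vm_carrier: "Vm a \<in> carrier_mat n k" by (simp add: Vm_def)

lemma Zm_carrier: "Zm a \<in> carrier_mat n q" by (simp add: Zm_def)

lemma Qm_eq: "Qm a = resid_mat n (Vm a)"
  using adj_resid_eq[OF Vm_carrier good_gram] by (simp add: Qm_def)

lemma Qm_carrier: "Qm a \<in> carrier_mat n n" and Qm_symmetric: "(Qm a)\<^sup>T = Qm a"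
  and Qm_idempotent: "Qm a * Qm a = Qm a"
  using resid_mat_carrier[OF Vm_carrier good_gram] resid_mat_symmetric[OF Vm_carrier good_gram]
    resid_mat_idempotent[OF Vm_carrier good_gram] by (auto simp: Qm_eq)

lemma near_entries:
  assumes jl: "j < q" "l < q"
  shows "\<bar>((Zm a)\<^sup>T * (Qm a * Zm a)) $$ (j, l) - m * of_bool (j = l)\<bar> \<le> \<eta> * m"
proof -
  have z: "zv a j \<in> carrier_vec n" for j by (simp add: zv_def)
  have col: "col (Zm a) j = zv a j" if "j < q" for j
    using that by (auto simp: Zm_def zv_def)
  have ent: "((Zm a)\<^sup>T * (Qm a * Zm a)) $$ (j, l) = zv a j \<bullet> (Qm a *\<^sub>v zv a l)"
    using jl Zm_carrier Qm_carrier by (simp add: col mult_mat_vec_def)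
  have dev: "\<bar>zv a j \<bullet> (Qm a *\<^sub>v zv a j) - m\<bar> \<le> \<eta> * m / 2" if "j < q" for j
    using good that by (simp add: good_def)
  show ?thesis
  proof (cases "j = l")
    case True
    have "0 \<le> \<eta> * m / 2" using dev[OF jl(1)] by linarith
    thus ?thesis using dev[OF jl(1)] True unfolding ent by simp
  next
    case False
    have x: "xv a j l = (1 / sqrt 2) \<cdot>\<^sub>v (zv a j + zv a l)"
      by (rule eq_vecI) (auto simp: xv_def zv_def)
    define S where "S u v = u \<bullet> (Qm a *\<^sub>v v)" for u v :: "real vec"
    have sym: "S (zv a l) (zv a j) = S (zv a j) (zv a l)"
    proof -
      have "S (zv a l) (zv a j) = ((Qm a)\<^sup>T *\<^sub>v zv a l) \<bullet> zv a j"
        unfolding S_def using z Qm_carrier by (intro scalar_prod_mult_mat_vec) (auto simp: zv_def)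
      also have "\<dots> = S (zv a j) (zv a l)"
        unfolding S_def Qm_symmetric using z Qm_carrier by (intro scalar_prod_comm_dim) (auto simp: zv_def)
      finally show ?thesis .
    qed
    have Qadd: "Qm a *\<^sub>v (zv a j + zv a l) = Qm a *\<^sub>v zv a j + Qm a *\<^sub>v zv a l"
      by (rule mult_add_distrib_mat_vec[OF Qm_carrier z z])
    have Qz: "Qm a *\<^sub>v zv a j \<in> carrier_vec n" for j using Qm_carrier z by auto
    have Qx: "Qm a *\<^sub>v xv a j l = (1 / sqrt 2) \<cdot>\<^sub>v (Qm a *\<^sub>v zv a j + Qm a *\<^sub>v zv a l)"
      unfolding x Qadd[symmetric] by (rule mult_mat_vec[OF Qm_carrier]) (use z in auto)
    have "S (xv a j l) (xv a j l) = 1 / 2 * ((zv a j + zv a l) \<bullet> (Qm a *\<^sub>v zv a j + Qm a *\<^sub>v zv a l))"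
    proof -
      have "((1 / sqrt 2) \<cdot>\<^sub>v u) \<bullet> ((1 / sqrt 2) \<cdot>\<^sub>v v) = 1 / 2 * (u \<bullet> v)"
        if "u \<in> carrier_vec n" "v \<in> carrier_vec n" for u v :: "real vec" using that by simp
      from this[of "zv a j + zv a l" "Qm a *\<^sub>v zv a j + Qm a *\<^sub>v zv a l"] z Qz
      show ?thesis unfolding S_def Qx unfolding x by simp
    qed
    also have "(zv a j + zv a l) \<bullet> (Qm a *\<^sub>v zv a j + Qm a *\<^sub>v zv a l) =
        S (zv a j) (zv a j) + S (zv a j) (zv a l) + (S (zv a l) (zv a j) + S (zv a l) (zv a l))"
      unfolding S_def using z Qz
      by (simp add: add_scalar_prod_distrib[of _ n] scalar_prod_add_distrib[of _ n])
    \<comment> \<open>The terms in \<open>m\<close> cancel since \<open>2 - 1 - 1 = 0\<close>. The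
      deviations enter with weights 2, 1, 1 and size \<open>\<eta> * m / 2\<close>, so twice the
      entry is at most \<open>2 * \<eta> * m\<close>; this is why \<open>good\<close> demands half
      the tolerance for \<open>Z\<close>.\<close>
    finally have "2 * S (zv a j) (zv a l) =
        2 * (S (xv a j l) (xv a j l) - m) - (S (zv a j) (zv a j) - m) - (S (zv a l) (zv a l) - m)"
      using sym by simp
    moreover have "\<bar>S (xv a j l) (xv a j l) - m\<bar> \<le> \<eta> * m / 2"
      using good jl False by (simp add: good_def S_def)
    moreover have "\<bar>S (zv a j) (zv a j) - m\<bar> \<le> \<eta> * m / 2" "\<bar>S (zv a l) (zv a l) - m\<bar> \<le> \<eta> * m / 2"
      using dev jl by (auto simp: S_def)
    moreover have "2 * x = 2 * (a - M) - (b - M) - (c - M) \<Longrightarrow> \<bar>a - M\<bar> \<le> e / 2 \<Longrightarrow> \<bar>b - M\<bar> \<le> e / 2 \<Longrightarrow>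
        \<bar>c - M\<bar> \<le> e / 2 \<Longrightarrow> \<bar>x\<bar> \<le> e" for x a b c e M :: real
      unfolding abs_le_iff by argo
    ultimately have "\<bar>S (zv a j) (zv a l)\<bar> \<le> \<eta> * m" by blast
    thus ?thesis unfolding ent S_def[symmetric] using False by simp
  qed
qed

lemma resid_norm_eq: "resid_norm a = epsv a \<bullet> (Qm a *\<^sub>v epsv a)"
proof -
  have e: "epsv a \<in> carrier_vec n" by (simp add: epsv_def)
  have "resid_norm a = (Qm a *\<^sub>v epsv a) \<bullet> (Qm a *\<^sub>v epsv a)"
    using Qm_carrier by (simp add: resid_norm_def scalar_prod_sum power2_eq_square)
  also have "\<dots> = epsv a \<bullet> ((Qm a)\<^sup>T * Qm a *\<^sub>v epsv a)"
    using Qm_carrier e by (intro scalar_prod_mult_mat_vec_both) auto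
  finally show ?thesis by (simp add: Qm_symmetric Qm_idempotent)
qed

text \<open>The error vector is \<sigma> times a standardised one, so numerator and denominator both
  carry the square of \<sigma>, which cancels. \<open>N\<close> is the standardised numerator before
  division by \<open>q\<close>, compared with \<open>gsq\<close> by the perturbation lemma;
  \<open>d\<close> is the standardised residual sum of squares per degree of freedom.\<close>

lemma F_statistic_approx:
  assumes \<eta>: "0 < \<eta>" "real q * \<eta> \<le> 1 / 2"
    and R: "R \<in> carrier_mat q (p + 1)" and r: "r \<in> carrier_vec q" and \<gamma>: "\<gamma> \<in> carrier_vec (p + 1)"
    and D2: "D2 \<in> carrier_mat (p + 1) q" and D1: "D1 \<in> carrier_mat (p + 1) k"
    and DE: "D2 * E2 + D1 * E1 = 1\<^sub>m (p + 1)"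
    and ED: "E2 * D2 = 1\<^sub>m q" "E2 * D1 = 0\<^sub>m q k" "E1 * D2 = 0\<^sub>m k q" "E1 * D1 = 1\<^sub>m k"
    and B: "B \<in> carrier_mat q q" and L: "L \<in> carrier_mat q q" and BL: "B * L = 1\<^sub>m q"
    and RD: "R * D2 = B" "R * D1 = 0\<^sub>m q k" and \<sigma>: "0 < \<sigma>"
    and Y: "Y = Um a *\<^sub>v \<gamma> + \<sigma> \<cdot>\<^sub>v epsv a"
    and \<delta>: "\<delta> = (1 / \<sigma>) \<cdot>\<^sub>v (L *\<^sub>v (R *\<^sub>v \<gamma> - r))" and small: "m * (\<delta> \<bullet> \<delta>) \<le> \<eta>\<^sup>2"
  shows "\<exists>N d. F_statistic n p q R r (Um a) Y = (N / real q) / d \<and>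
     \<bar>N - gsq a\<bar> \<le> (4 * real q + 5) * \<eta> * (1 + gsq a) \<and> \<bar>d - 1\<bar> \<le> \<eta>"
proof -
  have "\<eta> \<le> real q * \<eta>" using q \<eta> by (simp add: mult_le_cancel_right1)
  hence \<eta>1: "\<eta> \<le> 1 / 2" using \<eta> by linarith
  have mpos: "0 < m" "0 < m'" using m_bounds by auto
  note c = Zm_carrier Vm_carrier Qm_carrier
  have U: "Um a \<in> carrier_mat n (p + 1)" unfolding Um_def using c E2 E1 by auto
  have UD2: "Um a * D2 = Zm a"
  proof -
    have "Um a * D2 = Zm a * (E2 * D2) + Vm a * (E1 * D2)"
      unfolding Um_def using c E2 E1 D2 by (subst add_mult_distrib_mat_dim) (auto simp: assoc_mult_mat_dim)
    thus ?thesis unfolding ED using c by auto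
  qed
  have UD1: "Um a * D1 = Vm a"
  proof -
    have "Um a * D1 = Zm a * (E2 * D1) + Vm a * (E1 * D1)"
      unfolding Um_def using c E2 E1 D1 by (subst add_mult_distrib_mat_dim) (auto simp: assoc_mult_mat_dim)
    thus ?thesis unfolding ED using c by auto
  qed
  define A where "A = (Zm a)\<^sup>T * (Qm a * Zm a)"
  have A: "A \<in> carrier_mat q q" unfolding A_def using c by auto
  have AT: "A\<^sup>T = A" unfolding A_def using c Qm_symmetric
    by (simp add: transpose_mult_dim assoc_mult_mat_dim)
  have near: "\<bar>A $$ (j, l) - m * of_bool (j = l)\<bar> \<le> \<eta> * m" if "j < q" "l < q" for j l
    unfolding A_def by (rule near_entries[OF that])
  note A_near = A mpos(1) less_imp_le[OF \<eta>(1)] \<eta>(2) near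
  have invA: "invertible_mat A" by (rule near_scalar_mat_invertible[OF A_near])
  interpret rr: restricted_regression n "p + 1" q k "Um a" R D2 D1 E2 E1 B L
    by unfold_locales
      (use U R D2 D1 E2 E1 DE B L BL RD good_gram invA in \<open>auto simp: UD1 UD2 A_def Qm_eq\<close>)
  have rrA: "rr.A = A" and rrQ: "rr.Q = Qm a" and rrZ: "rr.Z = Zm a"
    by (simp_all add: rr.A_def rr.Q_def rr.Z_def rr.V_def UD1 UD2 A_def Qm_eq)
  define e where "e = \<sigma> \<cdot>\<^sub>v epsv a"
  have e0: "epsv a \<in> carrier_vec n" by (simp add: epsv_def)
  have e: "e \<in> carrier_vec n" using e0 by (simp add: e_def)
  define s where "s = epsv a \<bullet> (Qm a *\<^sub>v epsv a)"
  have s: "\<bar>s - m\<bar> \<le> \<eta> * m" using good by (simp add: s_def good_def)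
  have "\<eta> * m \<le> 1 / 2 * m" using \<eta>1 mpos by (intro mult_right_mono) auto
  moreover have "e \<le> 1 / 2 * M \<Longrightarrow> \<bar>s - M\<bar> \<le> e \<Longrightarrow> 0 < M \<Longrightarrow> 0 < s" for e M :: real by linarith
  ultimately have s0: "0 < s" using s mpos(1) by blast
  have rs: "resid_norm a = s" by (simp add: resid_norm_eq s_def)
  define g where "g = vec q (\<lambda>j. \<Sum>i<n. dir a i * a (i, j))"
  have g: "g \<in> carrier_vec q" by (simp add: g_def)
  have gg: "g \<bullet> g = gsq a" by (simp add: g_def gsq_def scalar_prod_sum power2_eq_square)
  have \<delta>c: "\<delta> \<in> carrier_vec q" unfolding \<delta> using L R r \<gamma> by auto
  \<comment> \<open>As \<open>s\<close> is positive, the default branch of \<open>dir\<close> is not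
    taken, and multiplying the unit direction by \<open>sqrt s\<close> gives back
    \<open>Qe\<close>.\<close>
  have ZQe: "(Zm a)\<^sup>T *\<^sub>v (Qm a *\<^sub>v epsv a) = sqrt s \<cdot>\<^sub>v g"
  proof (rule eq_vecI)
    fix j assume "j < dim_vec (sqrt s \<cdot>\<^sub>v g)"
    hence j: "j < q" by (simp add: g_def)
    have "((Zm a)\<^sup>T *\<^sub>v (Qm a *\<^sub>v epsv a)) $ j = (\<Sum>i<n. a (i, j) * (Qm a *\<^sub>v epsv a) $ i)"
    proof -
      have "dim_vec (Qm a *\<^sub>v epsv a) = n" using c by simp
      thus ?thesis using j c(1)
        by (simp add: Zm_def scalar_prod_sum del: index_mult_mat_vec) (simp add: scalar_prod_sum)
    qed
    also have "\<dots> = (\<Sum>i<n. sqrt s * (dir a i * a (i, j)))"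
      using s0 by (intro sum.cong refl) (simp add: dir_def rs)
    finally show "((Zm a)\<^sup>T *\<^sub>v (Qm a *\<^sub>v epsv a)) $ j = (sqrt s \<cdot>\<^sub>v g) $ j"
      using j by (simp add: g_def sum_distrib_left)
  qed (simp add: Zm_def g_def)
  define w where "w = sqrt s \<cdot>\<^sub>v g + A *\<^sub>v \<delta>"
  have w: "w \<in> carrier_vec q" unfolding w_def using g A \<delta>c by auto
  have rw: "rr.w r \<gamma> e = \<sigma> \<cdot>\<^sub>v w"
  proof -
    have "L *\<^sub>v (R *\<^sub>v \<gamma> - r) = \<sigma> \<cdot>\<^sub>v \<delta>"
      unfolding \<delta> using \<sigma> L R r \<gamma> by (intro eq_vecI) auto
    hence "A *\<^sub>v (L *\<^sub>v (R *\<^sub>v \<gamma> - r)) = \<sigma> \<cdot>\<^sub>v (A *\<^sub>v \<delta>)"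
      using mult_mat_vec[OF A \<delta>c] by simp
    moreover have "(Zm a)\<^sup>T *\<^sub>v (Qm a *\<^sub>v e) = \<sigma> \<cdot>\<^sub>v (sqrt s \<cdot>\<^sub>v g)"
    proof -
      have "Qm a *\<^sub>v e = \<sigma> \<cdot>\<^sub>v (Qm a *\<^sub>v epsv a)" unfolding e_def by (rule mult_mat_vec[OF c(3) e0])
      moreover have "(Zm a)\<^sup>T *\<^sub>v (\<sigma> \<cdot>\<^sub>v (Qm a *\<^sub>v epsv a)) = \<sigma> \<cdot>\<^sub>v ((Zm a)\<^sup>T *\<^sub>v (Qm a *\<^sub>v epsv a))"
        using c e0 by (intro mult_mat_vec[of _ q n]) auto
      ultimately show ?thesis by (simp add: ZQe)
    qed
    ultimately show ?thesis
      unfolding rr.w_def[OF r \<gamma> e refl] rrA rrQ rrZ w_def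
      using g A \<delta>c by (intro eq_vecI) (auto simp: algebra_simps)
  qed
  define N where "N = w \<bullet> (inv_mat A *\<^sub>v w)"
  have iA: "inv_mat A \<in> carrier_mat q q" by (rule inv_mat_carrier[OF A invA])
  have N: "rr.w r \<gamma> e \<bullet> (inv_mat rr.A *\<^sub>v rr.w r \<gamma> e) = \<sigma>\<^sup>2 * N"
    unfolding rw rrA N_def using w iA by (simp add: mult_mat_vec[OF iA w] power2_eq_square)
  have Napprox: "\<bar>N - gsq a\<bar> \<le> (4 * real q + 5) * \<eta> * (1 + gsq a)"
    using perturbed_quadratic_form[OF A_near AT q(1) g \<delta>c less_imp_le[OF s0] s small]
    by (simp add: N_def w_def gg)
  \<comment> \<open>The last clause of \<open>good\<close> is conditional on this determinant.
    Invertibility of \<open>V'V\<close> and of \<open>A\<close> now discharges the condition, so the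
    residual sum of squares is under control.\<close>
  have invG: "invertible_mat ((Um a)\<^sup>T * Um a)" using rr.inv_G by (simp add: rr.G_def)
  have detG: "det ((Um a)\<^sup>T * Um a) \<noteq> 0"
    using invG invertible_mat_iff_det[OF gram_mat_carrier[OF U]] by simp
  define d where "d = epsv a \<bullet> (resid_mat n (Um a) *\<^sub>v epsv a) / m'"
  have "\<bar>epsv a \<bullet> (resid_mat n (Um a) *\<^sub>v epsv a) - m'\<bar> \<le> \<eta> * m'"
    using good detG adj_resid_eq[OF U invG] by (simp add: good_def)
  moreover have "epsv a \<bullet> (resid_mat n (Um a) *\<^sub>v epsv a) - m' = (d - 1) * m'"
    using mpos by (simp add: d_def field_simps)
  ultimately have "\<bar>d - 1\<bar> * m' \<le> \<eta> * m'" using mpos by (simp add: abs_mult)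
  hence d1: "\<bar>d - 1\<bar> \<le> \<eta>" using mpos by (meson mult_le_cancel_right_pos)
  hence d0: "0 < d" using \<eta>1 by linarith
  have M: "resid_mat n (Um a) \<in> carrier_mat n n" by (rule resid_mat_carrier[OF U invG])
  have eMe: "e \<bullet> (resid_mat n (Um a) *\<^sub>v e) = \<sigma>\<^sup>2 * (d * m')"
    unfolding e_def d_def using M e0 mpos by (simp add: mult_mat_vec[OF M e0] power2_eq_square)
  have "F_statistic n p q R r (Um a) Y = ((\<sigma>\<^sup>2 * N) / real q) / ((\<sigma>\<^sup>2 * (d * m')) / (real n - real p - 1))"
    using rr.F_statistic_eq[OF r \<gamma> e, of Y p] Y \<sigma> d0 mpos unfolding N eMe by (simp add: e_def)
  also have "\<dots> = (N / real q) / d"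
  proof -
    have m'_eq: "real n - real p - 1 = m'" by simp
    have "(\<sigma>\<^sup>2 * (d * m')) / (real n - real p - 1) = \<sigma>\<^sup>2 * d" unfolding m'_eq using mpos(2) by simp
    thus ?thesis using \<sigma> by simp
  qed
  finally show ?thesis using Napprox d1 by blast
qed

end

end

text \<open>The bound \<open>K\<close> on \<open>G\<close> makes the error a fixed multiple of
  \<eta>. Here \<open>c\<close> stands for the scaling of the statistic with limit
  \<open>c0\<close>, and \<open>t\<close> for its centring term; \<open>\<eta> \<le> 1 / 2\<close>
  keeps the denominator \<open>d\<close> above 1/2, which costs a factor 2.\<close>

lemma centred_statistic_close:
  fixes N d G c c0 t \<eta> K :: real and q :: nat
  assumes q: "1 \<le> q" and \<eta>: "0 < \<eta>" "\<eta> \<le> 1 / 2" and G: "0 \<le> G" "G \<le> K"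
    and N: "\<bar>N - G\<bar> \<le> (4 * real q + 5) * \<eta> * (1 + G)" and d: "\<bar>d - 1\<bar> \<le> \<eta>"
    and c: "\<bar>c - c0\<bar> \<le> \<eta>" and t: "\<bar>t\<bar> \<le> \<eta>" and c0: "0 \<le> c0"
  shows "\<bar>(c * ((N / real q) / d - 1) - t) - c0 * (G / real q - 1)\<bar>
    \<le> ((c0 + 1) * (2 * (4 * real q + 5) * (1 + K) + 2 * K) + K + 2) * \<eta>"
proof -
  have d0: "1 / 2 \<le> d" using d \<eta> by linarith
  define F where "F = (N / real q) / d"
  have q1: "1 \<le> real q" using q by simp
  have FG: "\<bar>F - G / real q\<bar> \<le> (2 * (4 * real q + 5) * (1 + K) + 2 * K) * \<eta>"
  proof -
    have "F * (real q * d) = N" using q1 d0 by (simp add: F_def)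
    moreover have "G / real q * (real q * d) = G * d" using q1 by simp
    ultimately have "(F - G / real q) * (real q * d) = (N - G) + G * (1 - d)"
      by (simp add: left_diff_distrib right_diff_distrib)
    hence eq: "\<bar>F - G / real q\<bar> * (real q * d) = \<bar>(N - G) + G * (1 - d)\<bar>"
      using q1 d0 by (metis abs_mult abs_of_nonneg mult_nonneg_nonneg of_nat_0_le_iff order_trans zero_le_divide_1_iff zero_le_numeral)
    have "1 * (1 / 2) \<le> real q * d" using q1 d0 by (intro mult_mono) auto
    hence "\<bar>F - G / real q\<bar> * (1 / 2) \<le> \<bar>F - G / real q\<bar> * (real q * d)" by (intro mult_left_mono) auto
    hence "\<bar>F - G / real q\<bar> \<le> 2 * \<bar>(N - G) + G * (1 - d)\<bar>" unfolding eq by simp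
    also have "\<dots> \<le> 2 * ((4 * real q + 5) * \<eta> * (1 + K) + K * \<eta>)"
    proof -
      have "\<bar>G * (1 - d)\<bar> \<le> K * \<eta>" using G d \<eta> unfolding abs_mult by (intro mult_mono) auto
      moreover have "(4 * real q + 5) * \<eta> * (1 + G) \<le> (4 * real q + 5) * \<eta> * (1 + K)"
        using \<eta> G by (intro mult_left_mono) auto
      ultimately have "\<bar>(N - G) + G * (1 - d)\<bar> \<le> (4 * real q + 5) * \<eta> * (1 + K) + K * \<eta>"
        by (intro order_trans[OF abs_triangle_ineq add_mono] order_trans[OF N])
      thus ?thesis by simp
    qed
    finally show ?thesis by (simp add: algebra_simps)
  qed
  define H where "H = 2 * (4 * real q + 5) * (1 + K) + 2 * K"
  have H: "0 \<le> H" using G by (simp add: H_def)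
  \<comment> \<open>Inserting \<open>c * (h - 1)\<close> separates the error of the statistic, that
    of the scaling and the centring term.\<close>
  have split: "\<bar>(c * (F - 1) - t) - c0 * (h - 1)\<bar> \<le> \<bar>c * (F - h)\<bar> + \<bar>(c - c0) * (h - 1)\<bar> + \<bar>t\<bar>" for h
  proof -
    have "(c * (F - 1) - t) - c0 * (h - 1) = c * (F - h) + (c - c0) * (h - 1) - t"
      by (simp add: algebra_simps)
    moreover have "\<bar>x + y - t\<bar> \<le> \<bar>x\<bar> + \<bar>y\<bar> + \<bar>t\<bar>" for x y :: real by linarith
    ultimately show ?thesis by simp
  qed
  note split[of "G / real q"]
  also have "\<bar>c * (F - G / real q)\<bar> \<le> (c0 + 1) * (H * \<eta>)"
    using c c0 \<eta> FG unfolding abs_mult H_def[symmetric] by (intro mult_mono) auto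
  also have "\<bar>(c - c0) * (G / real q - 1)\<bar> \<le> \<eta> * (K + 1)"
  proof -
    have "G / real q \<le> G / 1" using G q1 by (intro divide_left_mono) auto
    moreover have "0 \<le> G / real q" using G by simp
    ultimately have "\<bar>G / real q - 1\<bar> \<le> K + 1" using G by linarith
    thus ?thesis using c \<eta> unfolding abs_mult by (intro mult_mono) auto
  qed
  also note t
  finally show ?thesis unfolding F_def[symmetric] H_def[symmetric] by (simp add: algebra_simps)
qed

section \<open>The second moment matrix of the regressors\<close>

lemma S_mat_carrier: "\<mu> \<in> carrier_vec p \<Longrightarrow> \<Sigma> \<in> carrier_mat p p \<Longrightarrow> S_mat p \<mu> \<Sigma> \<in> carrier_mat (p + 1) (p + 1)"
  unfolding S_mat_def by (auto intro!: four_block_carrier_mat simp: add.commute[of p])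

text \<open>The block matrix is a rank one matrix plus a remainder: the outer product of
  \<open>(1, \<mu>)\<close> with itself, plus \<Sigma> bordered by a zero row and a zero
  column.\<close>

lemma S_mat_entry:
  assumes "\<mu> \<in> carrier_vec p" "\<Sigma> \<in> carrier_mat p p" "i < p + 1" "j < p + 1"
  shows "S_mat p \<mu> \<Sigma> $$ (i, j) =
    (if i = 0 then 1 else \<mu> $ (i - 1)) * (if j = 0 then 1 else \<mu> $ (j - 1))
    + (if i = 0 \<or> j = 0 then 0 else \<Sigma> $$ (i - 1, j - 1))"
proof -
  have c: "mat_of_rows p [\<mu>] \<in> carrier_mat 1 p" "mat_of_cols p [\<mu>] \<in> carrier_mat p 1" by auto
  show ?thesis
    unfolding S_mat_def using assms c
    by (cases "i = 0"; cases "j = 0")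
      (auto simp: mat_of_rows_def mat_of_cols_def scalar_prod_def)
qed

text \<open>The mixed second moment of two linear functions of \<open>(1, x)\<close> is the product
  of their means plus their covariance, and the covariance sees the slope coefficients only.\<close>

lemma scalar_prod_S_mat:
  assumes \<mu>: "\<mu> \<in> carrier_vec p" and \<Sigma>: "\<Sigma> \<in> carrier_mat p p"
    and u: "u \<in> carrier_vec (p + 1)" and v: "v \<in> carrier_vec (p + 1)"
  shows "u \<bullet> (S_mat p \<mu> \<Sigma> *\<^sub>v v) =
    (u $ 0 + (\<Sum>l<p. \<mu> $ l * u $ Suc l)) * (v $ 0 + (\<Sum>l<p. \<mu> $ l * v $ Suc l))
    + (\<Sum>l<p. \<Sum>l'<p. u $ Suc l * \<Sigma> $$ (l, l') * v $ Suc l')"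
proof -
  define m where "m i = (if i = 0 then 1 else \<mu> $ (i - 1))" for i :: nat
  define t where "t i j = (if i = 0 \<or> j = 0 then 0 else \<Sigma> $$ (i - 1, j - 1))" for i j :: nat
  have S: "S_mat p \<mu> \<Sigma> \<in> carrier_mat (p + 1) (p + 1)" by (rule S_mat_carrier[OF \<mu> \<Sigma>])
  have "u \<bullet> (S_mat p \<mu> \<Sigma> *\<^sub>v v) = (\<Sum>i<Suc p. \<Sum>j<Suc p. u $ i * (S_mat p \<mu> \<Sigma> $$ (i, j) * v $ j))"
    using S u v by (simp add: scalar_prod_sum sum_distrib_left del: sum.lessThan_Suc)
  also have "\<dots> = (\<Sum>i<Suc p. \<Sum>j<Suc p. (u $ i * m i) * (v $ j * m j) + u $ i * t i j * v $ j)"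
    by (intro sum.cong refl) (simp add: S_mat_entry[OF \<mu> \<Sigma>] m_def t_def algebra_simps)
  also have "\<dots> = (\<Sum>i<Suc p. u $ i * m i) * (\<Sum>j<Suc p. v $ j * m j) + (\<Sum>i<Suc p. \<Sum>j<Suc p. u $ i * t i j * v $ j)"
    by (simp only: sum.distrib sum_product)
  also have "(\<Sum>i<Suc p. \<Sum>j<Suc p. u $ i * t i j * v $ j) = (\<Sum>l<p. \<Sum>l'<p. u $ Suc l * \<Sigma> $$ (l, l') * v $ Suc l')"
    unfolding sum.lessThan_Suc_shift by (simp add: t_def)
  also have "(\<Sum>i<Suc p. u $ i * m i) = u $ 0 + (\<Sum>l<p. \<mu> $ l * u $ Suc l)"
    unfolding sum.lessThan_Suc_shift by (simp add: m_def mult.commute)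
  also have "(\<Sum>i<Suc p. v $ i * m i) = v $ 0 + (\<Sum>l<p. \<mu> $ l * v $ Suc l)"
    unfolding sum.lessThan_Suc_shift by (simp add: m_def mult.commute)
  finally show ?thesis .
qed

lemma S_mat_pos_definite:
  assumes \<mu>: "\<mu> \<in> carrier_vec p" and \<Sigma>: "pos_definite p \<Sigma>"
  shows "pos_definite (p + 1) (S_mat p \<mu> \<Sigma>)"
  unfolding pos_definite_def
proof (intro conjI ballI impI)
  have \<Sigma>c: "\<Sigma> \<in> carrier_mat p p" and \<Sigma>T: "\<Sigma>\<^sup>T = \<Sigma>" using \<Sigma> by (auto simp: pos_definite_def)
  show S: "S_mat p \<mu> \<Sigma> \<in> carrier_mat (p + 1) (p + 1)" by (rule S_mat_carrier[OF \<mu> \<Sigma>c])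
  show "(S_mat p \<mu> \<Sigma>)\<^sup>T = S_mat p \<mu> \<Sigma>"
  proof (rule eq_matI)
    fix i j assume "i < dim_row (S_mat p \<mu> \<Sigma>)" "j < dim_col (S_mat p \<mu> \<Sigma>)"
    hence ij: "i < p + 1" "j < p + 1" using S by auto
    have "\<Sigma> $$ (i - 1, j - 1) = \<Sigma> $$ (j - 1, i - 1)" if "0 < i" "0 < j"
    proof -
      have "i - 1 < p" "j - 1 < p" using ij that by auto
      thus ?thesis using arg_cong[OF \<Sigma>T, of "\<lambda>A. A $$ (i - 1, j - 1)"] \<Sigma>c by simp
    qed
    thus "(S_mat p \<mu> \<Sigma>)\<^sup>T $$ (i, j) = S_mat p \<mu> \<Sigma> $$ (i, j)"
      using ij S by (simp add: S_mat_entry[OF \<mu> \<Sigma>c])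
  qed (use S in auto)
  fix v :: "real vec" assume v: "v \<in> carrier_vec (p + 1)" "v \<noteq> 0\<^sub>v (p + 1)"
  define v' where "v' = vec p (\<lambda>l. v $ Suc l)"
  have v': "v' \<in> carrier_vec p" by (simp add: v'_def)
  have eq: "v \<bullet> (S_mat p \<mu> \<Sigma> *\<^sub>v v) = (v $ 0 + (\<Sum>l<p. \<mu> $ l * v $ Suc l))\<^sup>2 + v' \<bullet> (\<Sigma> *\<^sub>v v')"
  proof -
    have "v' \<bullet> (\<Sigma> *\<^sub>v v') = (\<Sum>l<p. \<Sum>l'<p. v $ Suc l * \<Sigma> $$ (l, l') * v $ Suc l')"
      using \<Sigma>c by (simp add: v'_def scalar_prod_sum sum_distrib_left mult.assoc)
    thus ?thesis by (simp add: scalar_prod_S_mat[OF \<mu> \<Sigma>c v(1) v(1)] power2_eq_square)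
  qed
  show "0 < v \<bullet> (S_mat p \<mu> \<Sigma> *\<^sub>v v)"
  proof (cases "v' = 0\<^sub>v p")
    case False
    hence "0 < v' \<bullet> (\<Sigma> *\<^sub>v v')" using \<Sigma> v' by (simp add: pos_definite_def)
    thus ?thesis unfolding eq by (intro add_nonneg_pos) auto
  next
    case True
    have z: "v $ Suc l = 0" if "l < p" for l
      using arg_cong[OF True, of "\<lambda>w. w $ l"] that by (simp add: v'_def)
    have "v $ 0 \<noteq> 0"
    proof
      assume "v $ 0 = 0"
      hence "v = 0\<^sub>v (p + 1)" using v(1) z by (intro eq_vecI) (auto simp: less_Suc_eq_0_disj)
      thus False using v by simp
    qed
    moreover have "v' \<bullet> (\<Sigma> *\<^sub>v v') = 0" unfolding True using \<Sigma>c by simp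
    ultimately show ?thesis unfolding eq using z by simp
  qed
qed

text \<open>With \<open>u\<close> the inverse of \<open>S\<close> applied to \<open>R'v\<close>, the
  form at \<open>v\<close> equals \<open>u'Su\<close>. Orthonormal rows make the transpose of
  \<open>R\<close> injective, so \<open>u\<close> is nonzero for nonzero \<open>v\<close>.\<close>

lemma restricted_inverse_pos_definite:
  assumes S: "pos_definite m S" and R: "R \<in> carrier_mat q m" and o: "R * R\<^sup>T = 1\<^sub>m q"
  shows "pos_definite q (R * inv_mat S * R\<^sup>T)"
  unfolding pos_definite_def
proof (intro conjI ballI impI)
  have Sc: "S \<in> carrier_mat m m" and ST: "S\<^sup>T = S" using S by (auto simp: pos_definite_def)
  note inv = pos_definite_invertible[OF S]
  note i = inv_mat_carrier[OF Sc inv] inv_mat_right[OF Sc inv] inv_mat_left[OF Sc inv] inv_mat_symmetric[OF Sc inv ST]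
  have d: "dim_row R = q" "dim_col R = m" "dim_row S = m" "dim_col S = m" "dim_row (inv_mat S) = m" "dim_col (inv_mat S) = m"
    using R Sc i by auto
  show "R * inv_mat S * R\<^sup>T \<in> carrier_mat q q" using R i by auto
  show "(R * inv_mat S * R\<^sup>T)\<^sup>T = R * inv_mat S * R\<^sup>T"
    using d by (simp add: transpose_mult_dim i assoc_mult_mat_dim)
  fix v :: "real vec" assume v: "v \<in> carrier_vec q" "v \<noteq> 0\<^sub>v q"
  define u where "u = inv_mat S *\<^sub>v (R\<^sup>T *\<^sub>v v)"
  have u: "u \<in> carrier_vec m" using i R v by (auto simp: u_def)
  have Su: "S *\<^sub>v u = R\<^sup>T *\<^sub>v v"
  proof -
    have "S *\<^sub>v u = (S * inv_mat S) *\<^sub>v (R\<^sup>T *\<^sub>v v)" unfolding u_def using d v by (simp add: assoc_mult_mat_vec_dim)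
    thus ?thesis using R v i by simp
  qed
  have "u \<noteq> 0\<^sub>v m"
  proof
    assume "u = 0\<^sub>v m"
    hence "R\<^sup>T *\<^sub>v v = 0\<^sub>v m" using Su Sc by (simp add: mult_mat_zero_vec_dim)
    hence "R * R\<^sup>T *\<^sub>v v = 0\<^sub>v q" using d v by (simp add: assoc_mult_mat_vec_dim mult_mat_zero_vec_dim)
    thus False using v by (simp add: o)
  qed
  hence "0 < u \<bullet> (S *\<^sub>v u)" using S u by (simp add: pos_definite_def)
  also have "\<dots> = u \<bullet> (R\<^sup>T *\<^sub>v v)" by (simp add: Su)
  also have "\<dots> = (R *\<^sub>v u) \<bullet> v" using scalar_prod_mult_mat_vec[of u "R\<^sup>T" v] u v R by simp
  also have "\<dots> = v \<bullet> (R *\<^sub>v u)" using R u v by (intro scalar_prod_comm_dim) auto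
  also have "R *\<^sub>v u = R * inv_mat S * R\<^sup>T *\<^sub>v v" unfolding u_def using d v by (simp add: assoc_mult_mat_vec_dim)
  finally show "0 < v \<bullet> (R * inv_mat S * R\<^sup>T *\<^sub>v v)" .
qed

lemma mult_col_entry:
  assumes "X \<in> carrier_mat m k" "S \<in> carrier_mat m m" "Y \<in> carrier_mat m l" "i < k" "j < l"
  shows "(X\<^sup>T * S * Y) $$ (i, j) = col X i \<bullet> (S *\<^sub>v col Y j)"
  using assms by (simp add: assoc_mult_mat_dim mult_mat_vec_def)

text \<open>Extending the empty orthonormal system, a matrix with no columns, to a full one
  \<open>D\<close> gives \<open>D'WD = 1\<close>; its transpose is the factor sought.\<close>

lemma ex_whitening:
  assumes "pos_definite q W"
  shows "\<exists>L\<in>carrier_mat q q. L * W * L\<^sup>T = (1\<^sub>m q :: real mat)"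
proof -
  have W: "W \<in> carrier_mat q q" using assms by (simp add: pos_definite_def)
  have "(0\<^sub>m q 0)\<^sup>T * W * 0\<^sub>m q 0 = (1\<^sub>m 0 :: real mat)" using W by (intro eq_matI) auto
  from orthonormal_columns_extend[OF assms _ this]
  obtain D where "D \<in> carrier_mat q q" "D\<^sup>T * W * D = 1\<^sub>m q" by auto
  thus ?thesis by (intro bexI[of _ "D\<^sup>T"]) auto
qed

text \<open>A basis that is orthonormal for the second moment matrix \<open>S\<close> of the regressors
  \<open>(1, x)\<close>. Its first \<open>q\<close> members are \<open>S\<^sup>-\<^sup>1 R\<^sup>T L\<^sup>T\<close>, so all others lie in the kernel of \<open>R\<close>; the next
  one is the intercept direction, which is admissible because \<open>R\<close> does not involve the
  intercept; \<open>S\<close>-orthogonality to it centres the remaining regressors.\<close>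

lemma adapted_basis:
  assumes rm: "restriction_mat q (p + 1) R" and R0: "col R 0 = 0\<^sub>v q"
    and \<mu>: "\<mu> \<in> carrier_vec p" and \<Sigma>: "pos_definite p \<Sigma>"
  defines "S \<equiv> S_mat p \<mu> \<Sigma>" and "k \<equiv> p + 1 - q"
  obtains D2 D1 E2 E1 B L H where
    "q \<le> p" "D2 \<in> carrier_mat (p + 1) q" "D1 \<in> carrier_mat (p + 1) k"
    "E2 \<in> carrier_mat q (p + 1)" "E1 \<in> carrier_mat k (p + 1)"
    "D2 * E2 + D1 * E1 = 1\<^sub>m (p + 1)"
    "E2 * D2 = 1\<^sub>m q" "E2 * D1 = 0\<^sub>m q k" "E1 * D2 = 0\<^sub>m k q" "E1 * D1 = 1\<^sub>m k"
    "B \<in> carrier_mat q q" "L \<in> carrier_mat q q" "B * L = 1\<^sub>m q"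
    "R * D2 = B" "R * D1 = 0\<^sub>m q k"
    "inv_mat (R * inv_mat S * R\<^sup>T) = L\<^sup>T * L"
    "H \<in> carrier_mat p p" "H\<^sup>T * \<Sigma> * H = 1\<^sub>m p"
    "\<And>i. i < p + 1 \<Longrightarrow> D1 $$ (i, 0) = of_bool (i = 0)"
    "\<And>j. j < q \<Longrightarrow> D2 $$ (0, j) = - (\<Sum>l<p. \<mu> $ l * H $$ (l, j))"
    "\<And>l j. l < p \<Longrightarrow> j < q \<Longrightarrow> D2 $$ (Suc l, j) = H $$ (l, j)"
    "\<And>j. 0 < j \<Longrightarrow> j < k \<Longrightarrow> D1 $$ (0, j) = - (\<Sum>l<p. \<mu> $ l * H $$ (l, q - 1 + j))"
    "\<And>l j. l < p \<Longrightarrow> 0 < j \<Longrightarrow> j < k \<Longrightarrow> D1 $$ (Suc l, j) = H $$ (l, q - 1 + j)"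
proof -
  have R: "R \<in> carrier_mat q (p + 1)" and RR: "R * R\<^sup>T = 1\<^sub>m q" and q1: "1 \<le> q"
    using rm by (auto simp: restriction_mat_def)
  have \<Sigma>c: "\<Sigma> \<in> carrier_mat p p" using \<Sigma> by (simp add: pos_definite_def)
  have S: "pos_definite (p + 1) S" unfolding S_def by (rule S_mat_pos_definite[OF \<mu> \<Sigma>])
  have Sc: "S \<in> carrier_mat (p + 1) (p + 1)" and ST: "S\<^sup>T = S" using S by (auto simp: pos_definite_def)
  note inv = pos_definite_invertible[OF S]
  note i = inv_mat_carrier[OF Sc inv] inv_mat_right[OF Sc inv] inv_mat_left[OF Sc inv] inv_mat_symmetric[OF Sc inv ST]
  define W where "W = R * inv_mat S * R\<^sup>T"
  have Wp: "pos_definite q W" unfolding W_def by (rule restricted_inverse_pos_definite[OF S R RR])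
  have W: "W \<in> carrier_mat q q" using Wp by (auto simp: pos_definite_def)
  obtain L where L: "L \<in> carrier_mat q q" and LWL: "L * W * L\<^sup>T = 1\<^sub>m q" using ex_whitening[OF Wp] by blast
  define B where "B = W * L\<^sup>T"
  have d: "dim_row R = q" "dim_col R = p + 1" "dim_row S = p + 1" "dim_col S = p + 1"
    "dim_row (inv_mat S) = p + 1" "dim_col (inv_mat S) = p + 1" "dim_row L = q" "dim_col L = q"
    "dim_row W = q" "dim_col W = q"
    using R Sc i L W by auto
  have B: "B \<in> carrier_mat q q" using W L by (auto simp: B_def)
  have LB: "L * B = 1\<^sub>m q" unfolding B_def using LWL d by (simp add: assoc_mult_mat_dim)
  have BL: "B * L = 1\<^sub>m q" by (rule mat_mult_left_right_inverse[OF L B LB])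
  have iW: "inv_mat W = L\<^sup>T * L"
  proof (rule inv_mat_unique[OF W])
    show "L\<^sup>T * L \<in> carrier_mat q q" using L by auto
    show "W * (L\<^sup>T * L) = 1\<^sub>m q" using BL d unfolding B_def by (simp add: assoc_mult_mat_dim)
  qed
  define H0 where "H0 = inv_mat S * (R\<^sup>T * L\<^sup>T)"
  have H0: "H0 \<in> carrier_mat (p + 1) q" unfolding H0_def using i R L by auto
  have SH0: "S * H0 = R\<^sup>T * L\<^sup>T"
  proof -
    have "S * H0 = (S * inv_mat S) * (R\<^sup>T * L\<^sup>T)" unfolding H0_def using d by (simp add: assoc_mult_mat_dim)
    thus ?thesis using d by (simp add: i one_mult_mat_dim)
  qed
  have H0S: "H0\<^sup>T * S = L * R"
    using arg_cong[OF SH0, of transpose_mat] d H0 by (simp add: transpose_mult_dim ST)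
  have H0SH0: "H0\<^sup>T * S * H0 = 1\<^sub>m q"
  proof -
    have "H0\<^sup>T * S * H0 = L * R * H0" by (simp only: H0S)
    also have "\<dots> = L * (R * inv_mat S * R\<^sup>T) * L\<^sup>T" unfolding H0_def using d by (simp add: assoc_mult_mat_dim)
    finally have "H0\<^sup>T * S * H0 = L * (R * inv_mat S * R\<^sup>T) * L\<^sup>T" .
    thus ?thesis using LWL by (simp add: W_def)
  qed
  \<comment> \<open>The coefficient vector of the constant regressor 1. It has unit
    \<open>S\<close>-length because the top left entry of \<open>S\<close> is 1.\<close>
  define e0 :: "real vec" where "e0 = unit_vec (p + 1) 0"
  have e0: "e0 \<in> carrier_vec (p + 1)" by (simp add: e0_def)
  have Re0: "R *\<^sub>v e0 = 0\<^sub>v q"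
  proof (rule eq_vecI)
    fix i assume "i < dim_vec (0\<^sub>v q :: real vec)"
    hence i: "i < q" by simp
    have "R $$ (i, 0) = col R 0 $ i" using i R by simp
    also have "\<dots> = 0" unfolding R0 using i by simp
    finally show "(R *\<^sub>v e0) $ i = 0\<^sub>v q $ i" using i R by (simp add: e0_def)
  qed (use R in simp)
  \<comment> \<open>The \<open>S\<close>-product with \<open>e0\<close> is the mean of the linear
    function of \<open>(1, x)\<close> with coefficients \<open>v\<close>; orthogonality to
    \<open>e0\<close> therefore means mean zero.\<close>
  have e0S: "v \<bullet> (S *\<^sub>v e0) = v $ 0 + (\<Sum>l<p. \<mu> $ l * v $ Suc l)" if "v \<in> carrier_vec (p + 1)" for v
    unfolding S_def using that by (subst scalar_prod_S_mat[OF \<mu> \<Sigma>c]) (auto simp: e0_def unit_vec_def)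
  define H1 where "H1 = mat (p + 1) (q + 1) (\<lambda>(i, j). if j < q then H0 $$ (i, j) else e0 $ i)"
  have H1: "H1 \<in> carrier_mat (p + 1) (q + 1)" by (simp add: H1_def)
  have H1a: "col H1 j = col H0 j" if "j < q" for j using that H0 by (auto simp: H1_def)
  have H1b: "col H1 q = e0" using e0 by (auto simp: H1_def)
  \<comment> \<open>Here the zero first column of \<open>R\<close> is used:
    \<open>H0'S = L R\<close>, and \<open>R\<close> annihilates \<open>e0\<close>.\<close>
  have h0e0: "col H0 j \<bullet> (S *\<^sub>v e0) = 0" if "j < q" for j
  proof -
    have "col H0 j \<bullet> (S *\<^sub>v e0) = (H0\<^sup>T *\<^sub>v (S *\<^sub>v e0)) $ j" using that H0 by simp
    also have "H0\<^sup>T *\<^sub>v (S *\<^sub>v e0) = H0\<^sup>T * S *\<^sub>v e0" using H0 d e0 by (simp add: assoc_mult_mat_vec_dim)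
    also have "\<dots> = L *\<^sub>v (R *\<^sub>v e0)" unfolding H0S using d e0 by (simp add: assoc_mult_mat_vec_dim)
    also have "\<dots> = 0\<^sub>v q" unfolding Re0 using d by (simp add: mult_mat_zero_vec_dim)
    finally show ?thesis using that by simp
  qed
  have Ssym: "u \<bullet> (S *\<^sub>v v) = v \<bullet> (S *\<^sub>v u)" if "u \<in> carrier_vec (p + 1)" "v \<in> carrier_vec (p + 1)" for u v
  proof -
    have "u \<bullet> (S *\<^sub>v v) = (S *\<^sub>v u) \<bullet> v" using scalar_prod_mult_mat_vec[of u S v] that d ST by simp
    also have "\<dots> = v \<bullet> (S *\<^sub>v u)" using that d by (intro scalar_prod_comm_dim) auto
    finally show ?thesis .
  qed
  have H1SH1: "H1\<^sup>T * S * H1 = 1\<^sub>m (q + 1)"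
  proof (rule eq_matI)
    fix i j assume "i < dim_row (1\<^sub>m (q + 1) :: real mat)" "j < dim_col (1\<^sub>m (q + 1) :: real mat)"
    hence ij: "i < q + 1" "j < q + 1" by auto
    have ent: "(H1\<^sup>T * S * H1) $$ (i, j) = col H1 i \<bullet> (S *\<^sub>v col H1 j)"
      by (rule mult_col_entry[OF H1 Sc H1 ij])
    from ij consider "i < q" "j < q" | "i < q" "j = q" | "i = q" "j < q" | "i = q" "j = q" by fastforce
    thus "(H1\<^sup>T * S * H1) $$ (i, j) = 1\<^sub>m (q + 1) $$ (i, j)"
    proof cases
      case 1
      have "(H0\<^sup>T * S * H0) $$ (i, j) = col H0 i \<bullet> (S *\<^sub>v col H0 j)"
        by (rule mult_col_entry[OF H0 Sc H0 1])
      thus ?thesis using 1 by (simp add: ent H1a H0SH0)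
    next
      case 2
      thus ?thesis unfolding ent by (simp add: H1a H1b h0e0)
    next
      case 3
      have "e0 \<bullet> (S *\<^sub>v col H0 j) = col H0 j \<bullet> (S *\<^sub>v e0)" using H0 3 e0 by (intro Ssym) auto
      thus ?thesis using 3 unfolding ent by (simp add: H1a H1b h0e0)
    next
      case 4
      have "e0 \<bullet> (S *\<^sub>v e0) = 1" using e0S[OF e0] by (simp add: e0_def unit_vec_def)
      thus ?thesis using 4 unfolding ent by (simp add: H1b)
    qed
  qed (use H1 in auto)
  \<comment> \<open>\<open>H1\<close> has \<open>q + 1\<close> orthonormal columns in dimension
    \<open>p + 1\<close>. A restriction without the intercept thus leaves one direction
    free.\<close>
  have qp: "q \<le> p" using orthonormal_columns_le[OF Sc H1 H1SH1] by simp
  obtain D where D: "D \<in> carrier_mat (p + 1) (p + 1)" and DSD: "D\<^sup>T * S * D = 1\<^sub>m (p + 1)"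
    and Dcol: "\<And>j. j < q + 1 \<Longrightarrow> col D j = col H1 j"
    using orthonormal_columns_extend[OF S H1 H1SH1] by blast
  \<comment> \<open>Orthonormality of \<open>D\<close> for \<open>S\<close> makes this its inverse;
    splitting \<open>D\<close> by columns and \<open>E\<close> by rows gives the four
    blocks.\<close>
  define E where "E = D\<^sup>T * S"
  have E: "E \<in> carrier_mat (p + 1) (p + 1)" using D Sc by (auto simp: E_def)
  have ED: "E * D = 1\<^sub>m (p + 1)" using DSD by (simp add: E_def)
  have DE: "D * E = 1\<^sub>m (p + 1)" by (rule mat_mult_left_right_inverse[OF E D ED])
  have inner: "col D i \<bullet> (S *\<^sub>v col D j) = of_bool (i = j)" if "i < p + 1" "j < p + 1" for i j
    using mult_col_entry[OF D Sc D that, symmetric] that by (simp add: DSD)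
  have qk: "q + k = p + 1" using qp by (simp add: k_def)
  define D2 where "D2 = mat (p + 1) q (\<lambda>(i, j). D $$ (i, j))"
  define D1 where "D1 = mat (p + 1) k (\<lambda>(i, j). D $$ (i, q + j))"
  define E2 where "E2 = mat q (p + 1) (\<lambda>(i, j). E $$ (i, j))"
  define E1 where "E1 = mat k (p + 1) (\<lambda>(i, j). E $$ (q + i, j))"
  have DE_split: "D2 * E2 + D1 * E1 = 1\<^sub>m (p + 1)"
  proof (rule eq_matI)
    fix i j assume "i < dim_row (1\<^sub>m (p + 1) :: real mat)" "j < dim_col (1\<^sub>m (p + 1) :: real mat)"
    hence ij: "i < p + 1" "j < p + 1" by auto
    have "(D * E) $$ (i, j) = (\<Sum>c<q + k. D $$ (i, c) * E $$ (c, j))"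
      using ij D E by (simp add: scalar_prod_sum qk)
    also have "\<dots> = (\<Sum>c<q. D $$ (i, c) * E $$ (c, j)) + (\<Sum>c<k. D $$ (i, q + c) * E $$ (q + c, j))"
      by (rule sum_upto_append)
    also have "\<dots> = (D2 * E2 + D1 * E1) $$ (i, j)"
      using ij by (simp add: D2_def E2_def D1_def E1_def scalar_prod_sum)
    finally show "(D2 * E2 + D1 * E1) $$ (i, j) = 1\<^sub>m (p + 1) $$ (i, j)" by (simp add: DE)
  qed (auto simp: D2_def E2_def D1_def E1_def)
  have ED_ent: "(\<Sum>c<p + 1. E $$ (i, c) * D $$ (c, j)) = of_bool (i = j)" if "i < p + 1" "j < p + 1" for i j
    using arg_cong[OF ED, of "\<lambda>A. A $$ (i, j)"] that D E by (simp add: scalar_prod_sum)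
  have E2D2: "E2 * D2 = 1\<^sub>m q"
    by (rule eq_matI) (use ED_ent qk in \<open>auto simp: E2_def D2_def scalar_prod_sum simp del: sum.lessThan_Suc\<close>)
  have E2D1: "E2 * D1 = 0\<^sub>m q k"
    by (rule eq_matI) (use ED_ent qk in \<open>auto simp: E2_def D1_def scalar_prod_sum simp del: sum.lessThan_Suc\<close>)
  have E1D2: "E1 * D2 = 0\<^sub>m k q"
    by (rule eq_matI) (use ED_ent qk in \<open>auto simp: E1_def D2_def scalar_prod_sum simp del: sum.lessThan_Suc\<close>)
  have E1D1: "E1 * D1 = 1\<^sub>m k"
    by (rule eq_matI) (use ED_ent qk in \<open>auto simp: E1_def D1_def scalar_prod_sum simp del: sum.lessThan_Suc\<close>)
  have D2_eq: "D2 = H0"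
  proof (rule eq_matI)
    fix i j assume "i < dim_row H0" "j < dim_col H0"
    hence ij: "i < p + 1" "j < q" using H0 by auto
    have "col D j = col H0 j" using ij Dcol[of j] H1a[of j] by simp
    from arg_cong[OF this, of "\<lambda>v. v $ i"] show "D2 $$ (i, j) = H0 $$ (i, j)"
      using ij D H0 qk by (simp add: D2_def)
  qed (use H0 in \<open>auto simp: D2_def\<close>)
  have RD2: "R * D2 = B"
    unfolding D2_eq H0_def B_def W_def using d by (simp add: assoc_mult_mat_dim)
  have D1c: "D1 \<in> carrier_mat (p + 1) k" by (simp add: D1_def)
  have LRD1: "L * (R * D1) = 0\<^sub>m q k"
  proof -
    have "L * (R * D1) = H0\<^sup>T * S * D1" unfolding H0S using d D1c by (simp add: assoc_mult_mat_dim)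
    also have "\<dots> = 0\<^sub>m q k"
    proof (rule eq_matI)
      fix i j assume "i < dim_row (0\<^sub>m q k :: real mat)" "j < dim_col (0\<^sub>m q k :: real mat)"
      hence ij: "i < q" "j < k" by auto
      have "col D1 j = col D (q + j)" using ij D qk by (auto simp: D1_def)
      moreover have "col H0 i = col D i" using ij Dcol[of i] H1a[of i] by simp
      ultimately show "(H0\<^sup>T * S * D1) $$ (i, j) = 0\<^sub>m q k $$ (i, j)"
        using mult_col_entry[OF H0 Sc D1c ij] inner[of i "q + j"] ij qk by simp
    qed (use H0 D1c in auto)
    finally show ?thesis .
  qed
  have RD1: "R * D1 = 0\<^sub>m q k"
  proof -
    have "R * D1 = (B * L) * (R * D1)" unfolding BL using d D1c by (simp add: one_mult_mat_dim)
    also have "\<dots> = B * (L * (R * D1))" using d B D1c by (intro assoc_mult_mat_dim) auto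
    also have "\<dots> = 0\<^sub>m q k" unfolding LRD1 using B by auto
    finally show ?thesis .
  qed
  \<comment> \<open>Enumerates the \<open>p\<close> basis members other than number
    \<open>q\<close>, the intercept direction; \<open>H\<close> keeps their slope
    coefficients.\<close>
  define cc where "cc j = (if j < q then j else Suc j)" for j
  define H where "H = mat p p (\<lambda>(l, j). D $$ (Suc l, cc j))"
  have H: "H \<in> carrier_mat p p" by (simp add: H_def)
  have cc: "cc j < p + 1" "cc j \<noteq> q" if "j < p" for j using that by (auto simp: cc_def)
  have Dq: "col D q = e0" using Dcol[of q] H1b by simp
  have centred: "D $$ (0, j) = - (\<Sum>l<p. \<mu> $ l * D $$ (Suc l, j))" if "j < p + 1" "j \<noteq> q" for j
  proof -
    have "col D j \<bullet> (S *\<^sub>v e0) = 0" using inner[of j q] that qp by (simp add: Dq)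
    moreover have "col D j \<in> carrier_vec (p + 1)" using that D by auto
    ultimately have "col D j $ 0 + (\<Sum>l<p. \<mu> $ l * col D j $ Suc l) = 0" using e0S by simp
    thus ?thesis using that D by simp
  qed
  have col_dim_D: "col D j \<in> carrier_vec (p + 1)" if "j < p + 1" for j
    using that D by (metis carrier_matD(1) carrier_vec_dim_vec dim_col)
  have HSH: "H\<^sup>T * \<Sigma> * H = 1\<^sub>m p"
  proof (rule eq_matI)
    fix i j assume "i < dim_row (1\<^sub>m p :: real mat)" "j < dim_col (1\<^sub>m p :: real mat)"
    hence ij: "i < p" "j < p" by auto
    have c: "col D (cc i) \<in> carrier_vec (p + 1)" "col D (cc j) \<in> carrier_vec (p + 1)" 
      by (rule col_dim_D[OF cc(1)[OF ij(1)]], rule col_dim_D[OF cc(1)[OF ij(2)]])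
    have "(H\<^sup>T * \<Sigma> * H) $$ (i, j) = (\<Sum>l<p. \<Sum>l'<p. H $$ (l, i) * \<Sigma> $$ (l, l') * H $$ (l', j))"
      using mult_col_entry[OF H \<Sigma>c H ij] ij H \<Sigma>c by (simp add: scalar_prod_sum sum_distrib_left mult.assoc)
    also have "\<dots> = (\<Sum>l<p. \<Sum>l'<p. col D (cc i) $ Suc l * \<Sigma> $$ (l, l') * col D (cc j) $ Suc l')"
      using ij D cc by (intro sum.cong refl) (simp add: H_def)
    \<comment> \<open>Both vectors are centred, so the product of means in the second moment
      vanishes and the \<open>S\<close>-product reduces to the one for \<Sigma>.\<close>
    also have "\<dots> = col D (cc i) \<bullet> (S *\<^sub>v col D (cc j))"
      unfolding S_def scalar_prod_S_mat[OF \<mu> \<Sigma>c c]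
      using centred[OF cc[OF ij(1)]] cc[OF ij(1)] D by simp
    also have "\<dots> = of_bool (i = j)" using inner[of "cc i" "cc j"] cc ij by (auto simp: cc_def)
    finally show "(H\<^sup>T * \<Sigma> * H) $$ (i, j) = 1\<^sub>m p $$ (i, j)" using ij by simp
  qed (use H in auto)
  show thesis
  proof (rule that[of D2 D1 E2 E1 B L H])
    fix i assume "i < p + 1"
    thus "D1 $$ (i, 0) = of_bool (i = 0)"
      using arg_cong[OF Dq, of "\<lambda>v. v $ i"] D qk qp by (simp add: D1_def e0_def unit_vec_def k_def)
  next
    fix j assume j: "j < q"
    have "D2 $$ (0, j) = D $$ (0, j)" using j by (simp add: D2_def)
    also have "\<dots> = - (\<Sum>l<p. \<mu> $ l * D $$ (Suc l, j))" using j qp by (intro centred) auto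
    also have "(\<Sum>l<p. \<mu> $ l * D $$ (Suc l, j)) = (\<Sum>l<p. \<mu> $ l * H $$ (l, j))"
      using j qp by (intro sum.cong refl) (simp add: H_def cc_def)
    finally show "D2 $$ (0, j) = - (\<Sum>l<p. \<mu> $ l * H $$ (l, j))" .
  next
    fix l j assume "l < p" "j < q"
    thus "D2 $$ (Suc l, j) = H $$ (l, j)" using qp by (simp add: D2_def H_def cc_def)
  next
    fix j assume j: "0 < j" "j < k"
    \<comment> \<open>Column \<open>j > 0\<close> of \<open>D1\<close> is column
      \<open>q + j\<close> of \<open>D\<close>, but column \<open>q - 1 + j\<close> of
      \<open>H\<close>, because the intercept direction was removed.\<close>
    hence j': "q - 1 + j < p" "\<not> q - 1 + j < q" "Suc (q - 1 + j) = q + j" using q1 qk by auto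
    have "D1 $$ (0, j) = D $$ (0, q + j)" using j by (simp add: D1_def)
    also have "\<dots> = - (\<Sum>l<p. \<mu> $ l * D $$ (Suc l, q + j))" using j qk by (intro centred) auto
    also have "(\<Sum>l<p. \<mu> $ l * D $$ (Suc l, q + j)) = (\<Sum>l<p. \<mu> $ l * H $$ (l, q - 1 + j))"
      using j' by (intro sum.cong refl) (simp add: H_def cc_def)
    finally show "D1 $$ (0, j) = - (\<Sum>l<p. \<mu> $ l * H $$ (l, q - 1 + j))" .
  next
    fix l j assume j: "l < p" "0 < j" "j < k"
    hence j': "q - 1 + j < p" "\<not> q - 1 + j < q" "Suc (q - 1 + j) = q + j" using q1 qk by auto
    show "D1 $$ (Suc l, j) = H $$ (l, q - 1 + j)" using j j' by (simp add: D1_def H_def cc_def)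
  qed (use qp DE_split E2D2 E2D1 E1D2 E1D1 B L BL RD2 RD1 iW H HSH in
      \<open>auto simp: D2_def D1_def E2_def E1_def W_def\<close>)
qed

section \<open>The Gaussian linear model\<close>

locale gaussian_linear_model =
  fixes M :: "'a measure" and n p :: nat and y :: "nat \<Rightarrow> 'a \<Rightarrow> real" and x :: "nat \<Rightarrow> 'a \<Rightarrow> nat \<Rightarrow> real"
    and \<alpha> :: real and \<beta> :: "real vec" and \<sigma> :: real
  assumes model: "linear_model M n p y x \<alpha> \<beta> \<sigma>"
    and gauss: "\<And>i. i < n \<Longrightarrow> gaussian M p (x i) (mean_vec M p (x 0)) (cov_mat M p (x 0))"
    and indep_design: "design_indep_errors M n p y x"

sublocale gaussian_linear_model \<subseteq> prob_space M
  using model by (simp add: linear_model_def)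

context gaussian_linear_model
begin

abbreviation "\<mu> \<equiv> mean_vec M p (x 0)"
abbreviation "\<Sigma> \<equiv> cov_mat M p (x 0)"

text \<open>An explicit function of the pair \<open>(y i, x i)\<close>, to which equality of laws
  and independence of pairs apply directly; \<open>model_error\<close> contains a version of a
  conditional expectation and agrees with it only almost surely.\<close>

definition "err i \<omega> = y i \<omega> - \<alpha> - \<beta> \<bullet> vec p (x i \<omega>)"

lemma dims: "0 < p" "p + 1 < n" "\<beta> \<in> carrier_vec p" "0 < \<sigma>" "0 < n"
  using model unfolding linear_model_def by auto

lemma \<mu>: "\<mu> \<in> carrier_vec p" and \<Sigma>: "pos_definite p \<Sigma>"
  using gauss[of 0] dims by (auto simp: gaussian_def)

section \<open>Consequences of identical distribution\<close>

lemma pairs: "indep_vars (\<lambda>_. borel \<Otimes>\<^sub>M Rn p) (\<lambda>i \<omega>. (y i \<omega>, x i \<omega>)) {..<n}"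
  and pair_law: "\<And>i. i < n \<Longrightarrow> distr M (borel \<Otimes>\<^sub>M Rn p) (\<lambda>\<omega>. (y i \<omega>, x i \<omega>)) = distr M (borel \<Otimes>\<^sub>M Rn p) (\<lambda>\<omega>. (y 0 \<omega>, x 0 \<omega>))"
  using model unfolding linear_model_def iid_def by blast+

lemma pair_measurable: "i < n \<Longrightarrow> (\<lambda>\<omega>. (y i \<omega>, x i \<omega>)) \<in> measurable M (borel \<Otimes>\<^sub>M Rn p)"
  using pairs unfolding indep_vars_def by blast

lemma x_measurable: "i < n \<Longrightarrow> x i \<in> measurable M (Rn p)"
  using measurable_compose[OF pair_measurable measurable_snd, of i] by simp

lemma y_measurable: "i < n \<Longrightarrow> y i \<in> borel_measurable M"
  using measurable_compose[OF pair_measurable measurable_fst, of i] by simp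

lemma linear_measurable: "(\<lambda>z. \<alpha> + \<beta> \<bullet> vec p z) \<in> borel_measurable (Rn p)"
  by (simp add: scalar_prod_sum)

lemma err_fun_measurable: "(\<lambda>v. fst v - \<alpha> - \<beta> \<bullet> vec p (snd v)) \<in> borel_measurable (borel \<Otimes>\<^sub>M Rn p)"
proof -
  have "(\<lambda>v. snd v j) \<in> borel_measurable (borel \<Otimes>\<^sub>M Rn p)" if "j < p" for j
    using that by (intro measurable_compose[OF measurable_snd measurable_component_singleton[of j, where M = "\<lambda>_. lborel", simplified]]) auto
  thus ?thesis by (simp add: scalar_prod_sum)
qed

lemma err_measurable: "i < n \<Longrightarrow> err i \<in> borel_measurable M"
  using measurable_compose[OF pair_measurable err_fun_measurable, of i] by (simp add: err_def[abs_def])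

text \<open>Conditional mean, variance and fourth moment are prescribed for observation 0; equality
  of the laws of the pairs carries them to every \<open>i\<close>.\<close>

lemma transfer_integral:
  assumes i: "i < n" and g: "g \<in> borel_measurable (borel \<Otimes>\<^sub>M Rn p)"
  shows "(\<integral>\<omega>. g (y i \<omega>, x i \<omega>) \<partial>M) = (\<integral>\<omega>. g (y 0 \<omega>, x 0 \<omega>) \<partial>M :: real)"
    and "integrable M (\<lambda>\<omega>. g (y i \<omega>, x i \<omega>)) \<longleftrightarrow> integrable M (\<lambda>\<omega>. g (y 0 \<omega>, x 0 \<omega>))"
  using integral_distr[OF pair_measurable[OF i] g] integral_distr[OF pair_measurable[OF dims(5)] g]
    integrable_distr_eq[OF pair_measurable[OF i] g] integrable_distr_eq[OF pair_measurable[OF dims(5)] g]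
    pair_law[OF i] by auto

abbreviation "design_algebra i \<equiv> vimage_algebra (space M) (x i) (Rn p)"

lemma design_subalgebra: "i < n \<Longrightarrow> finite_measure_subalgebra M (design_algebra i)"
proof (unfold_locales, unfold subalgebra_def, intro conjI)
  assume i: "i < n"
  show "sets (design_algebra i) \<subseteq> sets M"
    using x_measurable[OF i] measurable_space[OF x_measurable[OF i]]
    by (subst sets_vimage_algebra2) (auto intro: measurable_sets)
qed simp

lemma cond_mean_eq:
  assumes i: "i < n"
  shows "AE \<omega> in M. cond_mean M p (y i) (x i) \<omega> = \<alpha> + \<beta> \<bullet> vec p (x i \<omega>)"
proof -
  interpret S0: finite_measure_subalgebra M "design_algebra 0" by (rule design_subalgebra) (rule dims)
  interpret Si: finite_measure_subalgebra M "design_algebra i" by (rule design_subalgebra[OF i])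
  define l where "l z = \<alpha> + \<beta> \<bullet> vec p z" for z
  have lm [measurable]: "l \<in> borel_measurable (Rn p)" using linear_measurable by (simp add: l_def[abs_def])
  have y0: "integrable M (y 0)" and c0: "AE \<omega> in M. cond_mean M p (y 0) (x 0) \<omega> = l (x 0 \<omega>)"
    using model unfolding linear_model_def l_def by blast+
  have lx [measurable]: "(\<lambda>\<omega>. l (x i \<omega>)) \<in> borel_measurable M" if "i < n" for i
    by (rule measurable_compose[OF x_measurable[OF that] lm])
  have l0: "integrable M (\<lambda>\<omega>. l (x 0 \<omega>))"
    using S0.real_cond_exp_int(1)[OF y0] c0 lx[OF dims(5)] unfolding cond_mean_def
    by (subst integrable_cong_AE[symmetric]) auto
  have yi: "integrable M (y i)" using transfer_integral(2)[OF i measurable_fst] y0 by simp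
  have lsnd: "(\<lambda>v. l (snd v)) \<in> borel_measurable (borel \<Otimes>\<^sub>M Rn p)"
    by (rule measurable_compose[OF measurable_snd lm])
  have li: "integrable M (\<lambda>\<omega>. l (x i \<omega>))" using transfer_integral(2)[OF i lsnd] l0 by simp
  have "AE \<omega> in M. real_cond_exp M (design_algebra i) (y i) \<omega> = l (x i \<omega>)"
  proof (rule Si.real_cond_exp_charact[OF _ yi li])
    have "x i \<in> measurable (design_algebra i) (Rn p)"
      using measurable_space[OF x_measurable[OF i]] by (intro measurable_vimage_algebra1) auto
    thus "(\<lambda>\<omega>. l (x i \<omega>)) \<in> borel_measurable (design_algebra i)" by (rule measurable_compose[OF _ lm])
    fix A assume "A \<in> sets (design_algebra i)"
    then obtain B where B: "B \<in> sets (Rn p)" "A = x i -` B \<inter> space M"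
      using measurable_space[OF x_measurable[OF i]] by (subst (asm) sets_vimage_algebra2) auto
    define A0 where "A0 = x 0 -` B \<inter> space M"
    have A0: "A0 \<in> sets (design_algebra 0)" unfolding A0_def by (rule in_vimage_algebra[OF B(1)])
    have iB: "(\<lambda>v. indicator B (snd v) :: real) \<in> borel_measurable (borel \<Otimes>\<^sub>M Rn p)"
      using B(1) by (intro measurable_compose[OF measurable_snd]) simp
    have "(\<integral>\<omega>\<in>A. y i \<omega> \<partial>M) = (\<integral>\<omega>. indicator B (x i \<omega>) * y i \<omega> \<partial>M)"
      unfolding set_lebesgue_integral_def B(2) by (intro Bochner_Integration.integral_cong) (auto simp: indicator_def)
    also have "\<dots> = (\<integral>\<omega>. indicator B (x 0 \<omega>) * y 0 \<omega> \<partial>M)"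
      using transfer_integral(1)[OF i borel_measurable_times[OF iB measurable_fst]] by simp
    also have "\<dots> = (\<integral>\<omega>\<in>A0. y 0 \<omega> \<partial>M)"
      unfolding set_lebesgue_integral_def A0_def by (intro Bochner_Integration.integral_cong) (auto simp: indicator_def)
    also have "\<dots> = (\<integral>\<omega>\<in>A0. real_cond_exp M (design_algebra 0) (y 0) \<omega> \<partial>M)"
      by (rule S0.real_cond_exp_intA[OF y0 A0])
    also have "\<dots> = (\<integral>\<omega>. indicator B (x 0 \<omega>) * l (x 0 \<omega>) \<partial>M)"
      unfolding set_lebesgue_integral_def
    proof (rule integral_cong_AE)
      have A0M: "A0 \<in> sets M" using A0 S0.subalg by (auto simp: subalgebra_def)
      thus "(\<lambda>\<omega>. indicat_real A0 \<omega> *\<^sub>R real_cond_exp M (design_algebra 0) (y 0) \<omega>) \<in> borel_measurable M"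
        by measurable
      show "(\<lambda>\<omega>. indicator B (x 0 \<omega>) * l (x 0 \<omega>)) \<in> borel_measurable M"
        using B(1) x_measurable[OF dims(5)] lx[OF dims(5)]
        by (intro borel_measurable_times measurable_compose[OF x_measurable[OF dims(5)]]) auto
      show "AE \<omega> in M. indicat_real A0 \<omega> *\<^sub>R real_cond_exp M (design_algebra 0) (y 0) \<omega> = indicator B (x 0 \<omega>) * l (x 0 \<omega>)"
        using c0 AE_space by eventually_elim (auto simp: cond_mean_def A0_def indicator_def)
    qed
    also have "\<dots> = (\<integral>\<omega>. indicator B (x i \<omega>) * l (x i \<omega>) \<partial>M)"
      using transfer_integral(1)[OF i borel_measurable_times[OF iB lsnd]] by simp
    also have "\<dots> = (\<integral>\<omega>\<in>A. l (x i \<omega>) \<partial>M)"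
      unfolding set_lebesgue_integral_def B(2) by (intro Bochner_Integration.integral_cong) (auto simp: indicator_def)
    finally show "(\<integral>\<omega>\<in>A. y i \<omega> \<partial>M) = (\<integral>\<omega>\<in>A. l (x i \<omega>) \<partial>M)" .
  qed
  thus ?thesis by (simp add: cond_mean_def l_def)
qed

lemma model_error_eq:
  assumes "i < n"
  shows "AE \<omega> in M. model_error M p (y i) (x i) \<omega> = err i \<omega>"
  using cond_mean_eq[OF assms] by eventually_elim (simp add: model_error_def err_def)

lemma model_error_measurable: "i < n \<Longrightarrow> model_error M p (y i) (x i) \<in> borel_measurable M"
  using y_measurable unfolding model_error_def[abs_def] cond_mean_def by auto

lemma err_mean: "expectation (err 0) = 0"
proof -
  interpret S0: finite_measure_subalgebra M "design_algebra 0" by (rule design_subalgebra) (rule dims)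
  have y0: "integrable M (y 0)" using model unfolding linear_model_def by blast
  have "expectation (err 0) = (\<integral>\<omega>. model_error M p (y 0) (x 0) \<omega> \<partial>M)"
    using model_error_eq[OF dims(5)] err_measurable[OF dims(5)] model_error_measurable[OF dims(5)]
    by (intro integral_cong_AE) auto
  also have "\<dots> = 0"
    using S0.real_cond_exp_int[OF y0] y0 by (simp add: model_error_def cond_mean_def)
  finally show ?thesis .
qed

lemma err_variance: "expectation (\<lambda>\<omega>. (err 0 \<omega>)\<^sup>2) = \<sigma>\<^sup>2"
proof -
  interpret S0: finite_measure_subalgebra M "design_algebra 0" by (rule design_subalgebra) (rule dims)
  define f where "f \<omega> = (model_error M p (y 0) (x 0) \<omega>)\<^sup>2" for \<omega>
  have f: "integrable M f" and c: "AE \<omega> in M. real_cond_exp M (design_algebra 0) f \<omega> = \<sigma>\<^sup>2"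
    using model unfolding linear_model_def f_def[abs_def] cond_var_def cond_mean_def by blast+
  have "expectation (\<lambda>\<omega>. (err 0 \<omega>)\<^sup>2) = (\<integral>\<omega>. f \<omega> \<partial>M)"
    using model_error_eq[OF dims(5)] err_measurable[OF dims(5)] model_error_measurable[OF dims(5)]
    by (intro integral_cong_AE) (auto simp: f_def)
  also have "\<dots> = (\<integral>\<omega>. real_cond_exp M (design_algebra 0) f \<omega> \<partial>M)"
    using S0.real_cond_exp_int(2)[OF f] by simp
  also have "\<dots> = (\<integral>\<omega>. \<sigma>\<^sup>2 \<partial>M)" using c by (intro integral_cong_AE) auto
  finally show ?thesis by (simp add: prob_space)
qed

text \<open>Columns before \<open>p\<close> are the regressors whitened by \<open>H\<close>, and
  column \<open>p\<close> holds the standardised errors. The value 0 outside the sample makes each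
  entry measurable without a condition on its index.\<close>

definition warray :: "real mat \<Rightarrow> nat \<times> nat \<Rightarrow> 'a \<Rightarrow> real" where
  "warray H v \<omega> = (if fst v < n then
     if snd v < p then \<Sum>l<p. H $$ (l, snd v) * (x (fst v) \<omega> l - \<mu> $ l) else err (fst v) \<omega> / \<sigma>
     else 0)"

section \<open>The whitened array of regressors and errors\<close>

context
  fixes H :: "real mat"
  assumes H: "H \<in> carrier_mat p p" and HSH: "H\<^sup>T * \<Sigma> * H = 1\<^sub>m p"
begin

lemma x_entry_measurable: "i < n \<Longrightarrow> l < p \<Longrightarrow> (\<lambda>\<omega>. x i \<omega> l) \<in> borel_measurable M"
  using measurable_compose[OF x_measurable[of i] measurable_component_singleton[of l "{..<p}" "\<lambda>_. lborel"]] by simp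

lemma warray_measurable: "warray H v \<in> borel_measurable M"
proof (cases "fst v < n")
  case True
  show ?thesis
  proof (cases "snd v < p")
    case False
    thus ?thesis using True err_measurable by (auto simp: warray_def[abs_def])
  next
    case sp: True
    have "(\<lambda>\<omega>. \<Sum>l<p. H $$ (l, snd v) * (x (fst v) \<omega> l - \<mu> $ l)) \<in> borel_measurable M"
      using x_entry_measurable[OF True]
      by (intro borel_measurable_sum borel_measurable_times borel_measurable_diff) auto
    thus ?thesis using True sp by (simp add: warray_def[abs_def])
  qed
qed (simp add: warray_def[abs_def])

text \<open>The inverse of \<Sigma> is \<open>H H'\<close>, so the exponent of the Gaussian density
  is the squared length of \<open>H'(z - \<mu>)\<close>, the form required for a standard normal
  image.\<close>

lemma row_law:
  assumes i: "i < n"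
  shows "distr M (Rn p) (\<lambda>\<omega>. mat_fun p (H\<^sup>T) (\<lambda>l\<in>{..<p}. x i \<omega> l - \<mu> $ l)) = PiM {..<p} (\<lambda>_. std_normal)"
proof -
  have \<Sigma>c: "\<Sigma> \<in> carrier_mat p p" using \<Sigma> by (simp add: pos_definite_def)
  have HT: "H\<^sup>T \<in> carrier_mat p p" using H by simp
  have S: "\<Sigma> * H \<in> carrier_mat p p" using \<Sigma>c H by auto
  have TS: "H\<^sup>T * (\<Sigma> * H) = 1\<^sub>m p" using HSH H \<Sigma>c by (simp add: assoc_mult_mat_dim)
  have "\<Sigma> * H * H\<^sup>T = 1\<^sub>m p" by (rule mat_mult_left_right_inverse[OF HT S TS])
  hence iS: "inv_mat \<Sigma> = H * H\<^sup>T"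
    using H \<Sigma>c by (intro inv_mat_unique[OF \<Sigma>c]) (auto simp: assoc_mult_mat_dim)
  \<comment> \<open>Multiplicativity turns this into
    \<open>(det H)\<^sup>2 * det \<Sigma> = 1\<close>, whence the determinant under the root of the
    density is positive.\<close>
  have "det (H\<^sup>T * (\<Sigma> * H)) = 1" by (simp add: TS)
  hence "det H * (det \<Sigma> * det H) = 1"
    using det_mult[OF HT S] det_mult[OF \<Sigma>c H] det_transpose[OF H] by simp
  hence "(det H)\<^sup>2 * det \<Sigma> = 1" by (simp add: power2_eq_square mult_ac)
  hence "0 < (det H)\<^sup>2 * det \<Sigma>" by simp
  hence "0 < det \<Sigma>" by (simp add: zero_less_mult_iff)
  hence C: "0 \<le> 1 / sqrt ((2 * pi) ^ p * det \<Sigma>)" by simp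
  have D: "distributed M (Rn p) (x i) (\<lambda>z. ennreal (gaussian_density p \<mu> \<Sigma> (vec p z)))"
    using gauss[OF i] by (simp add: gaussian_def)
  show ?thesis
  proof (rule linear_image_std_normal[OF prob_space_axioms D HT S TS _ C])
    fix z
    define w where "w = vec p z - \<mu>"
    have w: "w \<in> carrier_vec p" using \<mu> by (auto simp: w_def)
    have "w \<bullet> (inv_mat \<Sigma> *\<^sub>v w) = w \<bullet> (H *\<^sub>v (H\<^sup>T *\<^sub>v w))"
      unfolding iS using H w by (simp add: assoc_mult_mat_vec_dim)
    also have "\<dots> = (H\<^sup>T *\<^sub>v w) \<bullet> (H\<^sup>T *\<^sub>v w)" using H w by (intro scalar_prod_mult_mat_vec) auto
    also have "\<dots> = (\<Sum>i<p. (\<Sum>j<p. H\<^sup>T $$ (i, j) * (z j - \<mu> $ j))\<^sup>2)"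
      using H \<mu> by (simp add: scalar_prod_sum power2_eq_square w_def)
    finally show "gaussian_density p \<mu> \<Sigma> (vec p z) = 1 / sqrt ((2 * pi) ^ p * det \<Sigma>) *
        exp (- (\<Sum>i<p. (\<Sum>j<p. H\<^sup>T $$ (i, j) * (z j - \<mu> $ j))\<^sup>2) / 2)"
      by (simp add: gaussian_density_def w_def)
  qed
qed

lemma mat_fun_warray:
  "i < n \<Longrightarrow> j < p \<Longrightarrow> mat_fun p (H\<^sup>T) (\<lambda>l\<in>{..<p}. x i \<omega> l - \<mu> $ l) j = warray H (i, j) \<omega>"
  using H by (simp add: mat_fun_def warray_def)

lemma row_measurable: "i < n \<Longrightarrow> (\<lambda>\<omega>. mat_fun p (H\<^sup>T) (\<lambda>l\<in>{..<p}. x i \<omega> l - \<mu> $ l)) \<in> measurable M (Rn p)"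
  using x_entry_measurable by (intro measurable_compose[OF measurable_restrict mat_fun_measurable]) auto

lemma warray_law:
  assumes "i < n" "j < p"
  shows "distr M borel (warray H (i, j)) = std_normal"
proof -
  have "distr (PiM {..<p} (\<lambda>_. std_normal)) std_normal (\<lambda>z. z j) = std_normal"
    using assms by (intro distr_PiM_component prob_space_std_normal) auto
  also have "distr (PiM {..<p} (\<lambda>_. std_normal)) std_normal (\<lambda>z. z j) = distr (PiM {..<p} (\<lambda>_. std_normal)) borel (\<lambda>z. z j)"
    by (intro distr_cong) auto
  also have "\<dots> = distr (distr M (Rn p) (\<lambda>\<omega>. mat_fun p (H\<^sup>T) (\<lambda>l\<in>{..<p}. x i \<omega> l - \<mu> $ l))) borel (\<lambda>z. z j)"
    using row_law[OF assms(1)] by simp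
  also have "\<dots> = distr M borel ((\<lambda>z. z j) \<circ> (\<lambda>\<omega>. mat_fun p (H\<^sup>T) (\<lambda>l\<in>{..<p}. x i \<omega> l - \<mu> $ l)))"
    using assms row_measurable measurable_component_singleton[of j "{..<p}" "\<lambda>_. lborel"] by (intro distr_distr) auto
  also have "\<dots> = distr M borel (warray H (i, j))"
    using mat_fun_warray[OF assms] by (intro distr_cong) auto
  finally show ?thesis by simp
qed

lemma prob_row:
  assumes i: "i < n" and A: "\<And>j. j < p \<Longrightarrow> A j \<in> sets borel"
  shows "prob {\<omega> \<in> space M. \<forall>j<p. warray H (i, j) \<omega> \<in> A j} = (\<Prod>j<p. prob {\<omega> \<in> space M. warray H (i, j) \<omega> \<in> A j})"
proof -
  interpret N: product_prob_space "\<lambda>_::nat. std_normal"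
    by (rule product_prob_spaceI) (rule prob_space_std_normal)
  have "emeasure M {\<omega> \<in> space M. \<forall>j<p. warray H (i, j) \<omega> \<in> A j}
     = emeasure (distr M (Rn p) (\<lambda>\<omega>. mat_fun p (H\<^sup>T) (\<lambda>l\<in>{..<p}. x i \<omega> l - \<mu> $ l))) (Pi\<^sub>E {..<p} A)"
  proof (subst emeasure_distr[OF row_measurable[OF i]])
    show "Pi\<^sub>E {..<p} A \<in> sets (Rn p)" using A by (intro sets_PiM_I_finite) auto
    show "emeasure M {\<omega> \<in> space M. \<forall>j<p. warray H (i, j) \<omega> \<in> A j} =
      emeasure M ((\<lambda>\<omega>. mat_fun p (H\<^sup>T) (\<lambda>l\<in>{..<p}. x i \<omega> l - \<mu> $ l)) -` Pi\<^sub>E {..<p} A \<inter> space M)"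
    proof (rule arg_cong[where f = "emeasure M"], rule Set.set_eqI)
      fix \<omega>
      have "mat_fun p (H\<^sup>T) (\<lambda>l\<in>{..<p}. x i \<omega> l - \<mu> $ l) \<in> extensional {..<p}" by (simp add: mat_fun_def)
      thus "\<omega> \<in> {\<omega> \<in> space M. \<forall>j<p. warray H (i, j) \<omega> \<in> A j} \<longleftrightarrow>
        \<omega> \<in> (\<lambda>\<omega>. mat_fun p (H\<^sup>T) (\<lambda>l\<in>{..<p}. x i \<omega> l - \<mu> $ l)) -` Pi\<^sub>E {..<p} A \<inter> space M"
        using mat_fun_warray[OF i] by (simp add: PiE_iff conj_commute Ball_def)
    qed
  qed
  also have "\<dots> = (\<Prod>j<p. emeasure std_normal (A j))"
    unfolding row_law[OF i] using A by (intro N.emeasure_PiM) auto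
  also have "\<dots> = (\<Prod>j<p. emeasure M {\<omega> \<in> space M. warray H (i, j) \<omega> \<in> A j})"
  proof (intro prod.cong refl)
    fix j assume j: "j \<in> {..<p}"
    have "emeasure std_normal (A j) = emeasure (distr M borel (warray H (i, j))) (A j)"
      using warray_law[OF i] j by simp
    also have "\<dots> = emeasure M {\<omega> \<in> space M. warray H (i, j) \<omega> \<in> A j}"
      using A[of j] j warray_measurable
      by (subst emeasure_distr) (auto intro!: arg_cong[where f = "emeasure M"])
    finally show "emeasure std_normal (A j) = emeasure M {\<omega> \<in> space M. warray H (i, j) \<omega> \<in> A j}" .
  qed
  finally show ?thesis by (simp add: emeasure_eq_measure prod_ennreal prod_nonneg)
qed

text \<open>It suffices that probabilities of boxes factorise. Independence of design and errors
  separates the error column from the rest; independence of the pairs separates the observations,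
  once for the errors and once for the design; and the standard normal law of a whitened row
  separates its coordinates.\<close>

lemma indep_warray: "indep_vars (\<lambda>_. borel) (warray H) ({..<n} \<times> {..p})"
proof -
  define I where "I = {..<n} \<times> {..p}"
  have I: "finite I" "I \<noteq> {}" using dims by (auto simp: I_def)
  interpret P: product_prob_space "\<lambda>v. distr M borel (warray H v)"
    by (rule product_prob_spaceI) (rule prob_space_distr[OF warray_measurable])
  have "distr M (PiM I (\<lambda>_. borel)) (\<lambda>\<omega>. \<lambda>v\<in>I. warray H v \<omega>) = PiM I (\<lambda>v. distr M borel (warray H v))"
  proof (rule P.PiM_eqI[OF I(1)])
    show "sets (distr M (PiM I (\<lambda>_. borel)) (\<lambda>\<omega>. \<lambda>v\<in>I. warray H v \<omega>)) = sets (PiM I (\<lambda>v. distr M borel (warray H v)))"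
      unfolding sets_distr by (intro sets_PiM_cong) auto
    fix A assume A0: "\<And>v. v \<in> I \<Longrightarrow> A v \<in> sets (distr M borel (warray H v))"
    hence A: "A (i, j) \<in> sets borel" if "i < n" "j \<le> p" for i j using that by (auto simp: I_def)
    define EZ where "EZ = {\<omega> \<in> space M. \<forall>i\<in>{..<n}. \<forall>j\<in>{..<p}. warray H (i, j) \<omega> \<in> A (i, j)}"
    define EE where "EE = {\<omega> \<in> space M. \<forall>i\<in>{..<n}. warray H (i, p) \<omega> \<in> A (i, p)}"
    define EE' where "EE' = {\<omega> \<in> space M. \<forall>i\<in>{..<n}. model_error M p (y i) (x i) \<omega> / \<sigma> \<in> A (i, p)}"
    define pr where "pr v = prob {\<omega> \<in> space M. warray H v \<omega> \<in> A v}" for v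
    have ev1 [measurable]: "{\<omega> \<in> space M. warray H (i, j) \<omega> \<in> A (i, j)} \<in> events" if "i < n" "j \<le> p" for i j
      using measurable_sets[OF warray_measurable A[OF that]] by (simp add: vimage_def Int_def conj_commute)
    have ev2: "{\<omega> \<in> space M. model_error M p (y i) (x i) \<omega> / \<sigma> \<in> A (i, p)} \<in> events" if "i < n" for i
      using measurable_sets[OF borel_measurable_divide[OF model_error_measurable[OF that] borel_measurable_const] A[OF that order_refl], of \<sigma>]
      by (simp add: vimage_def Int_def conj_commute)
    have EZ: "EZ \<in> events"
      unfolding EZ_def by (intro sets.sets_Collect_finite_All ev1) auto
    have EE: "EE \<in> events"
      unfolding EE_def by (intro sets.sets_Collect_finite_All ev1) auto
    have EE': "EE' \<in> events"
      unfolding EE'_def by (intro sets.sets_Collect_finite_All ev2) auto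
    have AEe: "AE \<omega> in M. \<forall>i\<in>{..<n}. model_error M p (y i) (x i) \<omega> = err i \<omega>"
      using model_error_eq by (intro AE_finite_allI) auto
    have w_err: "warray H (i, p) \<omega> = err i \<omega> / \<sigma>" if "i < n" for i \<omega> using that by (simp add: warray_def)
    \<comment> \<open>The independence of design and errors concerns the sigma-algebra of
      \<open>model_error\<close>. Hence \<open>EE\<close> is exchanged for the almost surely equal
      \<open>EE'\<close>, and exchanged back after the product rule.\<close>
    have "prob (EZ \<inter> EE) = prob (EZ \<inter> EE')"
      using AEe EZ EE EE' by (intro finite_measure_eq_AE) (auto elim!: eventually_mono simp: EE_def EE'_def w_err)
    also have "\<dots> = prob EZ * prob EE'"
    proof (rule indep_setD[OF indep_design[unfolded design_indep_errors_def]])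
      have c: "(\<lambda>f. f i l) \<in> borel_measurable (PiM {..<n} (\<lambda>_. Rn p))" if "i < n" "l < p" for i l
        using measurable_compose[OF measurable_component_singleton[of i "{..<n}" "\<lambda>_. Rn p"] measurable_component_singleton[of l "{..<p}" "\<lambda>_. lborel"]] that
        by simp
      define B where "B = {f \<in> space (PiM {..<n} (\<lambda>_. Rn p)). \<forall>i\<in>{..<n}. \<forall>j\<in>{..<p}. (\<Sum>l<p. H $$ (l, j) * (f i l - \<mu> $ l)) \<in> A (i, j)}"
      have B: "B \<in> sets (PiM {..<n} (\<lambda>_. Rn p))"
        unfolding B_def
      proof (intro sets.sets_Collect_finite_All)
        fix i j assume ij: "i \<in> {..<n}" "j \<in> {..<p}"
        have "(\<lambda>f. \<Sum>l<p. H $$ (l, j) * (f i l - \<mu> $ l)) \<in> borel_measurable (PiM {..<n} (\<lambda>_. Rn p))"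
          using c ij by (intro borel_measurable_sum borel_measurable_times borel_measurable_diff) auto
        from measurable_sets[OF this A[of i j]] ij
        show "{f \<in> space (PiM {..<n} (\<lambda>_. Rn p)). (\<Sum>l<p. H $$ (l, j) * (f i l - \<mu> $ l)) \<in> A (i, j)} \<in> sets (PiM {..<n} (\<lambda>_. Rn p))"
          by (simp add: vimage_def Int_def conj_commute)
      qed auto
      have "EZ = (\<lambda>\<omega>. \<lambda>i\<in>{..<n}. x i \<omega>) -` B \<inter> space M"
      proof (rule Set.set_eqI)
        fix \<omega>
        have "\<omega> \<in> space M \<Longrightarrow> (\<lambda>i\<in>{..<n}. x i \<omega>) \<in> space (PiM {..<n} (\<lambda>_. Rn p))"
          using measurable_space[OF x_measurable] by (auto simp: space_PiM)
        thus "\<omega> \<in> EZ \<longleftrightarrow> \<omega> \<in> (\<lambda>\<omega>. \<lambda>i\<in>{..<n}. x i \<omega>) -` B \<inter> space M"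
          by (auto simp: EZ_def B_def warray_def)
      qed
      thus "EZ \<in> sets (vimage_algebra (space M) (\<lambda>\<omega>. \<lambda>i\<in>{..<n}. x i \<omega>) (PiM {..<n} (\<lambda>_. Rn p)))"
        using B by (auto intro: in_vimage_algebra)
      define C where "C = {f \<in> space (Rn n). \<forall>i\<in>{..<n}. f i / \<sigma> \<in> A (i, p)}"
      have C: "C \<in> sets (Rn n)"
        unfolding C_def
      proof (intro sets.sets_Collect_finite_All)
        fix i assume i: "i \<in> {..<n}"
        have "(\<lambda>f. f i / \<sigma>) \<in> borel_measurable (Rn n)"
          using measurable_component_singleton[of i "{..<n}" "\<lambda>_. lborel"] i by simp
        from measurable_sets[OF this A[of i p]] i
        show "{f \<in> space (Rn n). f i / \<sigma> \<in> A (i, p)} \<in> sets (Rn n)"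
          by (simp add: vimage_def Int_def conj_commute)
      qed (use dims in auto)
      have "EE' = (\<lambda>\<omega>. \<lambda>i\<in>{..<n}. model_error M p (y i) (x i) \<omega>) -` C \<inter> space M"
        by (rule Set.set_eqI) (auto simp: EE'_def C_def space_PiM)
      thus "EE' \<in> sets (vimage_algebra (space M) (\<lambda>\<omega>. \<lambda>i\<in>{..<n}. model_error M p (y i) (x i) \<omega>) (Rn n))"
        using C by (auto intro: in_vimage_algebra)
    qed
    also have "prob EE' = prob EE"
      using AEe EE EE' by (intro finite_measure_eq_AE) (auto elim!: eventually_mono simp: EE_def EE'_def w_err)
    also have "prob EE = (\<Prod>i<n. pr (i, p))"
    proof -
      have "indep_vars (\<lambda>_. borel) (\<lambda>i \<omega>. (\<lambda>v. (fst v - \<alpha> - \<beta> \<bullet> vec p (snd v)) / \<sigma>) (y i \<omega>, x i \<omega>)) {..<n}"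
        using borel_measurable_divide[OF err_fun_measurable borel_measurable_const, of \<sigma>]
        by (intro indep_vars_compose2[OF pairs]) auto
      moreover define K where "K i = (\<lambda>\<omega>. (\<lambda>v. (fst v - \<alpha> - \<beta> \<bullet> vec p (snd v)) / \<sigma>) (y i \<omega>, x i \<omega>)) -` A (i, p) \<inter> space M" for i
      ultimately have "prob (\<Inter>i\<in>{..<n}. K i) = (\<Prod>i<n. prob (K i))"
        unfolding K_def using A dims by (intro indep_varsD_finite) auto
      moreover have K: "K i = {\<omega> \<in> space M. warray H (i, p) \<omega> \<in> A (i, p)}" if "i < n" for i
        using that by (auto simp: K_def w_err err_def)
      moreover have "EE = (\<Inter>i\<in>{..<n}. K i)"
        using dims K by (auto simp: EE_def)
      ultimately show ?thesis by (simp add: pr_def)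
    qed
    also have "prob EZ = (\<Prod>i<n. \<Prod>j<p. pr (i, j))"
    proof -
      define Bi where "Bi i = {z \<in> space (Rn p). \<forall>j\<in>{..<p}. (\<Sum>l<p. H $$ (l, j) * (z l - \<mu> $ l)) \<in> A (i, j)}" for i
      have Bi: "Bi i \<in> sets (Rn p)" if "i < n" for i
        unfolding Bi_def
      proof (intro sets.sets_Collect_finite_All)
        fix j assume j: "j \<in> {..<p}"
        have "(\<lambda>z. z l) \<in> borel_measurable (Rn p)" if "l < p" for l
          using measurable_component_singleton[of l "{..<p}" "\<lambda>_. lborel"] that by simp
        hence "(\<lambda>z. \<Sum>l<p. H $$ (l, j) * (z l - \<mu> $ l)) \<in> borel_measurable (Rn p)"
          by (intro borel_measurable_sum borel_measurable_times borel_measurable_diff) auto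
        from measurable_sets[OF this A[of i j]] j \<open>i < n\<close>
        show "{z \<in> space (Rn p). (\<Sum>l<p. H $$ (l, j) * (z l - \<mu> $ l)) \<in> A (i, j)} \<in> sets (Rn p)"
          by (simp add: vimage_def Int_def conj_commute)
      qed (use dims in auto)
      have ev: "x i -` Bi i \<inter> space M = {\<omega> \<in> space M. \<forall>j<p. warray H (i, j) \<omega> \<in> A (i, j)}" if "i < n" for i
        using measurable_space[OF x_measurable[OF that]] that by (auto simp: Bi_def warray_def)
      have "indep_vars (\<lambda>_. Rn p) (\<lambda>i \<omega>. snd (y i \<omega>, x i \<omega>)) {..<n}"
        by (intro indep_vars_compose2[OF pairs]) auto
      hence "prob (\<Inter>i\<in>{..<n}. x i -` Bi i \<inter> space M) = (\<Prod>i<n. prob (x i -` Bi i \<inter> space M))"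
        using Bi dims by (intro indep_varsD_finite[where M' = "\<lambda>_. Rn p"]) auto
      also have "(\<Inter>i\<in>{..<n}. x i -` Bi i \<inter> space M) = EZ" using ev dims by (auto simp: EZ_def)
      also have "(\<Prod>i<n. prob (x i -` Bi i \<inter> space M)) = (\<Prod>i<n. \<Prod>j<p. pr (i, j))"
        using A by (intro prod.cong refl) (simp add: ev prob_row pr_def)
      finally show ?thesis .
    qed
    finally have "prob (EZ \<inter> EE) = (\<Prod>i<n. \<Prod>j<p. pr (i, j)) * (\<Prod>i<n. pr (i, p))" .
    hence fin: "prob (EZ \<inter> EE) = (\<Prod>v\<in>I. pr v)"
    proof -
      have "(\<Prod>v\<in>I. pr v) = (\<Prod>i<n. \<Prod>j\<in>{..p}. pr (i, j))"
        by (simp add: I_def prod.cartesian_product)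
      also have "\<dots> = (\<Prod>i<n. (\<Prod>j<p. pr (i, j)) * pr (i, p))"
        by (simp flip: lessThan_Suc_atMost)
      finally show ?thesis using \<open>prob (EZ \<inter> EE) = (\<Prod>i<n. \<Prod>j<p. pr (i, j)) * (\<Prod>i<n. pr (i, p))\<close>
        by (simp only: prod.distrib)
    qed
    have "emeasure (distr M (PiM I (\<lambda>_. borel)) (\<lambda>\<omega>. \<lambda>v\<in>I. warray H v \<omega>)) (Pi\<^sub>E I A)
       = emeasure M ((\<lambda>\<omega>. \<lambda>v\<in>I. warray H v \<omega>) -` (Pi\<^sub>E I A) \<inter> space M)"
      using A0 warray_measurable I by (intro emeasure_distr measurable_restrict sets_PiM_I_finite) auto
    also have "(\<lambda>\<omega>. \<lambda>v\<in>I. warray H v \<omega>) -` (Pi\<^sub>E I A) \<inter> space M = EZ \<inter> EE"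
      by (rule Set.set_eqI) (auto simp: EZ_def EE_def I_def PiE_iff le_less)
    also have "emeasure M (EZ \<inter> EE) = (\<Prod>v\<in>I. emeasure M {\<omega> \<in> space M. warray H v \<omega> \<in> A v})"
      by (simp add: emeasure_eq_measure fin pr_def prod_ennreal)
    also have "\<dots> = (\<Prod>v\<in>I. emeasure (distr M borel (warray H v)) (A v))"
      using A0 warray_measurable
      by (intro prod.cong refl) (subst emeasure_distr, auto intro!: arg_cong[where f = "emeasure M"])
    finally show "emeasure (distr M (PiM I (\<lambda>_. borel)) (\<lambda>\<omega>. \<lambda>v\<in>I. warray H v \<omega>)) (Pi\<^sub>E I A)
      = (\<Prod>v\<in>I. emeasure (distr M borel (warray H v)) (A v))" .
  qed
  thus ?thesis
    unfolding I_def[symmetric] using I warray_measurable by (subst indep_vars_iff_distr_eq_PiM') auto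
qed

lemma warray_err_moments:
  assumes i: "i < n"
    and int4: "integrable M (\<lambda>\<omega>. (model_error M p (y 0) (x 0) \<omega> / \<sigma>) ^ 4)"
    and m4: "(\<integral>\<omega>. (model_error M p (y 0) (x 0) \<omega> / \<sigma>) ^ 4 \<partial>M) \<le> \<kappa>"
  shows "integrable M (\<lambda>\<omega>. warray H (i, p) \<omega> ^ 4)" "expectation (warray H (i, p)) = 0"
    "expectation (\<lambda>\<omega>. (warray H (i, p) \<omega>)\<^sup>2) = 1" "expectation (\<lambda>\<omega>. warray H (i, p) \<omega> ^ 4) \<le> \<kappa>"
proof -
  define ef where "ef v = (fst v - \<alpha> - \<beta> \<bullet> vec p (snd v)) / \<sigma>" for v
  have ef [measurable]: "ef \<in> borel_measurable (borel \<Otimes>\<^sub>M Rn p)"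
    unfolding ef_def[abs_def] by (intro borel_measurable_divide err_fun_measurable borel_measurable_const)
  have w: "warray H (i, p) \<omega> = ef (y i \<omega>, x i \<omega>)" for \<omega> using i by (simp add: warray_def ef_def err_def)
  have w0: "ef (y 0 \<omega>, x 0 \<omega>) = err 0 \<omega> / \<sigma>" for \<omega> by (simp add: ef_def err_def)
  have tr: "(\<integral>\<omega>. warray H (i, p) \<omega> ^ k \<partial>M) = (\<integral>\<omega>. (err 0 \<omega> / \<sigma>) ^ k \<partial>M)"
    "integrable M (\<lambda>\<omega>. warray H (i, p) \<omega> ^ k) \<longleftrightarrow> integrable M (\<lambda>\<omega>. (err 0 \<omega> / \<sigma>) ^ k)" for k
    using transfer_integral[OF i, of "\<lambda>v. ef v ^ k"] by (simp_all add: w w0)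
  have em [measurable]: "err 0 \<in> borel_measurable M" "model_error M p (y 0) (x 0) \<in> borel_measurable M"
    using err_measurable model_error_measurable dims by auto
  have AE4: "AE \<omega> in M. (err 0 \<omega> / \<sigma>) ^ 4 = (model_error M p (y 0) (x 0) \<omega> / \<sigma>) ^ 4"
    using model_error_eq[OF dims(5)] by eventually_elim simp
  have "integrable M (\<lambda>\<omega>. (err 0 \<omega> / \<sigma>) ^ 4)"
    using int4 AE4 by (subst integrable_cong_AE) auto
  thus "integrable M (\<lambda>\<omega>. warray H (i, p) \<omega> ^ 4)" using tr(2) by simp
  have "(\<integral>\<omega>. (err 0 \<omega> / \<sigma>) ^ 4 \<partial>M) = (\<integral>\<omega>. (model_error M p (y 0) (x 0) \<omega> / \<sigma>) ^ 4 \<partial>M)"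
    using AE4 by (intro integral_cong_AE) auto
  thus "expectation (\<lambda>\<omega>. warray H (i, p) \<omega> ^ 4) \<le> \<kappa>" using tr(1)[of 4] m4 by simp
  show "expectation (warray H (i, p)) = 0" using tr(1)[of 1] err_mean by simp
  show "expectation (\<lambda>\<omega>. (warray H (i, p) \<omega>)\<^sup>2) = 1"
    using tr(1)[of 2] err_variance dims by (simp add: power_divide)
qed

end

text \<open>The order of quantifiers matters: one variable \<open>G\<close> is fixed before \<eta>,
  so the same chi-squared variable serves every accuracy. The exceptional event may depend on
  \<eta>.\<close>

lemma limit_variable:
  fixes q :: nat and R :: "real mat" and r :: "real vec" and \<kappa> :: real
  assumes rm: "restriction_mat q (p + 1) R" and R0: "col R 0 = 0\<^sub>v q" and r: "r \<in> carrier_vec q"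
    and \<kappa>: "3 \<le> \<kappa>"
    and int4: "integrable M (\<lambda>\<omega>. (model_error M p (y 0) (x 0) \<omega> / \<sigma>) ^ 4)"
    and m4: "(\<integral>\<omega>. (model_error M p (y 0) (x 0) \<omega> / \<sigma>) ^ 4 \<partial>M) \<le> \<kappa>"
  defines "\<Delta> \<equiv> Delta_gamma R r (S_mat p \<mu> \<Sigma>) (vCons \<alpha> \<beta>) \<sigma>"
  shows "0 \<le> \<Delta> \<and> q \<le> p \<and> (\<exists>G. G \<in> borel_measurable M \<and> distr M borel G = chi_squared q \<and> (\<forall>\<omega>. 0 \<le> G \<omega>) \<and>
    (\<forall>\<eta>. 0 < \<eta> \<and> real q * \<eta> \<le> 1 / 2 \<and> real n * \<Delta> \<le> \<eta>\<^sup>2 \<longrightarrow>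
      (\<exists>B\<in>events. prob B \<le> 4 * (\<kappa> + 2) * (real q + real q ^ 2 + 2) / (\<eta>\<^sup>2 * (real n - real (p + 1))) \<and>
        (\<forall>\<omega>\<in>space M - B. \<exists>N d. F_statistic n p q R r (design_mat n p x \<omega>) (response_vec n y \<omega>) = (N / real q) / d \<and>
          \<bar>N - G \<omega>\<bar> \<le> (4 * real q + 5) * \<eta> * (1 + G \<omega>) \<and> \<bar>d - 1\<bar> \<le> \<eta>))))"
proof -
  have R: "R \<in> carrier_mat q (p + 1)" and q1: "1 \<le> q" using rm by (auto simp: restriction_mat_def)
  obtain D2 D1 E2 E1 B L H where qp: "q \<le> p"
    and D2: "D2 \<in> carrier_mat (p + 1) q" and D1: "D1 \<in> carrier_mat (p + 1) (p + 1 - q)"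
    and E2: "E2 \<in> carrier_mat q (p + 1)" and E1: "E1 \<in> carrier_mat (p + 1 - q) (p + 1)"
    and DE: "D2 * E2 + D1 * E1 = 1\<^sub>m (p + 1)"
    and ED: "E2 * D2 = 1\<^sub>m q" "E2 * D1 = 0\<^sub>m q (p + 1 - q)" "E1 * D2 = 0\<^sub>m (p + 1 - q) q" "E1 * D1 = 1\<^sub>m (p + 1 - q)"
    and B: "B \<in> carrier_mat q q" and L: "L \<in> carrier_mat q q" and BL: "B * L = 1\<^sub>m q"
    and RD: "R * D2 = B" "R * D1 = 0\<^sub>m q (p + 1 - q)"
    and iW: "inv_mat (R * inv_mat (S_mat p \<mu> \<Sigma>) * R\<^sup>T) = L\<^sup>T * L"
    and H: "H \<in> carrier_mat p p" "H\<^sup>T * \<Sigma> * H = 1\<^sub>m p"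
    and D1_first: "\<And>i. i < p + 1 \<Longrightarrow> D1 $$ (i, 0) = of_bool (i = 0)"
    and D2_top: "\<And>j. j < q \<Longrightarrow> D2 $$ (0, j) = - (\<Sum>l<p. \<mu> $ l * H $$ (l, j))"
    and D2_low: "\<And>l j. l < p \<Longrightarrow> j < q \<Longrightarrow> D2 $$ (Suc l, j) = H $$ (l, j)"
    and D1_top: "\<And>j. 0 < j \<Longrightarrow> j < p + 1 - q \<Longrightarrow> D1 $$ (0, j) = - (\<Sum>l<p. \<mu> $ l * H $$ (l, q - 1 + j))"
    and D1_low: "\<And>l j. l < p \<Longrightarrow> 0 < j \<Longrightarrow> j < p + 1 - q \<Longrightarrow> D1 $$ (Suc l, j) = H $$ (l, q - 1 + j)"
    by (rule adapted_basis[OF rm R0 \<mu> \<Sigma>]) blast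
  define W where "W = warray H"
  interpret arr: regression_array M W n p q \<kappa> E2 E1
    by unfold_locales
      (use indep_warray[OF H] warray_law[OF H] warray_err_moments[OF H _ int4 m4] \<kappa> q1 qp dims E2 E1
        in \<open>auto simp: W_def\<close>)
  define U where "U \<omega> = design_mat n p x \<omega>" for \<omega>
  have U: "U \<omega> \<in> carrier_mat n (p + 1)" for \<omega> by (simp add: U_def design_mat_def)
  have row_mult: "(U \<omega> * D) $$ (i, j) = D $$ (0, j) + (\<Sum>l<p. x i \<omega> l * D $$ (Suc l, j))"
    if "D \<in> carrier_mat (p + 1) c" "i < n" "j < c" for D c i j \<omega>
  proof -
    have "(U \<omega> * D) $$ (i, j) = (\<Sum>l<Suc p. U \<omega> $$ (i, l) * D $$ (l, j))"
      using U[of \<omega>] that by (simp add: scalar_prod_sum del: sum.lessThan_Suc)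
    also have "\<dots> = D $$ (0, j) + (\<Sum>l<p. x i \<omega> l * D $$ (Suc l, j))"
      unfolding sum.lessThan_Suc_shift using that by (simp add: U_def design_mat_def)
    finally show ?thesis .
  qed
  \<comment> \<open>The top entries of \<open>D2\<close> and \<open>D1\<close> multiply the constant
    regressor and so subtract the mean of the combination formed by the lower entries.\<close>
  have centre: "- (\<Sum>l<p. \<mu> $ l * H $$ (l, j)) + (\<Sum>l<p. x i \<omega> l * H $$ (l, j)) = W (i, j) \<omega>"
    if "i < n" "j < p" for i j \<omega>
    using that by (simp add: W_def warray_def sum_subtractf algebra_simps)
  have Zm: "arr.Zm (\<lambda>t. W t \<omega>) = U \<omega> * D2" for \<omega>
  proof (rule eq_matI)
    fix i j assume "i < dim_row (U \<omega> * D2)" "j < dim_col (U \<omega> * D2)"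
    hence ij: "i < n" "j < q" using U[of \<omega>] D2 by auto
    have "(U \<omega> * D2) $$ (i, j) = - (\<Sum>l<p. \<mu> $ l * H $$ (l, j)) + (\<Sum>l<p. x i \<omega> l * H $$ (l, j))"
      unfolding row_mult[OF D2 ij] using ij by (simp add: D2_top D2_low)
    also have "\<dots> = W (i, j) \<omega>" using ij qp by (intro centre) auto
    finally show "arr.Zm (\<lambda>t. W t \<omega>) $$ (i, j) = (U \<omega> * D2) $$ (i, j)" using ij by (simp add: arr.Zm_def)
  qed (use U[of \<omega>] D2 in \<open>auto simp: arr.Zm_def\<close>)
  have Vm: "arr.Vm (\<lambda>t. W t \<omega>) = U \<omega> * D1" for \<omega>
  proof (rule eq_matI)
    fix i j assume "i < dim_row (U \<omega> * D1)" "j < dim_col (U \<omega> * D1)"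
    hence ij: "i < n" "j < p + 1 - q" using U[of \<omega>] D1 by auto
    show "arr.Vm (\<lambda>t. W t \<omega>) $$ (i, j) = (U \<omega> * D1) $$ (i, j)"
    proof (cases "j = 0")
      case True
      have "(U \<omega> * D1) $$ (i, 0) = 1"
        using row_mult[OF D1 ij] True D1_first by simp
      thus ?thesis using ij True by (simp add: arr.Vm_def intercept_mat_def)
    next
      case False
      have "(U \<omega> * D1) $$ (i, j) = - (\<Sum>l<p. \<mu> $ l * H $$ (l, q - 1 + j)) + (\<Sum>l<p. x i \<omega> l * H $$ (l, q - 1 + j))"
        unfolding row_mult[OF D1 ij] using ij False by (simp add: D1_top D1_low)
      also have "\<dots> = W (i, q - 1 + j) \<omega>" using ij q1 by (intro centre) auto
      finally show ?thesis using ij False by (simp add: arr.Vm_def intercept_mat_def)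
    qed
  qed (use U[of \<omega>] D1 in \<open>auto simp: arr.Vm_def intercept_mat_def\<close>)
  have Um: "arr.Um (\<lambda>t. W t \<omega>) = U \<omega>" for \<omega>
  proof -
    have "arr.Um (\<lambda>t. W t \<omega>) = U \<omega> * (D2 * E2 + D1 * E1)"
      unfolding arr.Um_def Zm Vm using U[of \<omega>] D2 D1 E2 E1
      by (subst mult_add_distrib_mat_dim) (auto simp: assoc_mult_mat_dim)
    thus ?thesis unfolding DE using U[of \<omega>] by simp
  qed
  define \<gamma> where "\<gamma> = vCons \<alpha> \<beta>"
  have \<gamma>: "\<gamma> \<in> carrier_vec (p + 1)" using dims by (auto simp: \<gamma>_def)
  have Y: "response_vec n y \<omega> = arr.Um (\<lambda>t. W t \<omega>) *\<^sub>v \<gamma> + \<sigma> \<cdot>\<^sub>v arr.epsv (\<lambda>t. W t \<omega>)" for \<omega>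
  proof (rule eq_vecI)
    fix i assume "i < dim_vec (arr.Um (\<lambda>t. W t \<omega>) *\<^sub>v \<gamma> + \<sigma> \<cdot>\<^sub>v arr.epsv (\<lambda>t. W t \<omega>))"
    hence i: "i < n" by (simp add: arr.epsv_def)
    have "(U \<omega> *\<^sub>v \<gamma>) $ i = (\<Sum>l<Suc p. U \<omega> $$ (i, l) * \<gamma> $ l)"
      using U[of \<omega>] i \<gamma> by (simp add: scalar_prod_sum del: sum.lessThan_Suc)
    also have "\<dots> = \<alpha> + (\<Sum>l<p. x i \<omega> l * \<beta> $ l)"
      unfolding sum.lessThan_Suc_shift using i by (simp add: U_def design_mat_def \<gamma>_def)
    also have "\<dots> = \<alpha> + \<beta> \<bullet> vec p (x i \<omega>)" by (simp add: scalar_prod_sum mult.commute)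
    finally show "response_vec n y \<omega> $ i = (arr.Um (\<lambda>t. W t \<omega>) *\<^sub>v \<gamma> + \<sigma> \<cdot>\<^sub>v arr.epsv (\<lambda>t. W t \<omega>)) $ i"
      unfolding Um using i U[of \<omega>] dims by (simp add: response_vec_def arr.epsv_def W_def warray_def err_def)
  qed (simp add: response_vec_def arr.epsv_def)
  define \<delta> where "\<delta> = (1 / \<sigma>) \<cdot>\<^sub>v (L *\<^sub>v (R *\<^sub>v \<gamma> - r))"
  \<comment> \<open>The inverse matrix inside the noncentrality is \<open>L'L\<close> by the choice
    of the basis.\<close>
  have \<Delta>: "\<Delta> = \<delta> \<bullet> \<delta>"
  proof -
    define d where "d = R *\<^sub>v \<gamma> - r"
    have d: "d \<in> carrier_vec q" unfolding d_def using R \<gamma> r by auto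
    have "d \<bullet> (L\<^sup>T * L *\<^sub>v d) = (L *\<^sub>v d) \<bullet> (L *\<^sub>v d)"
      using d L by (intro scalar_prod_mult_mat_vec_both[symmetric]) auto
    hence "\<Delta> = ((L *\<^sub>v d) \<bullet> (L *\<^sub>v d)) / \<sigma>\<^sup>2"
      by (simp add: \<Delta>_def Delta_gamma_def Let_def iW d_def \<gamma>_def)
    also have "\<dots> = \<delta> \<bullet> \<delta>"
      unfolding \<delta>_def d_def[symmetric] using d L by (simp add: power2_eq_square)
    finally show ?thesis .
  qed
  hence \<Delta>0: "0 \<le> \<Delta>" by (simp add: scalar_prod_self_nonneg)
  define G where "G \<omega> = arr.gsq (\<lambda>t. W t \<omega>)" for \<omega>
  have G0: "0 \<le> G \<omega>" for \<omega> by (simp add: G_def arr.gsq_def sum_nonneg)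
  have "\<exists>C\<in>events. prob C \<le> 4 * (\<kappa> + 2) * (real q + real q ^ 2 + 2) / (\<eta>\<^sup>2 * (real n - real (p + 1))) \<and>
        (\<forall>\<omega>\<in>space M - C. \<exists>N d. F_statistic n p q R r (design_mat n p x \<omega>) (response_vec n y \<omega>) = (N / real q) / d \<and>
          \<bar>N - G \<omega>\<bar> \<le> (4 * real q + 5) * \<eta> * (1 + G \<omega>) \<and> \<bar>d - 1\<bar> \<le> \<eta>)"
    if \<eta>: "0 < \<eta>" "real q * \<eta> \<le> 1 / 2" "real n * \<Delta> \<le> \<eta>\<^sup>2" for \<eta>
  proof -
    have "(real n - real (p + 1 - q)) * \<Delta> \<le> real n * \<Delta>" using \<Delta>0 by (intro mult_right_mono) auto
    hence small: "(real n - real (p + 1 - q)) * (\<delta> \<bullet> \<delta>) \<le> \<eta>\<^sup>2" using \<eta>(3) \<Delta> by simp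
    obtain C where C: "C \<in> events"
      "prob C \<le> 4 * (\<kappa> + 2) * (real q + real q ^ 2 + 2) / (\<eta>\<^sup>2 * (real n - real (p + 1)))"
      "\<And>\<omega>. \<omega> \<in> space M - C \<Longrightarrow> arr.good \<eta> (\<lambda>t. W t \<omega>)"
      using arr.good_outside_small_event[OF \<eta>(1)] by blast
    have "\<exists>N d. F_statistic n p q R r (design_mat n p x \<omega>) (response_vec n y \<omega>) = (N / real q) / d \<and>
          \<bar>N - G \<omega>\<bar> \<le> (4 * real q + 5) * \<eta> * (1 + G \<omega>) \<and> \<bar>d - 1\<bar> \<le> \<eta>" if "\<omega> \<in> space M - C" for \<omega>
      using arr.F_statistic_approx[OF C(3)[OF that] \<eta>(1,2) R r \<gamma> D2 D1 DE ED B L BL RD dims(4) Y \<delta>_def small]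
      unfolding Um U_def G_def .
    with C show ?thesis by blast
  qed
  moreover have "G \<in> borel_measurable M" unfolding G_def[abs_def] by (rule arr.gsq_measurable)
  moreover have "distr M borel G = chi_squared q" unfolding G_def[abs_def] by (rule arr.gsq_law)
  ultimately show ?thesis using \<Delta>0 qp G0 by blast
qed

lemma F_statistic_random_variable:
  assumes R: "R \<in> carrier_mat q (p + 1)" and r: "r \<in> carrier_vec q"
  shows "(\<lambda>\<omega>. F_statistic n p q R r (design_mat n p x \<omega>) (response_vec n y \<omega>)) \<in> borel_measurable M"
proof (rule F_statistic_measurable[OF _ _ R r])
  show "mat_measurable M n (p + 1) (design_mat n p x)"
    unfolding mat_measurable_def
  proof (intro conjI ballI allI impI)
    fix i j assume ij: "i < n" "j < p + 1"
    have "(\<lambda>\<omega>. x i \<omega> (j - 1)) \<in> borel_measurable M" if "j \<noteq> 0"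
      using measurable_compose[OF x_measurable[OF ij(1)] measurable_component_singleton[of "j - 1" "{..<p}" "\<lambda>_. lborel"]] that ij
      by simp
    thus "(\<lambda>\<omega>. design_mat n p x \<omega> $$ (i, j)) \<in> borel_measurable M"
      using ij by (cases "j = 0") (auto simp: design_mat_def)
  qed (simp add: design_mat_def)
  show "vec_measurable M n (response_vec n y)"
    using y_measurable by (auto simp: vec_measurable_def response_vec_def)
qed

end

section \<open>The limit theorem\<close>

lemma ereal_limsup_less_one:
  assumes "limsup (\<lambda>n. ereal (f n)) < 1"
  obtains \<rho> where "\<rho> < 1" "\<forall>\<^sub>F n in sequentially. f n < \<rho>"
proof -
  obtain z where z: "limsup (\<lambda>n. ereal (f n)) < ereal z" "ereal z < 1"
    using ereal_dense2[OF assms] by blast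
  have "\<forall>\<^sub>F n in sequentially. ereal (f n) < ereal z" using z(1) by (rule Limsup_lessD)
  thus thesis using z(2) by (intro that[of z]) auto
qed

lemma powr_neg_half: "z powr (- 1 / 2) = 1 / sqrt z" if "0 < z" for z :: real
proof -
  have "z powr (- 1 / 2) = inverse (z powr (1 / 2))" by (metis powr_minus minus_divide_left)
  thus ?thesis using that powr_half_sqrt[of z] by (simp only: inverse_eq_divide)
qed

lemma sqrt_half_div: "0 < r \<Longrightarrow> sqrt (r / 2) / r = (2 * r) powr (- 1 / 2)" for r :: real
  proof -
    assume q: "0 < r"
    have "sqrt (r / 2) * sqrt (2 * r) = sqrt (r / 2 * (2 * r))"
      by (rule real_sqrt_mult[symmetric])
    also have "r / 2 * (2 * r) = r\<^sup>2" by (simp add: power2_eq_square)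
    finally have "sqrt (r / 2) * sqrt (2 * r) = r" using q by simp
    moreover have "0 < sqrt (2 * r)" using q by (simp only: real_sqrt_gt_0_iff)
    ultimately have "sqrt (r / 2) = r / sqrt (2 * r)" by (metis nonzero_mult_div_cancel_right less_irrefl)
    hence "sqrt (r / 2) / r = 1 / sqrt (2 * r)"
      using q by simp
    thus ?thesis using q powr_neg_half[of "2 * r"] by simp
  qed

theorem theorem3p1:
  fixes M :: "nat \<Rightarrow> 'a measure"
    and N q :: nat
    and p :: "nat \<Rightarrow> nat"
    and y :: "nat \<Rightarrow> nat \<Rightarrow> 'a \<Rightarrow> real"
    and x :: "nat \<Rightarrow> nat \<Rightarrow> 'a \<Rightarrow> nat \<Rightarrow> real"
    and \<alpha> \<sigma> \<Delta> :: "nat \<Rightarrow> real"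
    and \<beta> \<gamma> \<mu> r\<^sub>0 :: "nat \<Rightarrow> real vec"
    and \<Sigma> R\<^sub>0 :: "nat \<Rightarrow> real mat"
    and F :: "nat \<Rightarrow> 'a \<Rightarrow> real"
  defines "\<mu> \<equiv> \<lambda>n. mean_vec (M n) (p n) (x n 0)"
    and "\<Sigma> \<equiv> \<lambda>n. cov_mat (M n) (p n) (x n 0)"
    and "\<gamma> \<equiv> \<lambda>n. vCons (\<alpha> n) (\<beta> n)"
    and "\<Delta> \<equiv> \<lambda>n. Delta_gamma (R\<^sub>0 n) (r\<^sub>0 n) (S_mat (p n) (\<mu> n) (\<Sigma> n)) (\<gamma> n) (\<sigma> n)"
    and "F \<equiv> \<lambda>n \<omega>. F_statistic n (p n) q (R\<^sub>0 n) (r\<^sub>0 n)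
               (design_mat n (p n) (x n) \<omega>) (response_vec n (y n) \<omega>)"
  assumes model: "\<And>n. n \<ge> N \<Longrightarrow> linear_model (M n) n (p n) (y n) (x n) (\<alpha> n) (\<beta> n) (\<sigma> n)"
    and gaussian: "\<And>n i. n \<ge> N \<Longrightarrow> i < n \<Longrightarrow> gaussian (M n) (p n) (x n i) (\<mu> n) (\<Sigma> n)"
    and indep: "\<And>n. n \<ge> N \<Longrightarrow> design_indep_errors (M n) n (p n) (y n) (x n)"
    and moment_finite: "\<forall>\<^sub>F n in sequentially.
          integrable (M n) (\<lambda>\<omega>. (model_error (M n) (p n) (y n 0) (x n 0) \<omega> / \<sigma> n) ^ 4)"
    and moment: "(\<lambda>n. \<integral>\<omega>. (model_error (M n) (p n) (y n 0) (x n 0) \<omega> / \<sigma> n) ^ 4 \<partial>M n)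
          \<in> O(\<lambda>_. 1)"
    and dimension: "limsup (\<lambda>n. ereal (real (p n) / real n)) < 1"
    and restriction: "\<And>n. n \<ge> N \<Longrightarrow> restriction_mat q (p n + 1) (R\<^sub>0 n)"
    and r0: "\<And>n. n \<ge> N \<Longrightarrow> r\<^sub>0 n \<in> carrier_vec q"
    and no_intercept: "\<And>n. n \<ge> N \<Longrightarrow> col (R\<^sub>0 n) 0 = 0\<^sub>v q"
    and alternatives: "\<Delta> \<in> o(\<lambda>n. real q / real n)"
  shows "weak_conv_m
    (\<lambda>n. distr (M n) borel (\<lambda>\<omega>. s_seq n (p n) q powr (- 1 / 2) * (F n \<omega> - 1)
                                   - sqrt (real n) * \<Delta> n * b_seq n (p n) q))
    (distr (chi_squared q) borel (\<lambda>k. (2 * real q) powr (- 1 / 2) * k - sqrt (real q / 2)))"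
proof -
  have glm: "gaussian_linear_model (M n) n (p n) (y n) (x n) (\<alpha> n) (\<beta> n) (\<sigma> n)" if "n \<ge> N" for n
    by (rule gaussian_linear_model.intro[OF model[OF that] gaussian[OF that, unfolded \<mu>_def \<Sigma>_def] indep[OF that]])
  have q: "1 \<le> q" using restriction[of N] by (simp add: restriction_mat_def)
  obtain c where c: "\<forall>\<^sub>F n in sequentially.
      norm (\<integral>\<omega>. (model_error (M n) (p n) (y n 0) (x n 0) \<omega> / \<sigma> n) ^ 4 \<partial>M n) \<le> c * norm (1 :: real)"
    using landau_o.bigE[OF moment] by blast
  \<comment> \<open>The 3 is the normal fourth moment, needed for the design columns;
    \<open>c\<close> bounds the error moments for large \<open>n\<close>.\<close>
  define \<kappa> where "\<kappa> = max 3 c"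
  have \<kappa>: "3 \<le> \<kappa>" by (simp add: \<kappa>_def)
  have "\<forall>\<^sub>F n in sequentially. n \<ge> N \<and>
      integrable (M n) (\<lambda>\<omega>. (model_error (M n) (p n) (y n 0) (x n 0) \<omega> / \<sigma> n) ^ 4) \<and>
      (\<integral>\<omega>. (model_error (M n) (p n) (y n 0) (x n 0) \<omega> / \<sigma> n) ^ 4 \<partial>M n) \<le> \<kappa>"
    using moment_finite c eventually_ge_at_top[of N]
    by eventually_elim (auto simp: \<kappa>_def le_max_iff_disj)
  then obtain N0 where N0: "\<And>n. n \<ge> N0 \<Longrightarrow> n \<ge> N"
    "\<And>n. n \<ge> N0 \<Longrightarrow> integrable (M n) (\<lambda>\<omega>. (model_error (M n) (p n) (y n 0) (x n 0) \<omega> / \<sigma> n) ^ 4)"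
    "\<And>n. n \<ge> N0 \<Longrightarrow> (\<integral>\<omega>. (model_error (M n) (p n) (y n 0) (x n 0) \<omega> / \<sigma> n) ^ 4 \<partial>M n) \<le> \<kappa>"
    unfolding eventually_sequentially by blast
  define m' where "m' n = real n - real (p n + 1)" for n
  define C0 where "C0 = 4 * (\<kappa> + 2) * (real q + real q ^ 2 + 2)"
  have C0: "0 < C0" using \<kappa> by (simp add: C0_def add_nonneg_pos)
  define small where "small n G \<eta> \<longleftrightarrow> (\<exists>B\<in>sets (M n). measure (M n) B \<le> C0 / (\<eta>\<^sup>2 * m' n) \<and>
      (\<forall>\<omega>\<in>space (M n) - B. \<exists>N d. F n \<omega> = (N / real q) / d \<and>
        \<bar>N - G \<omega>\<bar> \<le> (4 * real q + 5) * \<eta> * (1 + G \<omega>) \<and> \<bar>d - 1\<bar> \<le> \<eta>))" for n G \<eta>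
  define L where "L n G \<longleftrightarrow> G \<in> borel_measurable (M n) \<and> distr (M n) borel G = chi_squared q \<and> (\<forall>\<omega>. 0 \<le> G \<omega>) \<and>
    (\<forall>\<eta>. 0 < \<eta> \<and> real q * \<eta> \<le> 1 / 2 \<and> real n * \<Delta> n \<le> \<eta>\<^sup>2 \<longrightarrow> small n G \<eta>)" for n G
  have lim: "0 \<le> \<Delta> n \<and> q \<le> p n \<and> (\<exists>G. L n G)" if "n \<ge> N0" for n
    using gaussian_linear_model.limit_variable[OF glm[OF N0(1)[OF that]] restriction[OF N0(1)[OF that]]
        no_intercept[OF N0(1)[OF that]] r0[OF N0(1)[OF that]] \<kappa> N0(2)[OF that] N0(3)[OF that]]
    unfolding L_def small_def \<Delta>_def F_def \<gamma>_def \<mu>_def \<Sigma>_def C0_def m'_def .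
  define G where "G n = (SOME G. L n G)" for n
  have G: "L n (G n)" if "n \<ge> N0" for n
  proof -
    have "\<exists>G. L n G" using lim[OF that] by blast
    thus ?thesis unfolding G_def by (rule someI_ex)
  qed
  have Gm [measurable]: "G n \<in> borel_measurable (M n)" and G_law: "distr (M n) borel (G n) = chi_squared q"
    and G0: "0 \<le> G n \<omega>" if "n \<ge> N0" for n \<omega>
    using G[OF that] unfolding L_def by blast+
  have ps: "prob_space (M n)" if "n \<ge> N0" for n
    using model[OF N0(1)[OF that]] unfolding linear_model_def by blast
  have pn: "p n + 1 < n" if "n \<ge> N0" for n
    using model[OF N0(1)[OF that]] unfolding linear_model_def by blast
  obtain \<rho> where \<rho>: "\<rho> < 1" "\<forall>\<^sub>F n in sequentially. real (p n) / real n < \<rho>"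
    using ereal_limsup_less_one[OF dimension] by blast
  \<comment> \<open>From \<open>p n < \<rho> * n\<close> with \<open>\<rho> < 1\<close> follows
    \<open>m' n \<ge> (1 - \<rho>) * n - 1\<close>.\<close>
  have m'_lim: "filterlim m' at_top sequentially"
  proof (rule filterlim_at_top_mono)
    show "filterlim (\<lambda>n. - 1 + (1 - \<rho>) * real n) at_top sequentially"
      using \<rho>(1) by (intro filterlim_tendsto_add_at_top[OF tendsto_const]
        filterlim_tendsto_pos_mult_at_top[OF tendsto_const _ filterlim_real_sequentially]) simp
    show "\<forall>\<^sub>F n in sequentially. - 1 + (1 - \<rho>) * real n \<le> m' n"
      using \<rho>(2) eventually_gt_at_top[of 0]
    proof eventually_elim
      case (elim n)
      hence "real (p n) < \<rho> * real n" by (simp add: pos_divide_less_eq)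
      thus ?case by (simp add: m'_def algebra_simps)
    qed
  qed
  have n\<Delta>: "(\<lambda>n. real n * \<Delta> n) \<longlonglongrightarrow> 0"
  proof (rule LIMSEQ_I)
    fix e :: real assume e: "0 < e"
    have "\<forall>\<^sub>F n in sequentially. norm (\<Delta> n) \<le> (e / (2 * real q)) * norm (real q / real n)"
      using e q by (intro landau_o.smallD[OF alternatives]) simp
    hence "\<forall>\<^sub>F n in sequentially. norm (real n * \<Delta> n - 0) < e"
      using eventually_gt_at_top[of 0]
    proof eventually_elim
      case (elim n)
      have "norm (real n * \<Delta> n) = real n * norm (\<Delta> n)" by (simp add: abs_mult)
      also have "\<dots> \<le> real n * ((e / (2 * real q)) * norm (real q / real n))"
        using elim by (intro mult_left_mono) auto
      also have "\<dots> = e / 2" using elim q by simp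
      finally show ?case using e by simp
    qed
    thus "\<exists>no. \<forall>n\<ge>no. norm (real n * \<Delta> n - 0) < e" by (simp add: eventually_sequentially)
  qed
  define c0 where "c0 = sqrt (real q / 2)"
  have c0: "0 \<le> c0" by (simp add: c0_def)
  have c0q: "c0 / real q = (2 * real q) powr (- 1 / 2)"
    unfolding c0_def by (rule sqrt_half_div) (use q in linarith)
  define cs where "cs n = s_seq n (p n) q powr (- 1 / 2)" for n
  \<comment> \<open>The reciprocal of \<open>n - p - 1\<close> vanishes, so the scale tends to
    \<open>2 / q\<close>, whose power \<open>- 1 / 2\<close> is \<open>c0\<close>.\<close>
  have cs: "cs \<longlonglongrightarrow> c0"
  proof -
    have "(\<lambda>n. 2 * (1 / real q + inverse (m' n))) \<longlonglongrightarrow> 2 * (1 / real q + 0)"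
      by (intro tendsto_intros tendsto_inverse_0_at_top m'_lim)
    hence "(\<lambda>n. s_seq n (p n) q) \<longlonglongrightarrow> 2 / real q"
      unfolding s_seq_def m'_def inverse_eq_divide of_nat_add of_nat_1 diff_diff_eq by simp
    hence "(\<lambda>n. s_seq n (p n) q powr (- 1 / 2)) \<longlonglongrightarrow> (2 / real q) powr (- 1 / 2)"
      using q by (intro tendsto_powr tendsto_const) auto
    moreover have "(2 / real q) powr (- 1 / 2) = c0"
      using q powr_neg_half[of "2 / real q"] unfolding c0_def by (simp add: real_sqrt_divide)
    ultimately show ?thesis by (simp add: cs_def[abs_def])
  qed
  define t where "t n = sqrt (real n) * \<Delta> n * b_seq n (p n) q" for n
  \<comment> \<open>As \<open>q \<le> p n\<close>, both factors under the root of
    \<open>b_seq\<close> are at most 1, so its square is at most \<open>n / (2 * q)\<close> and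
    \<open>b_seq\<close> at most \<open>sqrt n\<close>; together with the explicit
    \<open>sqrt n\<close> this makes \<open>n\<close>.\<close>
  have t_bound: "\<bar>t n\<bar> \<le> real n * \<Delta> n" if "n \<ge> N0" for n
  proof -
    have n: "0 < real n" using pn[OF that] by simp
    define u where "u = 1 - (real (p n) + 1) / real n"
    have u: "0 \<le> u" "u + real q / real n \<le> 1" "u \<le> 1"
    proof -
      show "0 \<le> u" using pn[OF that] n by (simp add: u_def)
      show "u \<le> 1" using n by (simp add: u_def)
      have "real q / real n \<le> (real (p n) + 1) / real n"
        using lim[OF that] n by (intro divide_right_mono) auto
      thus "u + real q / real n \<le> 1" by (simp add: u_def)
    qed
    have "u * (u + real q / real n) \<le> 1 * 1" using u n by (intro mult_mono) auto
    hence "u * (u + real q / real n) / (2 * real q / real n) \<le> 1 / (2 * real q / real n)"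
      using q n by (intro divide_right_mono) auto
    also have "\<dots> = real n / (2 * real q)" by simp
    also have "\<dots> \<le> real n / 1" using q n by (intro divide_left_mono) auto
    finally have b: "b_seq n (p n) q \<le> sqrt (real n)"
      unfolding b_seq_def u_def[symmetric] by (simp add: add_divide_distrib[symmetric])
    have b0: "0 \<le> b_seq n (p n) q" using u n unfolding b_seq_def u_def[symmetric] by simp
    have "\<bar>t n\<bar> = sqrt (real n) * b_seq n (p n) q * \<Delta> n"
      using lim[OF that] b0 by (simp add: t_def abs_mult)
    also have "\<dots> \<le> sqrt (real n) * sqrt (real n) * \<Delta> n"
      using b lim[OF that] by (intro mult_right_mono mult_left_mono) auto
    finally show ?thesis by simp
  qed
  define Y where "Y n \<omega> = cs n * (F n \<omega> - 1) - t n" for n \<omega>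
  \<comment> \<open>This variable has the limit law exactly, for every \<open>n\<close>:
    \<open>c0 / q\<close> is \<open>(2 * q) powr (- 1 / 2)\<close>, and the constant
    \<open>c0\<close> is the square root of \<open>q / 2\<close>.\<close>
  define X where "X n \<omega> = c0 * (G n \<omega> / real q - 1)" for n \<omega>
  have Xm: "X n \<in> borel_measurable (M n)" if "n \<ge> N0" for n
    unfolding X_def[abs_def] using Gm[OF that] by measurable
  have Ym: "Y n \<in> borel_measurable (M n)" if "n \<ge> N0" for n
  proof -
    have "R\<^sub>0 n \<in> carrier_mat q (p n + 1)" using restriction[OF N0(1)[OF that]] by (simp add: restriction_mat_def)
    hence "F n \<in> borel_measurable (M n)" unfolding F_def
      by (rule gaussian_linear_model.F_statistic_random_variable[OF glm[OF N0(1)[OF that]] _ r0[OF N0(1)[OF that]]])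
    thus ?thesis unfolding Y_def[abs_def] by measurable
  qed
  have X_law: "distr (M n) borel (X n)
      = distr (chi_squared q) borel (\<lambda>k. (2 * real q) powr (- 1 / 2) * k - sqrt (real q / 2))" if "n \<ge> N0" for n
  proof -
    have "X n = (\<lambda>k. (2 * real q) powr (- 1 / 2) * k - sqrt (real q / 2)) \<circ> G n"
      unfolding X_def[abs_def] c0q[symmetric] c0_def[symmetric] o_def by (simp add: right_diff_distrib)
    thus ?thesis unfolding G_law[OF that, symmetric] using Gm[OF that] by (subst distr_distr) auto
  qed
  have close: "(\<lambda>n. measure (M n) {\<omega> \<in> space (M n). \<bar>Y n \<omega> - X n \<omega>\<bar> > \<zeta>}) \<longlonglongrightarrow> 0" if \<zeta>: "\<zeta> > 0" for \<zeta>
  proof (rule LIMSEQ_I)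
    fix e :: real assume e: "0 < e"
    \<comment> \<open>Tightness: the law of \<open>G n\<close> does not change with
      \<open>n\<close>, so one truncation level \<open>K\<close> serves all \<open>n\<close>. That
      this law is a probability on the line is inherited from \<open>G N0\<close>.\<close>
    interpret chi: real_distribution "chi_squared q"
    proof -
      interpret prob_space "M N0" by (rule ps) simp
      have "real_distribution (distr (M N0) borel (G N0))" by (rule real_distribution_distr) (rule Gm, simp)
      thus "real_distribution (chi_squared q)" using G_law[of N0] by simp
    qed
    have "\<forall>\<^sub>F K in at_top. dist (cdf (chi_squared q) K) 1 < e / 2"
      using chi.cdf_lim_at_top_prob e by (intro tendstoD) auto
    hence "\<forall>\<^sub>F K in at_top. 0 \<le> K \<and> dist (cdf (chi_squared q) K) 1 < e / 2"
      using eventually_ge_at_top[of 0] by eventually_elim blast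
    then obtain K where K: "0 \<le> K" "dist (cdf (chi_squared q) K) 1 < e / 2"
      unfolding eventually_at_top_linorder by blast
    have GK: "measure (M n) {\<omega> \<in> space (M n). K < G n \<omega>} < e / 2" if "n \<ge> N0" for n
    proof -
      interpret prob_space "M n" by (rule ps[OF that])
      have g: "G n \<in> borel_measurable (M n)" by (rule Gm[OF that])
      have "cdf (chi_squared q) K = measure (M n) {\<omega> \<in> space (M n). G n \<omega> \<le> K}"
        unfolding G_law[OF that, symmetric] cdf_def using g
        by (subst measure_distr) (auto simp: vimage_def Int_def conj_commute)
      moreover have "measure (M n) {\<omega> \<in> space (M n). K < G n \<omega>} = 1 - measure (M n) {\<omega> \<in> space (M n). G n \<omega> \<le> K}"
      proof -
        have "{\<omega> \<in> space (M n). K < G n \<omega>} = space (M n) - {\<omega> \<in> space (M n). G n \<omega> \<le> K}" by auto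
        moreover have "{\<omega> \<in> space (M n). G n \<omega> \<le> K} \<in> sets (M n)" using g by measurable
        ultimately show ?thesis by (simp add: prob_compl)
      qed
      ultimately show ?thesis using K(2) by (simp add: dist_real_def abs_if split: if_splits)
    qed
    \<comment> \<open>The factor of \<eta> in \<open>centred_statistic_close\<close>.\<close>
    define CK where "CK = (c0 + 1) * (2 * (4 * real q + 5) * (1 + K) + 2 * K) + K + 2"
    have CK: "0 < CK" unfolding CK_def using c0 K by (intro add_nonneg_pos add_nonneg_nonneg mult_nonneg_nonneg) auto
    \<comment> \<open>The first bound gives \<open>real q * \<eta> \<le> 1 / 2\<close> for the
      perturbation estimates, the second brings the total error below \<zeta>.\<close>
    define \<eta> where "\<eta> = min (1 / (2 * real q)) (\<zeta> / CK)"
    have \<eta>: "0 < \<eta>" "real q * \<eta> \<le> 1 / 2" "CK * \<eta> \<le> \<zeta>"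
    proof -
      show "0 < \<eta>" using q \<zeta> CK by (simp add: \<eta>_def)
      have "real q * \<eta> \<le> real q * (1 / (2 * real q))" by (intro mult_left_mono) (auto simp: \<eta>_def)
      thus "real q * \<eta> \<le> 1 / 2" using q by simp
      have "CK * \<eta> \<le> CK * (\<zeta> / CK)" using CK by (intro mult_left_mono) (auto simp: \<eta>_def)
      thus "CK * \<eta> \<le> \<zeta>" using CK by simp
    qed
    have \<eta>2: "\<eta> \<le> 1 / 2"
    proof -
      have "1 * \<eta> \<le> real q * \<eta>" using q \<eta> by (intro mult_right_mono) auto
      thus ?thesis using \<eta> by linarith
    qed
    \<comment> \<open>The threshold beyond which the exceptional event has probability below
      \<open>e / 2\<close>; the other half of \<open>e\<close> is spent on large values of
      \<open>G n\<close>.\<close>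
    have "\<forall>\<^sub>F n in sequentially. C0 / (\<eta>\<^sup>2 * (e / 2)) < m' n"
      using m'_lim by (simp add: filterlim_at_top_dense)
    moreover have "\<forall>\<^sub>F n in sequentially. dist (real n * \<Delta> n) 0 < \<eta>\<^sup>2"
      using \<eta> by (intro tendstoD[OF n\<Delta>]) simp
    moreover have "\<forall>\<^sub>F n in sequentially. dist (cs n) c0 < \<eta>"
      using \<eta> by (intro tendstoD[OF cs])
    ultimately have "\<forall>\<^sub>F n in sequentially. norm (measure (M n) {\<omega> \<in> space (M n). \<bar>Y n \<omega> - X n \<omega>\<bar> > \<zeta>} - 0) < e"
      using eventually_ge_at_top[of N0]
    proof eventually_elim
      case (elim n)
      interpret prob_space "M n" by (rule ps[OF elim(4)])
      have nd: "real n * \<Delta> n \<le> \<eta>\<^sup>2" using elim(2) by (simp add: dist_real_def)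
      have "small n (G n) \<eta>" using G[OF elim(4)] \<eta>(1,2) nd unfolding L_def by blast
      then obtain B where B: "B \<in> sets (M n)" "measure (M n) B \<le> C0 / (\<eta>\<^sup>2 * m' n)"
        and B_compl: "\<forall>\<omega>\<in>space (M n) - B. \<exists>N d. F n \<omega> = (N / real q) / d \<and>
          \<bar>N - G n \<omega>\<bar> \<le> (4 * real q + 5) * \<eta> * (1 + G n \<omega>) \<and> \<bar>d - 1\<bar> \<le> \<eta>"
        unfolding small_def by (elim bexE conjE)
      have m'0: "0 < m' n" using pn[OF elim(4)] by (simp add: m'_def)
      have "C0 < m' n * (\<eta>\<^sup>2 * (e / 2))"
        using elim(1) \<eta> e by (subst (asm) pos_divide_less_eq) auto
      hence "C0 / (\<eta>\<^sup>2 * m' n) < e / 2"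
        using \<eta> m'0 by (subst pos_divide_less_eq) (auto simp: mult_ac)
      hence PB: "measure (M n) B < e / 2" using B(2) by linarith
      have t: "\<bar>t n\<bar> \<le> \<eta>"
      proof -
        have "\<eta>\<^sup>2 \<le> \<eta>" using \<eta> \<eta>2 by (simp add: power2_eq_square mult_left_le)
        thus ?thesis using t_bound[OF elim(4)] nd by linarith
      qed
      have cc: "\<bar>cs n - c0\<bar> \<le> \<eta>" using elim(3) by (simp add: dist_real_def)
      have GKm: "{\<omega> \<in> space (M n). K < G n \<omega>} \<in> sets (M n)" using Gm[OF elim(4)] by measurable
      have "{\<omega> \<in> space (M n). \<bar>Y n \<omega> - X n \<omega>\<bar> > \<zeta>} \<subseteq> B \<union> {\<omega> \<in> space (M n). K < G n \<omega>}"
      proof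
        fix \<omega> assume \<omega>: "\<omega> \<in> {\<omega> \<in> space (M n). \<bar>Y n \<omega> - X n \<omega>\<bar> > \<zeta>}"
        show "\<omega> \<in> B \<union> {\<omega> \<in> space (M n). K < G n \<omega>}"
        proof (rule ccontr)
          assume no: "\<omega> \<notin> B \<union> {\<omega> \<in> space (M n). K < G n \<omega>}"
          then obtain N' d where Nd: "F n \<omega> = (N' / real q) / d"
            "\<bar>N' - G n \<omega>\<bar> \<le> (4 * real q + 5) * \<eta> * (1 + G n \<omega>)" "\<bar>d - 1\<bar> \<le> \<eta>"
            using B_compl \<omega> by blast
          have "G n \<omega> \<le> K" using no \<omega> by auto
          from centred_statistic_close[OF q \<eta>(1) \<eta>2 G0[OF elim(4)] this Nd(2,3) cc t c0]
          have "\<bar>Y n \<omega> - X n \<omega>\<bar> \<le> CK * \<eta>" by (simp add: Y_def X_def Nd(1) CK_def)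
          thus False using \<omega> \<eta>(3) by auto
        qed
      qed
      hence "measure (M n) {\<omega> \<in> space (M n). \<bar>Y n \<omega> - X n \<omega>\<bar> > \<zeta>} \<le> measure (M n) (B \<union> {\<omega> \<in> space (M n). K < G n \<omega>})"
        using B(1) GKm by (intro finite_measure_mono) auto
      also have "\<dots> \<le> measure (M n) B + measure (M n) {\<omega> \<in> space (M n). K < G n \<omega>}"
        by (rule measure_Un_le[OF B(1) GKm])
      also have "\<dots> < e" using PB GK[OF elim(4)] by linarith
      finally show ?case by simp
    qed
    thus "\<exists>no. \<forall>n\<ge>no. norm (measure (M n) {\<omega> \<in> space (M n). \<bar>Y n \<omega> - X n \<omega>\<bar> > \<zeta>} - 0) < e"
      by (simp add: eventually_sequentially)
  qed
  have "weak_conv_m (\<lambda>n. distr (M n) borel (Y n))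
     (distr (chi_squared q) borel (\<lambda>k. (2 * real q) powr (- 1 / 2) * k - sqrt (real q / 2)))"
    by (rule weak_conv_m_of_close[OF ps Xm Ym X_law close])
  thus ?thesis by (simp add: Y_def[abs_def] cs_def t_def)
qed

end
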